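(* Let $M$ be a special $L(3)$-module. Then there is a commutative finite-dimensional local $k$-algebra $A$ with radical $J$ and an identification $A/J^2= L(3)$ such that ${}_AJ$, considered as an $A/J^2$-module, is isomorphic to $M$.
   Context: $k$ is an algebraically closed field. $L(3)=k\langle x,y,z\rangle/(x,y,z)^2$ is the $4$-dimensional local $k$-algebra with radical $E$ of dimension $3$ and $E^2=0$. Modules are finitely generated. The dimension vector of an $L(3)$-module $M$ is $(\dim M/EM,\dim EM)$. An $L(3)$-module is special if its dimension vector is $(3,2)$, it is faithful, it has no simple direct summand and it has no uniform submodule of length $3$ (uniform: simple socle). *)

theory Defs
  imports "Jordan_Normal_Form.VS_Connect" "HOL-Algebra.Ideal_Product" "HOL-Algebra.QuotRing"
begin

text \<open>The ground field is a type \<open>'k\<close> of class \<^class>\<open>alg_closed_field\<close>, viewed as the ring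
  \<^term>\<open>class_ring\<close>. Algebras and modules are records in the sense of \<open>HOL-Algebra\<close>. If a
  module record does not stand for an algebra, its fields \<^const>\<open>mult\<close> and \<^const>\<open>one\<close> carry no
  meaning; no notion below that concerns modules depends on them.\<close>


section \<open>Rings and modules\<close>

text \<open>Only meant for commutative rings, as \<^const>\<open>maximalideal\<close> refers to two-sided ideals.\<close>

definition radical :: "('a, 'c) ring_scheme \<Rightarrow> 'a set" where
  "radical R = {x \<in> carrier R. \<forall>I. maximalideal I R \<longrightarrow> x \<in> I}"

definition local_cring :: "('a, 'c) ring_scheme \<Rightarrow> bool" where
  "local_cring R \<longleftrightarrow> cring R \<and> (\<exists>!I. maximalideal I R)"

text \<open>The quotient of a module by a submodule, and likewise of an algebra by an ideal. Scalars act
  by \<open>c \<odot> (N +> x) = N +> (c \<odot> x)\<close>, written with a union over representatives as in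
  \<^const>\<open>rcoset_mult\<close>.\<close>

definition quot :: "('r, 'm, 'c) module_scheme \<Rightarrow> 'm set \<Rightarrow> ('r, 'm set) module" where
  "quot M N = \<lparr>carrier = carrier (M Quot N), mult = mult (M Quot N), one = one (M Quot N),
     zero = zero (M Quot N), add = add (M Quot N),
     smult = (\<lambda>c C. \<Union>x\<in>C. N +>\<^bsub>M\<^esub> (c \<odot>\<^bsub>M\<^esub> x))\<rparr>"

definition restrict_scalars ::
    "('r \<Rightarrow> 's) \<Rightarrow> ('s, 'm, 'c) module_scheme \<Rightarrow> ('r, 'm) module" where
  "restrict_scalars h M = \<lparr>carrier = carrier M, mult = mult M, one = one M,
     zero = zero M, add = add M, smult = (\<lambda>r x. h r \<odot>\<^bsub>M\<^esub> x)\<rparr>"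

text \<open>An ideal \<open>I\<close> of \<open>R\<close> as an \<open>R\<close>-module.\<close>

definition ideal_module :: "('a, 'c) ring_scheme \<Rightarrow> 'a set \<Rightarrow> ('a, 'a) module" where
  "ideal_module R I = \<lparr>carrier = I, mult = mult R, one = one R, zero = zero R, add = add R,
     smult = mult R\<rparr>"

definition annihilates :: "'r set \<Rightarrow> ('r, 'm, 'c) module_scheme \<Rightarrow> bool" where
  "annihilates I M \<longleftrightarrow> (\<forall>a\<in>I. \<forall>x\<in>carrier M. a \<odot>\<^bsub>M\<^esub> x = \<zero>\<^bsub>M\<^esub>)"

text \<open>An \<open>R\<close>-module considered as a module over \<open>R/I\<close>. If \<open>I\<close> annihilates \<open>M\<close>, then all
  representatives of a coset \<open>C\<close> act on \<open>x\<close> in the same way, and the image below is a singleton.\<close>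

definition module_over_quot :: "('r, 'm, 'c) module_scheme \<Rightarrow> ('r set, 'm) module" where
  "module_over_quot M = \<lparr>carrier = carrier M, mult = mult M, one = one M,
     zero = zero M, add = add M, smult = (\<lambda>C x. the_elem ((\<lambda>a. a \<odot>\<^bsub>M\<^esub> x) ` C))\<rparr>"

definition module_isomorphic ::
    "('r, 'a) ring_scheme \<Rightarrow> ('r, 'm, 'c) module_scheme \<Rightarrow> ('r, 'n, 'd) module_scheme \<Rightarrow> bool" where
  "module_isomorphic R M N \<longleftrightarrow> module R M \<and> module R N \<and>
     (\<exists>f \<in> LinearCombinations.module_hom R M N. bij_betw f (carrier M) (carrier N))"

definition algebra_iso ::
    "('k, 'a, 'c) module_scheme \<Rightarrow> ('k, 'b, 'd) module_scheme \<Rightarrow> ('a \<Rightarrow> 'b) set" where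
  "algebra_iso A B = {h \<in> ring_iso A B. \<forall>c. \<forall>x\<in>carrier A. h (c \<odot>\<^bsub>A\<^esub> x) = c \<odot>\<^bsub>B\<^esub> h x}"

definition finitely_generated ::
    "('r, 'a) ring_scheme \<Rightarrow> ('r, 'm, 'c) module_scheme \<Rightarrow> bool" where
  "finitely_generated R M \<longleftrightarrow>
     (\<exists>S. finite S \<and> S \<subseteq> carrier M \<and> LinearCombinations.module.span R M S = carrier M)"

definition faithful :: "('r, 'a) ring_scheme \<Rightarrow> ('r, 'm, 'c) module_scheme \<Rightarrow> bool" where
  "faithful R M \<longleftrightarrow>
     (\<forall>r\<in>carrier R. (\<forall>x\<in>carrier M. r \<odot>\<^bsub>M\<^esub> x = \<zero>\<^bsub>M\<^esub>) \<longrightarrow> r = \<zero>\<^bsub>R\<^esub>)"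

definition simple_module :: "('r, 'a) ring_scheme \<Rightarrow> ('r, 'm, 'c) module_scheme \<Rightarrow> bool" where
  "simple_module R M \<longleftrightarrow> module R M \<and> carrier M \<noteq> {\<zero>\<^bsub>M\<^esub>} \<and>
     (\<forall>N. LinearCombinations.submodule R N M \<longrightarrow> N = {\<zero>\<^bsub>M\<^esub>} \<or> N = carrier M)"

definition has_simple_summand :: "('r, 'a) ring_scheme \<Rightarrow> ('r, 'm, 'c) module_scheme \<Rightarrow> bool" where
  "has_simple_summand R M \<longleftrightarrow>
     (\<exists>S T. LinearCombinations.submodule R S M \<and> LinearCombinations.submodule R T M \<and>
        simple_module R (M\<lparr>carrier := S\<rparr>) \<and>
        S \<inter> T = {\<zero>\<^bsub>M\<^esub>} \<and> S <+>\<^bsub>M\<^esub> T = carrier M)"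

definition socle :: "('r, 'a) ring_scheme \<Rightarrow> ('r, 'm, 'c) module_scheme \<Rightarrow> 'm set" where
  "socle R M = LinearCombinations.module.span R M
     (\<Union>{S. LinearCombinations.submodule R S M \<and> simple_module R (M\<lparr>carrier := S\<rparr>)})"

definition uniform :: "('r, 'a) ring_scheme \<Rightarrow> ('r, 'm, 'c) module_scheme \<Rightarrow> bool" where
  "uniform R M \<longleftrightarrow> simple_module R (M\<lparr>carrier := socle R M\<rparr>)"

text \<open>\<open>M\<close> has a composition series with \<open>n\<close> factors.\<close>

definition has_length ::
    "('r, 'a) ring_scheme \<Rightarrow> ('r, 'm, 'c) module_scheme \<Rightarrow> nat \<Rightarrow> bool" where
  "has_length R M n \<longleftrightarrow>
     (\<exists>F. (\<forall>i\<le>n. LinearCombinations.submodule R (F i) M) \<and>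
        F 0 = {\<zero>\<^bsub>M\<^esub>} \<and> F n = carrier M \<and>
        (\<forall>i<n. F i \<subseteq> F (Suc i) \<and>
           simple_module R (quot (M\<lparr>carrier := F (Suc i)\<rparr>) (F i))))"

text \<open>The \<open>k\<close>-dimension of a module over a \<open>k\<close>-algebra \<open>A\<close>, where \<open>k\<close> acts through \<open>c \<mapsto> c \<odot> 1\<close>.\<close>

definition kdim ::
    "('k::field, 'a, 'c) module_scheme \<Rightarrow> ('a, 'm, 'd) module_scheme \<Rightarrow> nat" where
  "kdim A M = vectorspace.dim class_ring (restrict_scalars (\<lambda>c. c \<odot>\<^bsub>A\<^esub> \<one>\<^bsub>A\<^esub>) M)"

text \<open>The submodule \<open>IM\<close> generated by all products.\<close>

definition ideal_smult ::
    "('r, 'a) ring_scheme \<Rightarrow> 'r set \<Rightarrow> ('r, 'm, 'c) module_scheme \<Rightarrow> 'm set" where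
  "ideal_smult R I M = LinearCombinations.module.span R M {a \<odot>\<^bsub>M\<^esub> x | a x. a \<in> I \<and> x \<in> carrier M}"

definition dim_vector ::
    "('k::field, 'a, 'c) module_scheme \<Rightarrow> ('a, 'm, 'd) module_scheme \<Rightarrow> nat \<times> nat" where
  "dim_vector A M =
     (let EM = ideal_smult A (radical A) M
      in (kdim A (quot M EM), kdim A (M\<lparr>carrier := EM\<rparr>)))"

text \<open>Finite-dimensional commutative local \<open>k\<close>-algebras; commutativity is part of
  \<^const>\<open>algebra\<close>. An existence claim may fix the carrier type \<open>'k vec\<close>, since every
  finite-dimensional algebra has an isomorphic copy on a set of coordinate vectors.\<close>

definition fd_comm_local_algebra :: "('k::field, 'a, 'c) module_scheme \<Rightarrow> bool" where
  "fd_comm_local_algebra A \<longleftrightarrow>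
     algebra class_ring A \<and> vectorspace.fin_dim class_ring A \<and> local_cring A"


section \<open>The algebra \<open>L(3)\<close>\<close>

datatype letter = Lx | Ly | Lz

type_synonym 'k freealg = "letter list \<Rightarrow> 'k"

text \<open>The free associative algebra \<open>k\<langle>x,y,z\<rangle>\<close>: an element is given by its coefficients at the
  words, and the product is the convolution over all factorizations of a word.\<close>

definition free_algebra :: "('k::field, 'k freealg) module" where
  "free_algebra = \<lparr>carrier = {f. finite {w. f w \<noteq> 0}},
     mult = (\<lambda>f g w. \<Sum>i\<le>length w. f (take i w) * g (drop i w)),
     one = (\<lambda>w. if w = [] then 1 else 0),
     zero = (\<lambda>w. 0),
     add = (\<lambda>f g w. f w + g w),
     smult = (\<lambda>c f w. c * f w)\<rparr>"

definition gen :: "letter \<Rightarrow> 'k::field freealg" where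
  "gen l = (\<lambda>w. if w = [l] then 1 else 0)"

definition gen_ideal :: "'k::field freealg set" where
  "gen_ideal = Idl\<^bsub>free_algebra\<^esub> {gen Lx, gen Ly, gen Lz}"

definition L3 :: "('k::field, 'k freealg set) module" where
  "L3 = quot free_algebra (gen_ideal \<cdot>\<^bsub>free_algebra\<^esub> gen_ideal)"

definition special :: "('k::field freealg set, 'm, 'c) module_scheme \<Rightarrow> bool" where
  "special M \<longleftrightarrow> module L3 M \<and> finitely_generated L3 M \<and> dim_vector L3 M = (3, 2) \<and>
     faithful L3 M \<and> \<not> has_simple_summand L3 M \<and>
     \<not> (\<exists>N. LinearCombinations.submodule L3 N M \<and>
          uniform L3 (M\<lparr>carrier := N\<rparr>) \<and> has_length L3 (M\<lparr>carrier := N\<rparr>) 3)"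

end

theory Submission
  imports Defs
begin

text \<open>Multiplication by the radical \<open>E\<close> of \<open>L(3)\<close> turns \<open>M\<close> into a bilinear map
  \<open>E \<times> M/EM \<rightarrow> EM\<close>, that is, in coordinates, into a pair \<open>A, B\<close> of \<open>3 \<times> 3\<close> matrices. Faithfulness says
  that \<open>A, B\<close> have no common left kernel, and the absence of simple summands that they have no common right
  kernel. If some invertible \<open>Q\<close> makes \<open>A Q\<close> and \<open>B Q\<close> symmetric, then after a change of basis of
  \<open>M/EM\<close> the bilinear map is the multiplication of a commutative local algebra on \<open>k \<oplus> E \<oplus> EM\<close> with
  radical \<open>E \<oplus> EM\<close>, which is the required algebra.

  Such a \<open>Q\<close> exists for every pair without common kernels. If some combination of \<open>A\<close> and \<open>B\<close> is
  invertible, then one may assume \<open>A = 1\<close>, and any single matrix is symmetrized by a symmetric \<open>Q\<close>.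
  Otherwise two members of the pencil spanned by \<open>A\<close> and \<open>B\<close> have rank 2. As the determinant vanishes
  on the whole pencil, both matrices vanish on the product of the span of their left kernels with the span of their
  right kernels; in bases adapted to these spans \<open>Q\<close> can be chosen diagonal.\<close>

section \<open>Pencils of matrices\<close>

text \<open>The radical \<open>J\<close> of the sought algebra has two roles: \<open>J/J^2\<close>
  must be the given space \<open>E\<close>, and \<open>J/J^2\<close> is also the top
  \<open>M/EM\<close> of \<open>J\<close> as a module, while \<open>J^2\<close> becomes
  \<open>EM\<close>. Since \<open>E\<close> kills \<open>EM\<close>, all products of three radical
  elements vanish, so associativity is automatic and commutativity is the only obstacle. The letters
  fix a basis of \<open>E\<close>; what can be chosen is the identification of \<open>E\<close> with
  \<open>M/EM\<close>. This is why one factor \<open>Q\<close> on the right, common to both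
  matrices, is sought. With \<open>A = 1\<close> the condition says that \<open>Q\<close> is
  symmetric and \<open>C * Q = Q * transpose_mat C\<close>: this is the theorem of Taussky and
  Zassenhaus that a matrix is conjugate to its transpose by a symmetric matrix, done here by hand in
  size 3. For a singular pencil the vanishing of the determinant enters through its first-order
  term, the trace of \<open>adj A * B\<close>, which yields \<open>adj A * B * adj A = 0\<close>.
  When \<open>A\<close> has rank 2, \<open>adj A\<close> has rank one, with columns in the right
  kernel and rows in the left kernel of \<open>A\<close>, so this is a statement on kernel
  vectors.\<close>

definition mat3 :: "'a \<Rightarrow> 'a \<Rightarrow> 'a \<Rightarrow> 'a \<Rightarrow> 'a \<Rightarrow> 'a \<Rightarrow> 'a \<Rightarrow> 'a \<Rightarrow> 'a \<Rightarrow> 'a mat" where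
  "mat3 a b c d e f g h i =
     mat 3 3 (\<lambda>(p, q). (if p = 0 then if q = 0 then a else if q = 1 then b else c
        else if p = 1 then if q = 0 then d else if q = 1 then e else f
        else if q = 0 then g else if q = 1 then h else i))"

lemma mat3_carrier [simp]: "mat3 a b c d e f g h i \<in> carrier_mat 3 3"
  by (simp add: mat3_def)

lemma less_3_cases: "(i::nat) < 3 \<longleftrightarrow> i = 0 \<or> i = 1 \<or> i = 2"
  by auto

lemma mat3_cases:
  assumes "A \<in> carrier_mat 3 3"
  obtains a b c d e f g h i where "A = mat3 a b c d e f g h i"
proof -
  have "A = mat3 (A $$ (0,0)) (A $$ (0,1)) (A $$ (0,2)) (A $$ (1,0)) (A $$ (1,1)) (A $$ (1,2))
      (A $$ (2,0)) (A $$ (2,1)) (A $$ (2,2))"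
    using assms by (auto simp: mat3_def less_3_cases intro!: eq_matI)
  then show ?thesis by (rule that)
qed

lemma mat3_eq_iff [simp]:
  "mat3 a b c d e f g h i = mat3 a' b' c' d' e' f' g' h' i' \<longleftrightarrow>
     a = a' \<and> b = b' \<and> c = c' \<and> d = d' \<and> e = e' \<and> f = f' \<and> g = g' \<and> h = h' \<and> i = i'"
  (is "?L = ?R")
proof
  assume L: ?L
  have "\<And>p q. mat3 a b c d e f g h i $$ (p, q) = mat3 a' b' c' d' e' f' g' h' i' $$ (p, q)"
    using L by simp
  from this[of 0 0] this[of 0 1] this[of 0 2] this[of 1 0] this[of 1 1] this[of 1 2]
    this[of 2 0] this[of 2 1] this[of 2 2]
  show ?R by (simp add: mat3_def)
qed simp

lemma mat3_mult:
  fixes a :: "'a :: comm_semiring_0"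
  shows "mat3 a b c d e f g h i * mat3 a' b' c' d' e' f' g' h' i' =
   mat3 (a*a' + b*d' + c*g') (a*b' + b*e' + c*h') (a*c' + b*f' + c*i')
        (d*a' + e*d' + f*g') (d*b' + e*e' + f*h') (d*c' + e*f' + f*i')
        (g*a' + h*d' + i*g') (g*b' + h*e' + i*h') (g*c' + h*f' + i*i')"
  by (rule eq_matI)
    (auto simp: mat3_def less_3_cases scalar_prod_def numeral_3_eq_3 ac_simps)

lemma mat3_transpose:
  "transpose_mat (mat3 a b c d e f g h i) = mat3 a d g b e h c f i"
  by (rule eq_matI) (auto simp: mat3_def less_3_cases)

lemma mat3_add:
  "mat3 a b c d e f g h i + mat3 a' b' c' d' e' f' g' h' i' =
    mat3 (a+a') (b+b') (c+c') (d+d') (e+e') (f+f') (g+g') (h+h') (i+i')"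
  by (rule eq_matI) (auto simp: mat3_def less_3_cases)

lemma mat3_smult:
  "x \<cdot>\<^sub>m mat3 a b c d e f g h i = mat3 (x*a) (x*b) (x*c) (x*d) (x*e) (x*f) (x*g) (x*h) (x*i)"
  by (rule eq_matI) (auto simp: mat3_def less_3_cases)

lemma mat3_one: "1\<^sub>m 3 = mat3 1 0 0 0 1 0 0 0 1"
  by (rule eq_matI) (auto simp: mat3_def less_3_cases)

lemma mat3_det:
  fixes a :: "'a :: comm_ring_1"
  shows "det (mat3 a b c d e f g h i) =
    a*(e*i - f*h) - b*(d*i - f*g) + c*(d*h - e*g)"
proof -
  have 2: "det A = A $$ (0,0) * A $$ (1,1) - A $$ (0,1) * A $$ (1,0)"
    if "A \<in> carrier_mat 2 2" for A :: "'a mat"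
    using that by (simp add: laplace_expansion_row[OF that, of 0] numeral_2_eq_2 cofactor_def
        mat_delete_def det_single)
  show ?thesis
    by (subst laplace_expansion_row[OF mat3_carrier, of 0])
      (auto simp: numeral_3_eq_3 cofactor_def 2[unfolded numeral_2_eq_2] mat_delete_def mat3_def
        algebra_simps)
qed

definition vec3 :: "'a \<Rightarrow> 'a \<Rightarrow> 'a \<Rightarrow> 'a vec" where
  "vec3 x y z = vec 3 (\<lambda>i. if i = 0 then x else if i = 1 then y else z)"

lemma vec3_carrier [simp]: "vec3 x y z \<in> carrier_vec 3"
  by (simp add: vec3_def)

lemma vec3_cases:
  assumes "v \<in> carrier_vec 3"
  obtains x y z where "v = vec3 x y z"
proof -
  have "v = vec3 (v $ 0) (v $ 1) (v $ 2)"
    using assms by (auto simp: vec3_def less_3_cases intro!: eq_vecI)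
  then show ?thesis by (rule that)
qed

lemma vec3_eq_iff [simp]: "vec3 x y z = vec3 x' y' z' \<longleftrightarrow> x = x' \<and> y = y' \<and> z = z'" (is "?L = ?R")
proof
  assume L: ?L
  have "\<And>p. vec3 x y z $ p = vec3 x' y' z' $ p"
    using L by simp
  from this[of 0] this[of 1] this[of 2] show ?R by (simp add: vec3_def)
qed simp

lemma vec3_zero: "0\<^sub>v 3 = vec3 0 0 0"
  by (rule eq_vecI) (auto simp: vec3_def less_3_cases)

lemma mat3_mult_vec3:
  fixes a :: "'a :: comm_semiring_0"
  shows "mat3 a b c d e f g h i *\<^sub>v vec3 x y z = vec3 (a*x+b*y+c*z) (d*x+e*y+f*z) (g*x+h*y+i*z)"
  by (rule eq_vecI) (auto simp: mat3_def vec3_def less_3_cases scalar_prod_def numeral_3_eq_3 ac_simps)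

lemma obtain_mat_inverse:
  fixes A :: "'a :: field mat"
  assumes A: "A \<in> carrier_mat n n" and "det A \<noteq> 0"
  obtains A' where "A' \<in> carrier_mat n n" "A * A' = 1\<^sub>m n" "A' * A = 1\<^sub>m n" "det A' \<noteq> 0"
proof -
  from det_non_zero_imp_unit[OF A assms(2), of "()"] obtain A'
    where A': "A' \<in> carrier_mat n n" "A * A' = 1\<^sub>m n" "A' * A = 1\<^sub>m n"
    by (auto simp: Units_def ring_mat_def)
  have "det A * det A' = 1"
    using det_mult[OF A A'(1)] A'(2) by simp
  then have "det A' \<noteq> 0" by auto
  with A' show ?thesis by (rule that)
qed

section \<open>Symmetrizing a pair of matrices from the right; pencils with an invertible
  member\<close>

definition symmetrizes :: "'a :: comm_ring_1 mat \<Rightarrow> 'a mat \<Rightarrow> bool" where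
  "symmetrizes Q B \<longleftrightarrow> transpose_mat (B * Q) = B * Q"

lemma symmetrizes_add:
  assumes "A \<in> carrier_mat n n" "B \<in> carrier_mat n n" "Q \<in> carrier_mat n n"
    and "symmetrizes Q A" "symmetrizes Q B"
  shows "symmetrizes Q (A + B)"
proof -
  have "(A + B) * Q = A * Q + B * Q"
    using assms by (simp add: add_mult_distrib_mat)
  with assms show ?thesis
    by (simp add: symmetrizes_def transpose_add[of _ n n])
qed

lemma symmetrizes_smult:
  assumes "A \<in> carrier_mat n n" "Q \<in> carrier_mat n n" "symmetrizes Q A"
  shows "symmetrizes Q (x \<cdot>\<^sub>m A)"
proof -
  have "x \<cdot>\<^sub>m A * Q = x \<cdot>\<^sub>m (A * Q)"
    using assms(1,2) by (rule mult_smult_assoc_mat)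
  moreover have "transpose_mat (x \<cdot>\<^sub>m (A * Q)) = x \<cdot>\<^sub>m transpose_mat (A * Q)"
    using assms by (intro eq_matI) auto
  ultimately show ?thesis
    using assms by (simp add: symmetrizes_def)
qed

definition symmetrizable :: "nat \<Rightarrow> 'a :: field mat \<Rightarrow> 'a mat \<Rightarrow> bool" where
  "symmetrizable n A B \<longleftrightarrow> (\<exists>Q \<in> carrier_mat n n. det Q \<noteq> 0 \<and> symmetrizes Q A \<and> symmetrizes Q B)"

text \<open>Congruence preserves symmetry: with \<open>S = X * A * Y * Q\<close>, the product
  \<open>A * (Y * Q * transpose_mat X')\<close> equals \<open>X' * S * transpose_mat X'\<close>.
  Hence row and column operations on the pair are both available, although only a right factor is
  sought.\<close>

lemma symmetrizes_equivalent:
  assumes [simp]: "X \<in> carrier_mat n n" "X' \<in> carrier_mat n n" "Y \<in> carrier_mat n n"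
      "Q \<in> carrier_mat n n" "A \<in> carrier_mat n n"
    and X: "X' * X = 1\<^sub>m n" and "symmetrizes Q (X * A * Y)"
  shows "symmetrizes (Y * Q * transpose_mat X') A"
proof -
  let ?S = "X * A * Y * Q"
  have [simp]: "C * D \<in> carrier_mat n n" if "C \<in> carrier_mat n n" "D \<in> carrier_mat n n" for C D :: "'a mat"
    using that by simp
  have "A * (Y * Q * transpose_mat X') = (X' * X) * (A * (Y * Q * transpose_mat X'))"
    unfolding X by (rule left_mult_one_mat[of _ n n, symmetric])
      (intro mult_carrier_mat[of _ n n] transpose_carrier_mat[THEN iffD2] assms)
  also have "\<dots> = X' * ?S * transpose_mat X'"
    by (simp add: assoc_mult_mat[of _ n n _ n _ n])
  finally have 1: "A * (Y * Q * transpose_mat X') = X' * ?S * transpose_mat X'" .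
  have "transpose_mat (X' * ?S * transpose_mat X') = X' * (transpose_mat ?S * transpose_mat X')"
    by (simp add: transpose_mult[of _ n n _ n] del: transpose_mat_def)
  also have "transpose_mat ?S = ?S"
    using assms(7) by (simp add: symmetrizes_def)
  also have "X' * (?S * transpose_mat X') = X' * ?S * transpose_mat X'"
    by (simp add: assoc_mult_mat[of _ n n _ n _ n])
  finally show ?thesis
    by (simp add: symmetrizes_def 1)
qed

lemma symmetrizable_equivalent:
  assumes carr: "X \<in> carrier_mat n n" "Y \<in> carrier_mat n n" "A \<in> carrier_mat n n" "B \<in> carrier_mat n n"
    and "det X \<noteq> 0" "det Y \<noteq> 0"
    and "symmetrizable n (X * A * Y) (X * B * Y)"
  shows "symmetrizable n A B"
proof -
  obtain X' where X': "X' \<in> carrier_mat n n" "X' * X = 1\<^sub>m n" "det X' \<noteq> 0"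
    using obtain_mat_inverse[OF carr(1) assms(5)] by metis
  obtain Q where Q: "Q \<in> carrier_mat n n" "det Q \<noteq> 0"
      "symmetrizes Q (X * A * Y)" "symmetrizes Q (X * B * Y)"
    using assms(7) by (auto simp: symmetrizable_def)
  show ?thesis
    unfolding symmetrizable_def
  proof (intro bexI conjI)
    show "det (Y * Q * transpose_mat X') \<noteq> 0"
      using carr X' Q assms by (simp add: det_mult[of _ n] det_transpose)
    show "symmetrizes (Y * Q * transpose_mat X') A" "symmetrizes (Y * Q * transpose_mat X') B"
      by (rule symmetrizes_equivalent[OF carr(1) X'(1) carr(2) Q(1) carr(3) X'(2) Q(3)],
          rule symmetrizes_equivalent[OF carr(1) X'(1) carr(2) Q(1) carr(4) X'(2) Q(4)])
    show "Y * Q * transpose_mat X' \<in> carrier_mat n n"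
      using carr(2) X'(1) Q(1) by simp
  qed
qed

text \<open>The matrices symmetrized by a fixed \<open>Q\<close> form a linear space, so only the
  span of \<open>A\<close> and \<open>B\<close> matters and the basis of the pencil may be
  changed.\<close>

lemma symmetrizable_combination:
  assumes carr: "A \<in> carrier_mat n n" "B \<in> carrier_mat n n" and "x \<noteq> 0"
    and "symmetrizable n (x \<cdot>\<^sub>m A + y \<cdot>\<^sub>m B) B"
  shows "symmetrizable n A B"
proof -
  obtain Q where Q: "Q \<in> carrier_mat n n" "det Q \<noteq> 0"
      "symmetrizes Q (x \<cdot>\<^sub>m A + y \<cdot>\<^sub>m B)" "symmetrizes Q B"
    using assms(4) by (auto simp: symmetrizable_def)
  have "A = (1 / x) \<cdot>\<^sub>m (x \<cdot>\<^sub>m A + y \<cdot>\<^sub>m B) + (- y / x) \<cdot>\<^sub>m B"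
    using carr \<open>x \<noteq> 0\<close> by (intro eq_matI) (auto simp: field_simps)
  also have "symmetrizes Q \<dots>"
    using carr Q by (auto intro!: symmetrizes_add[where n = n] symmetrizes_smult[where n = n, OF _ _ Q(3)]
        symmetrizes_smult[where n = n, OF _ _ Q(4)])
  finally have "symmetrizes Q A" .
  with Q(1,2,4) show ?thesis
    unfolding symmetrizable_def by (intro bexI[of _ Q]) simp_all
qed

lemma symmetrizable_commute: "symmetrizable n A B \<Longrightarrow> symmetrizable n B A"
  by (auto simp: symmetrizable_def)

text \<open>For a symmetric \<open>Q\<close> with rows \<open>(p, q, r)\<close>, \<open>(q, s, t)\<close>, \<open>(r, t, u)\<close> the symmetry of the
  product amounts to the three linear equations in \<open>*\<close> below. The three witnesses are solutions with \<open>det Q\<close>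
  equal to \<open>- h\<^sup>2\<close>, \<open>- 1\<close> and \<open>- (c + i f)\<close>.\<close>

lemma symmetrizable_one_normal_form:
  "symmetrizable 3 (1\<^sub>m 3) (mat3 0 b c 1 e f 0 h (i :: 'a :: field))"
proof -
  have *: "symmetrizable 3 (1\<^sub>m 3) (mat3 0 b c 1 e f 0 h i)"
    if "det (mat3 p q r q s t r t u) \<noteq> 0" "b*s + c*t = p + e*q + f*r" "b*t + c*u = h*q + i*r"
      "r + e*t + f*u = h*s + i*t" for p q r s t u
  proof -
    have "symmetrizes (mat3 p q r q s t r t u) (1\<^sub>m 3)"
      "symmetrizes (mat3 p q r q s t r t u) (mat3 0 b c 1 e f 0 h i)"
      using that by (simp_all add: symmetrizes_def mat3_one mat3_mult mat3_transpose)
    then show ?thesis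
      using that(1) unfolding symmetrizable_def
      by (intro bexI[of _ "mat3 p q r q s t r t u"] conjI) simp_all
  qed
  consider "h \<noteq> 0" | "h = 0" "c + i*f = 0" | "h = 0" "c + i*f \<noteq> 0" by blast
  then show ?thesis
  proof cases
    case 1
    show ?thesis
      by (rule *[of "b + e*i - f*h" "-i" h 1 0 0]) (use 1 in \<open>auto simp: mat3_det algebra_simps\<close>)
  next
    case 2
    show ?thesis
    proof (rule *[of "f*f - e" 1 "-f" 0 0 1])
      show "b*0 + c*1 = h*1 + i*(-f)"
        using 2 by (simp add: eq_neg_iff_add_eq_0)
    qed (use 2 in \<open>auto simp: mat3_det algebra_simps\<close>)
  next
    case 3
    \<comment> \<open>With \<open>h = 0\<close>, \<open>s = 0\<close> and \<open>t = 1\<close> the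
      last equation determines \<open>r\<close>; the middle one then becomes linear in
      \<open>u\<close> with coefficient \<open>c + i*f\<close>.\<close>
    define u where "u = (i*i - i*e - b) / (c + i*f)"
    define r where "r = i - e - f*u"
    have "u * (c + i*f) = i*i - i*e - b"
      using 3 by (simp add: u_def)
    then have u: "u * c + u * (i*f) = i*i - i*e - b"
      by (simp only: distrib_left)
    have "det (mat3 (c + e*f - f*r) (-f) r (-f) 0 1 r 1 u) = - (c + i*f)"
      by (simp add: mat3_det r_def algebra_simps)
    moreover have "b*1 + c*u = h*(-f) + i*r"
      using u 3 by (simp add: r_def algebra_simps)
    ultimately show ?thesis
      by (intro *[of "c + e*f - f*r" "-f" r 0 1 u]) (use 3 in \<open>auto simp: r_def algebra_simps\<close>)
  qed
qed

text \<open>\<open>?X\<close> is the inverse of \<open>?Y\<close>, so the identity is kept. The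
  columns of \<open>?Y\<close> are the first unit vector, its image under the given matrix, and the
  third unit vector; in this basis the first basis vector is sent to the second, which is the normal
  form above.\<close>

lemma symmetrizable_one_offdiag:
  assumes "d \<noteq> 0"
  shows "symmetrizable 3 (1\<^sub>m 3) (mat3 a b c d e f g h (i :: 'a :: field))"
proof (rule symmetrizable_equivalent)
  let ?X = "mat3 1 (-a/d) 0 0 (1/d) 0 0 (-g/d) 1" and ?Y = "mat3 1 a 0 0 d 0 0 g 1"
  show "det ?X \<noteq> 0" "det ?Y \<noteq> 0"
    using assms by (simp_all add: mat3_det)
  have 1: "?X * 1\<^sub>m 3 * ?Y = 1\<^sub>m 3"
    using assms by (simp add: mat3_one mat3_mult)
  have "\<exists>b' c' e' f' h' i'. ?X * mat3 a b c d e f g h i * ?Y = mat3 0 b' c' 1 e' f' 0 h' i'"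
    using assms by (simp add: mat3_mult)
  then show "symmetrizable 3 (?X * 1\<^sub>m 3 * ?Y) (?X * mat3 a b c d e f g h i * ?Y)"
    unfolding 1 using symmetrizable_one_normal_form by metis
qed simp_all

lemma symmetrizable_one_conjugate:
  assumes "S \<in> carrier_mat n n" "C \<in> carrier_mat n n" and "S * S = 1\<^sub>m n" "det S \<noteq> 0"
    and "symmetrizable n (1\<^sub>m n) (S * C * S)"
  shows "symmetrizable n (1\<^sub>m n) C"
  by (rule symmetrizable_equivalent[of S n S]) (use assms in simp_all)

text \<open>Conjugation by the transpositions \<open>?S\<close> and \<open>?T\<close> of basis
  vectors carries any nonzero off-diagonal entry to the position of \<open>d\<close>. A diagonal
  matrix is symmetric already.\<close>

lemma symmetrizable_one:
  assumes "C \<in> carrier_mat 3 3"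
  shows "symmetrizable 3 (1\<^sub>m 3) (C :: 'a :: field mat)"
proof -
  obtain a b c d e f g h i where C: "C = mat3 a b c d e f g h i"
    using mat3_cases[OF assms] .
  let ?S = "mat3 0 1 0 1 0 0 0 0 (1::'a)" and ?T = "mat3 1 0 0 0 0 1 0 1 (0::'a)"
  have S: "symmetrizable 3 (1\<^sub>m 3) A" if "A \<in> carrier_mat 3 3"
      "symmetrizable 3 (1\<^sub>m 3) (?S * A * ?S)" for A :: "'a mat"
    by (rule symmetrizable_one_conjugate[of ?S])
      (use that in \<open>simp_all add: mat3_det, simp add: mat3_one mat3_mult\<close>)
  have T: "symmetrizable 3 (1\<^sub>m 3) A" if "A \<in> carrier_mat 3 3"
      "symmetrizable 3 (1\<^sub>m 3) (?T * A * ?T)" for A :: "'a mat"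
    by (rule symmetrizable_one_conjugate[of ?T])
      (use that in \<open>simp_all add: mat3_det, simp add: mat3_one mat3_mult\<close>)
  consider "d \<noteq> 0" | "g \<noteq> 0" | "b \<noteq> 0" | "h \<noteq> 0" | "c \<noteq> 0" | "f \<noteq> 0"
    | "b = 0" "c = 0" "d = 0" "f = 0" "g = 0" "h = 0"
    by blast
  then show ?thesis
  proof cases
    case 1
    then show ?thesis unfolding C by (rule symmetrizable_one_offdiag)
  next
    case 2
    show ?thesis unfolding C
      by (rule T)
        (use 2 in \<open>simp_all add: mat3_mult symmetrizable_one_offdiag\<close>)
  next
    case 3
    show ?thesis unfolding C
      by (rule S)
        (use 3 in \<open>simp_all add: mat3_mult symmetrizable_one_offdiag\<close>)
  next
    case 4
    show ?thesis unfolding C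
      by (rule S, simp, rule T)
        (use 4 in \<open>simp_all add: mat3_mult symmetrizable_one_offdiag\<close>)
  next
    case 5
    show ?thesis unfolding C
      by (rule T, simp, rule S)
        (use 5 in \<open>simp_all add: mat3_mult symmetrizable_one_offdiag\<close>)
  next
    case 6
    show ?thesis unfolding C
      by (rule S, simp, rule T, simp add: mat3_mult, rule S)
        (use 6 in \<open>simp_all add: mat3_mult symmetrizable_one_offdiag\<close>)
  next
    case 7
    then have "symmetrizes (1\<^sub>m 3) (1\<^sub>m 3 :: 'a mat)" "symmetrizes (1\<^sub>m 3) C"
      by (simp_all add: C symmetrizes_def mat3_one mat3_mult mat3_transpose)
    then show ?thesis
      unfolding symmetrizable_def by (intro bexI[of _ "1\<^sub>m 3"]) simp_all
  qed
qed

lemma symmetrizable_regular: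
  fixes A B :: "'a :: field mat"
  assumes carr: "A \<in> carrier_mat 3 3" "B \<in> carrier_mat 3 3"
    and "det (x \<cdot>\<^sub>m A + y \<cdot>\<^sub>m B) \<noteq> 0"
  shows "symmetrizable 3 A B"
proof -
  let ?P = "x \<cdot>\<^sub>m A + y \<cdot>\<^sub>m B"
  have P: "?P \<in> carrier_mat 3 3" using carr by simp
  obtain P' where P': "P' \<in> carrier_mat 3 3" "P' * ?P = 1\<^sub>m 3" "det P' \<noteq> 0"
    using obtain_mat_inverse[OF P assms(3)] by metis
  have *: "symmetrizable 3 ?P D" if "D \<in> carrier_mat 3 3" for D
  proof (rule symmetrizable_equivalent[OF P'(1) one_carrier_mat P that P'(3)])
    have "P' * ?P * 1\<^sub>m 3 = 1\<^sub>m 3"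
      by (simp add: P'(2))
    then show "symmetrizable 3 (P' * ?P * 1\<^sub>m 3) (P' * D * 1\<^sub>m 3)"
      using symmetrizable_one[of "P' * D"] P'(1) that by simp
  qed simp
  show ?thesis
  proof (cases "x = 0")
    case False
    then show ?thesis using symmetrizable_combination[OF carr] * carr by blast
  next
    \<comment> \<open>The invertible member is a multiple of \<open>B\<close> alone, so the two
      matrices exchange roles.\<close>
    case True
    have "y \<noteq> 0"
    proof
      assume "y = 0"
      then have "?P = 0\<^sub>m 3 3" using True carr by (intro eq_matI) auto
      then show False using assms(3) by simp
    qed
    moreover have "?P = y \<cdot>\<^sub>m B + 0 \<cdot>\<^sub>m A"
      using True carr by (intro eq_matI) auto
    ultimately have "symmetrizable 3 B A"
      using symmetrizable_combination[OF carr(2,1), of y 0] *[OF carr(1)] by simp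
    then show ?thesis by (rule symmetrizable_commute)
  qed
qed

section \<open>Adjugates, kernels, and pencils whose determinant vanishes\<close>

lemma mat3_index [simp]:
  "mat3 a b c d e f g h i $$ (0, 0) = a" "mat3 a b c d e f g h i $$ (0, Suc 0) = b"
  "mat3 a b c d e f g h i $$ (0, 2) = c" "mat3 a b c d e f g h i $$ (Suc 0, 0) = d"
  "mat3 a b c d e f g h i $$ (Suc 0, Suc 0) = e" "mat3 a b c d e f g h i $$ (Suc 0, 2) = f"
  "mat3 a b c d e f g h i $$ (2, 0) = g" "mat3 a b c d e f g h i $$ (2, Suc 0) = h"
  "mat3 a b c d e f g h i $$ (2, 2) = i"
  by (simp_all add: mat3_def)

definition adj3 :: "'a :: comm_ring_1 mat \<Rightarrow> 'a mat" where
  "adj3 A = (let a = \<lambda>i j. A $$ (i, j) in mat3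
    (a 1 1 * a 2 2 - a 1 2 * a 2 1) (a 0 2 * a 2 1 - a 0 1 * a 2 2) (a 0 1 * a 1 2 - a 0 2 * a 1 1)
    (a 1 2 * a 2 0 - a 1 0 * a 2 2) (a 0 0 * a 2 2 - a 0 2 * a 2 0) (a 0 2 * a 1 0 - a 0 0 * a 1 2)
    (a 1 0 * a 2 1 - a 1 1 * a 2 0) (a 0 1 * a 2 0 - a 0 0 * a 2 1) (a 0 0 * a 1 1 - a 0 1 * a 1 0))"

lemma adj3_mat3:
  "adj3 (mat3 a b c d e f g h i) = mat3 (e*i - f*h) (c*h - b*i) (b*f - c*e)
    (f*g - d*i) (a*i - c*g) (c*d - a*f) (d*h - e*g) (b*g - a*h) (a*e - b*d)"
  by (simp add: adj3_def Let_def)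

lemma adj3_carrier [simp]: "adj3 A \<in> carrier_mat 3 3"
  by (simp add: adj3_def Let_def)

text \<open>The trace of \<open>adj3 A * B\<close>. By Jacobi's formula it is the derivative of
  \<open>det\<close> at \<open>A\<close> in direction \<open>B\<close>, hence a mixed coefficient of
  the determinant of the pencil.\<close>

definition tr_adj3 :: "'a :: comm_ring_1 mat \<Rightarrow> 'a mat \<Rightarrow> 'a" where
  "tr_adj3 A B = (let n = \<lambda>i j. adj3 A $$ (i, j); b = \<lambda>i j. B $$ (i, j) in
     n 0 0 * b 0 0 + n 0 1 * b 1 0 + n 0 2 * b 2 0 + n 1 0 * b 0 1 + n 1 1 * b 1 1 + n 1 2 * b 2 1
     + n 2 0 * b 0 2 + n 2 1 * b 1 2 + n 2 2 * b 2 2)"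

lemma tr_adj3_mat3:
  "tr_adj3 (mat3 a b c d e f g h i) (mat3 a' b' c' d' e' f' g' h' i') =
     (e*i - f*h)*a' + (c*h - b*i)*d' + (b*f - c*e)*g' + (f*g - d*i)*b' + (a*i - c*g)*e'
     + (c*d - a*f)*h' + (d*h - e*g)*c' + (b*g - a*h)*f' + (a*e - b*d)*i'"
  by (simp add: tr_adj3_def Let_def adj3_mat3)

lemma det_pencil3:
  fixes A B :: "'a :: comm_ring_1 mat"
  assumes "A \<in> carrier_mat 3 3" "B \<in> carrier_mat 3 3"
  shows "det (x \<cdot>\<^sub>m A + y \<cdot>\<^sub>m B) =
    x^3 * det A + x^2 * y * tr_adj3 A B + x * y^2 * tr_adj3 B A + y^3 * det B"
proof -
  obtain a b c d e f g h i where A: "A = mat3 a b c d e f g h i"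
    using mat3_cases[OF assms(1)] .
  obtain a' b' c' d' e' f' g' h' i' where B: "B = mat3 a' b' c' d' e' f' g' h' i'"
    using mat3_cases[OF assms(2)] .
  show ?thesis
    unfolding A B mat3_smult mat3_add mat3_det tr_adj3_mat3
    by (simp add: algebra_simps power2_eq_square power3_eq_cube)
qed

lemma adj3_mult:
  fixes A :: "'a :: comm_ring_1 mat"
  assumes "A \<in> carrier_mat 3 3"
  shows "A * adj3 A = det A \<cdot>\<^sub>m 1\<^sub>m 3" "adj3 A * A = det A \<cdot>\<^sub>m 1\<^sub>m 3"
  by (rule mat3_cases[OF assms];
      simp add: mat3_mult adj3_mat3 mat3_det mat3_one mat3_smult, simp add: algebra_simps)+

text \<open>The last matrix in the proof is the derivative of the adjugate at \<open>A\<close> in direction \<open>B\<close>; the identity is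
  \<open>adj A * B * adj A = tr (adj A * B) adj A - det A D adj(A)[B]\<close>.\<close>

lemma adj3_sandwich:
  fixes A B :: "'a :: comm_ring_1 mat"
  assumes "A \<in> carrier_mat 3 3" "B \<in> carrier_mat 3 3" and "det A = 0" "tr_adj3 A B = 0"
  shows "adj3 A * B * adj3 A = 0\<^sub>m 3 3"
proof -
  obtain a b c d e f g h i where A: "A = mat3 a b c d e f g h i"
    using mat3_cases[OF assms(1)] .
  obtain a' b' c' d' e' f' g' h' i' where B: "B = mat3 a' b' c' d' e' f' g' h' i'"
    using mat3_cases[OF assms(2)] .
  have "adj3 A * B * adj3 A = tr_adj3 A B \<cdot>\<^sub>m adj3 A + (- det A) \<cdot>\<^sub>m (mat3
      (e*i' + e'*i - f*h' - f'*h) (c*h' + c'*h - b*i' - b'*i) (b*f' + b'*f - c*e' - c'*e)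
      (f*g' + f'*g - d*i' - d'*i) (a*i' + a'*i - c*g' - c'*g) (c*d' + c'*d - a*f' - a'*f)
      (d*h' + d'*h - e*g' - e'*g) (b*g' + b'*g - a*h' - a'*h) (a*e' + a'*e - b*d' - b'*d))"
    unfolding A B adj3_mat3 mat3_det tr_adj3_mat3 mat3_smult mat3_mult mat3_add mat3_eq_iff
    by (intro conjI; simp add: algebra_simps)
  then show ?thesis
    using assms by (simp add: mat3_smult mat3_add A adj3_mat3) (auto simp: mat3_def intro!: eq_matI)
qed

text \<open>Both products of \<open>A\<close> with its adjugate are \<open>det A\<close> times the
  identity, hence zero: columns of the adjugate lie in the right kernel and rows in the left kernel.
  A nonzero entry at \<open>(p, q)\<close> selects a nonzero column \<open>q\<close> and a nonzero
  row \<open>p\<close>; their pairing through \<open>B\<close> is the \<open>(p, q)\<close> entry of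
  \<open>adj3 A * B * adj3 A\<close>, which vanishes.\<close>

lemma kernel_vectors_of_adj3:
  fixes A B :: "'a :: field mat"
  assumes A: "A \<in> carrier_mat 3 3" and B: "B \<in> carrier_mat 3 3" and "det A = 0" "tr_adj3 A B = 0"
    and "adj3 A \<noteq> 0\<^sub>m 3 3"
  obtains v w where "v \<in> carrier_vec 3" "w \<in> carrier_vec 3" "v \<noteq> 0\<^sub>v 3" "w \<noteq> 0\<^sub>v 3"
    "A *\<^sub>v v = 0\<^sub>v 3" "transpose_mat A *\<^sub>v w = 0\<^sub>v 3" "w \<bullet> (B *\<^sub>v v) = 0"
proof -
  let ?N = "adj3 A"
  have "\<exists>p<3. \<exists>q<3. ?N $$ (p, q) \<noteq> 0"
  proof (rule ccontr)
    assume *: "\<not> (\<exists>p<3. \<exists>q<3. ?N $$ (p, q) \<noteq> 0)"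
    have "?N = 0\<^sub>m 3 3"
    proof (rule eq_matI)
      fix i j assume "i < dim_row (0\<^sub>m 3 3 :: 'a mat)" "j < dim_col (0\<^sub>m 3 3 :: 'a mat)"
      then show "?N $$ (i, j) = 0\<^sub>m 3 3 $$ (i, j)"
        using * by simp
    qed (simp_all only: carrier_matD[OF adj3_carrier[of A]] index_zero_mat)
    with assms(5) show False ..
  qed
  then obtain p q where pq: "p < 3" "q < 3" "?N $$ (p, q) \<noteq> 0"
    by blast
  note dimN = carrier_matD[OF adj3_carrier[of A]]
  have zero: "det A \<cdot>\<^sub>m 1\<^sub>m 3 = 0\<^sub>m 3 3"
    using assms(3) by (intro eq_matI) simp_all
  show ?thesis
  proof
    show "col ?N q \<in> carrier_vec 3" "row ?N p \<in> carrier_vec 3"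
      by (rule col_carrier_vec[OF pq(2) adj3_carrier], rule row_carrier_vec[OF pq(1) adj3_carrier])
    have "col ?N q $ p \<noteq> 0" "row ?N p $ q \<noteq> 0"
      using pq by (simp_all add: dimN)
    then show "col ?N q \<noteq> 0\<^sub>v 3" "row ?N p \<noteq> 0\<^sub>v 3"
      using index_zero_vec(1)[OF pq(1)] index_zero_vec(1)[OF pq(2)] by auto
    have "A *\<^sub>v col ?N q = col (A * ?N) q"
      using pq(2) by (simp only: col_mult2[OF A adj3_carrier])
    also have "\<dots> = 0\<^sub>v 3"
      using pq unfolding adj3_mult[OF A] zero by (intro eq_vecI) simp_all
    finally show "A *\<^sub>v col ?N q = 0\<^sub>v 3" .
    show "transpose_mat A *\<^sub>v row ?N p = 0\<^sub>v 3"
    proof (rule eq_vecI)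
      fix j assume "j < dim_vec (0\<^sub>v 3 :: 'a vec)"
      then have j: "j < 3" by simp
      have "(transpose_mat A *\<^sub>v row ?N p) $ j = col A j \<bullet> row ?N p"
        using j A by simp
      also have "\<dots> = row ?N p \<bullet> col A j"
        by (rule comm_scalar_prod[OF col_carrier_vec[OF j A] row_carrier_vec[OF pq(1) adj3_carrier]])
      also have "\<dots> = (?N * A) $$ (p, j)"
        using j pq A by (simp add: dimN)
      also have "\<dots> = 0"
        using j pq unfolding adj3_mult[OF A] zero by simp
      finally show "(transpose_mat A *\<^sub>v row ?N p) $ j = 0\<^sub>v 3 $ j"
        using j by simp
    qed (use A in simp)
    have "row ?N p \<bullet> (B *\<^sub>v col ?N q) = row ?N p \<bullet> col (B * ?N) q"
      using pq(2) by (simp only: col_mult2[OF B adj3_carrier])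
    also have "\<dots> = (?N * (B * ?N)) $$ (p, q)"
      using pq B by (simp add: dimN)
    also have "?N * (B * ?N) = 0\<^sub>m 3 3"
      using adj3_sandwich[OF A B assms(3,4)] by (simp only: assoc_mult_mat[OF adj3_carrier B adj3_carrier])
    finally show "row ?N p \<bullet> (B *\<^sub>v col ?N q) = 0"
      using pq by simp
  qed
qed

text \<open>Only right kernels occur here; the condition on left kernels is the same predicate for
  the transposed matrices.\<close>

definition nondegenerate :: "nat \<Rightarrow> 'a :: field mat \<Rightarrow> 'a mat \<Rightarrow> bool" where
  "nondegenerate n A B \<longleftrightarrow>
     (\<forall>v \<in> carrier_vec n. A *\<^sub>v v = 0\<^sub>v n \<and> B *\<^sub>v v = 0\<^sub>v n \<longrightarrow> v = 0\<^sub>v n)"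

lemma nondegenerateD:
  "nondegenerate n A B \<Longrightarrow> v \<in> carrier_vec n \<Longrightarrow> A *\<^sub>v v = 0\<^sub>v n \<Longrightarrow> B *\<^sub>v v = 0\<^sub>v n \<Longrightarrow> v = 0\<^sub>v n"
  by (auto simp: nondegenerate_def)

lemma mult_mat_vec_eq_0_iff:
  fixes X :: "'a :: field mat"
  assumes "X \<in> carrier_mat n n" "v \<in> carrier_vec n" "det X \<noteq> 0"
  shows "X *\<^sub>v v = 0\<^sub>v n \<longleftrightarrow> v = 0\<^sub>v n"
  using assms det_0_iff_vec_prod_zero_field[OF assms(1)] by auto

lemma nondegenerate_equivalent:
  fixes A B :: "'a :: field mat"
  assumes X: "X \<in> carrier_mat n n" and Y: "Y \<in> carrier_mat n n"
    and A: "A \<in> carrier_mat n n" and B: "B \<in> carrier_mat n n"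
    and "det X \<noteq> 0" "det Y \<noteq> 0" and nd: "nondegenerate n A B"
  shows "nondegenerate n (X * A * Y) (X * B * Y)"
  unfolding nondegenerate_def
proof (intro ballI impI)
  fix v :: "'a vec" assume v: "v \<in> carrier_vec n"
  assume *: "X * A * Y *\<^sub>v v = 0\<^sub>v n \<and> X * B * Y *\<^sub>v v = 0\<^sub>v n"
  have Yv: "Y *\<^sub>v v \<in> carrier_vec n"
    using Y v by (rule mult_mat_vec_carrier)
  have "X * C * Y *\<^sub>v v = X *\<^sub>v (C *\<^sub>v (Y *\<^sub>v v))" if C: "C \<in> carrier_mat n n" for C
  proof -
    have "X * C * Y *\<^sub>v v = X * C *\<^sub>v (Y *\<^sub>v v)"
      using mult_carrier_mat[OF X C] Y v by (rule assoc_mult_mat_vec)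
    also have "\<dots> = X *\<^sub>v (C *\<^sub>v (Y *\<^sub>v v))"
      using X C Yv by (rule assoc_mult_mat_vec)
    finally show ?thesis .
  qed
  with * A B have "X *\<^sub>v (A *\<^sub>v (Y *\<^sub>v v)) = 0\<^sub>v n" "X *\<^sub>v (B *\<^sub>v (Y *\<^sub>v v)) = 0\<^sub>v n"
    by auto
  then have "A *\<^sub>v (Y *\<^sub>v v) = 0\<^sub>v n" "B *\<^sub>v (Y *\<^sub>v v) = 0\<^sub>v n"
    using mult_mat_vec_eq_0_iff[OF X _ assms(5)] mult_mat_vec_carrier[OF A Yv]
      mult_mat_vec_carrier[OF B Yv] by auto
  then have "Y *\<^sub>v v = 0\<^sub>v n"
    using nondegenerateD[OF nd Yv] by blast
  then show "v = 0\<^sub>v n"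
    using mult_mat_vec_eq_0_iff[OF Y v assms(6)] by blast
qed

lemma nondegenerate_combination:
  fixes A B :: "'a :: field mat"
  assumes A: "A \<in> carrier_mat n n" and B: "B \<in> carrier_mat n n" and "nondegenerate n A B"
  shows "nondegenerate n (A + B) B"
  unfolding nondegenerate_def
proof (intro ballI impI)
  fix v :: "'a vec" assume v: "v \<in> carrier_vec n"
  assume *: "(A + B) *\<^sub>v v = 0\<^sub>v n \<and> B *\<^sub>v v = 0\<^sub>v n"
  have "(A + B) *\<^sub>v v = A *\<^sub>v v + B *\<^sub>v v"
    by (rule add_mult_distrib_mat_vec[OF A B v])
  then have "A *\<^sub>v v = 0\<^sub>v n"
    using * mult_mat_vec_carrier[OF A v] by simp
  with * show "v = 0\<^sub>v n"
    using nondegenerateD[OF assms(3) v] by blast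
qed

lemma nondegenerate_commute: "nondegenerate n A B \<Longrightarrow> nondegenerate n B A"
  by (auto simp: nondegenerate_def)

text \<open>The vanishing minors make \<open>(d, e, f)\<close> proportional to
  \<open>(p, q, r)\<close>. The conclusion is multiplied by each of \<open>p\<close>,
  \<open>q\<close>, \<open>r\<close>, so that it is a polynomial identity; whichever of them is
  nonzero can be cancelled afterwards.\<close>

lemma proportional_rows_kernel:
  fixes p :: "'a :: comm_ring_1"
  assumes "p*e = q*d" "p*f = r*d" "q*f = r*e" and 0: "p*x + q*y + r*z = 0"
  shows "p*(d*x + e*y + f*z) = 0 \<and> q*(d*x + e*y + f*z) = 0 \<and> r*(d*x + e*y + f*z) = 0"
proof -
  have "p*(d*x + e*y + f*z) = d*(p*x + q*y + r*z) + (p*e - q*d)*y + (p*f - r*d)*z"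
    "q*(d*x + e*y + f*z) = e*(p*x + q*y + r*z) - (p*e - q*d)*x + (q*f - r*e)*z"
    "r*(d*x + e*y + f*z) = f*(p*x + q*y + r*z) - (p*f - r*d)*x - (q*f - r*e)*y"
    by (simp_all add: algebra_simps)
  with assms show ?thesis by simp
qed

text \<open>A vanishing adjugate means rank at most one: any nonzero row of \<open>A\<close> spans
  the row space and serves as \<open>r\<close>, and \<open>r = 0\<close> serves for
  \<open>A = 0\<close>.\<close>

lemma adj3_eq_0_imp_row:
  fixes A :: "'a :: field mat"
  assumes A: "A \<in> carrier_mat 3 3" and "adj3 A = 0\<^sub>m 3 3"
  obtains r where "r \<in> carrier_vec 3" "\<And>v. v \<in> carrier_vec 3 \<Longrightarrow> r \<bullet> v = 0 \<Longrightarrow> A *\<^sub>v v = 0\<^sub>v 3"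
proof -
  note rowI = that
  obtain a b c d e f g h i where A_eq: "A = mat3 a b c d e f g h i"
    using mat3_cases[OF A] .
  have "0\<^sub>m 3 3 = mat3 0 0 0 0 0 0 0 0 (0 :: 'a)"
    by (intro eq_matI) (auto simp: mat3_def)
  then have "adj3 A = mat3 0 0 0 0 0 0 0 0 0"
    using assms(2) by (simp only:)
  then have minors: "e*i = f*h" "c*h = b*i" "b*f = c*e" "f*g = d*i" "a*i = c*g" "c*d = a*f"
      "d*h = e*g" "b*g = a*h" "a*e = b*d"
    by (auto simp: A_eq adj3_mat3)
  have scalar: "vec3 p q r \<bullet> vec3 x y z = p*x + q*y + r*z" for p q r x y z :: 'a
    by (simp add: scalar_prod_def vec3_def numeral_3_eq_3)
  have *: thesis if row: "p \<noteq> 0 \<or> q \<noteq> 0 \<or> r \<noteq> 0" and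
      m: "\<And>x y z. p*x + q*y + r*z = 0 \<Longrightarrow>
         (p*(a*x+b*y+c*z) = 0 \<and> q*(a*x+b*y+c*z) = 0 \<and> r*(a*x+b*y+c*z) = 0) \<and>
         (p*(d*x+e*y+f*z) = 0 \<and> q*(d*x+e*y+f*z) = 0 \<and> r*(d*x+e*y+f*z) = 0) \<and>
         (p*(g*x+h*y+i*z) = 0 \<and> q*(g*x+h*y+i*z) = 0 \<and> r*(g*x+h*y+i*z) = 0)" for p q r
  proof (rule rowI[of "vec3 p q r"])
    fix v :: "'a vec" assume v: "v \<in> carrier_vec 3" "vec3 p q r \<bullet> v = 0"
    obtain x y z where v_eq: "v = vec3 x y z"
      using vec3_cases[OF v(1)] .
    show "A *\<^sub>v v = 0\<^sub>v 3"
      using m[of x y z] row v(2) by (auto simp: A_eq v_eq scalar mat3_mult_vec3 vec3_zero)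
  qed simp
  consider "a \<noteq> 0 \<or> b \<noteq> 0 \<or> c \<noteq> 0" | "d \<noteq> 0 \<or> e \<noteq> 0 \<or> f \<noteq> 0" | "g \<noteq> 0 \<or> h \<noteq> 0 \<or> i \<noteq> 0"
    | "A = mat3 0 0 0 0 0 0 0 0 0"
    unfolding A_eq by auto
  then show ?thesis
  proof cases
    case 1
    show ?thesis by (rule *[OF 1], rule conjI[OF _ conjI]; rule proportional_rows_kernel)
        (use minors in \<open>simp_all add: mult.commute\<close>)
  next
    case 2
    show ?thesis by (rule *[OF 2], rule conjI[OF _ conjI]; rule proportional_rows_kernel)
        (use minors in \<open>simp_all add: mult.commute\<close>)
  next
    case 3
    show ?thesis by (rule *[OF 3], rule conjI[OF _ conjI]; rule proportional_rows_kernel)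
        (use minors in \<open>simp_all add: mult.commute\<close>)
  next
    case 4
    show ?thesis
    proof (rule rowI[of "vec3 0 0 0"])
      fix v :: "'a vec" assume v: "v \<in> carrier_vec 3"
      show "A *\<^sub>v v = 0\<^sub>v 3"
        by (rule vec3_cases[OF v]) (simp add: 4 mat3_mult_vec3 vec3_zero)
    qed simp
  qed
qed

text \<open>If both ranks are at most one, the two kernels contain the zero sets of two linear
  functionals, and two functionals on a space of dimension 3 have a common nonzero zero. It is
  obtained from a singular matrix with the two functionals and 0 as rows.\<close>

lemma adj3_eq_0_degenerate:
  fixes A B :: "'a :: field mat"
  assumes A: "A \<in> carrier_mat 3 3" and B: "B \<in> carrier_mat 3 3"
    and "adj3 A = 0\<^sub>m 3 3" "adj3 B = 0\<^sub>m 3 3"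
  shows "\<not> nondegenerate 3 A B"
proof -
  obtain r where r: "r \<in> carrier_vec 3" "\<And>v. v \<in> carrier_vec 3 \<Longrightarrow> r \<bullet> v = 0 \<Longrightarrow> A *\<^sub>v v = 0\<^sub>v 3"
    using adj3_eq_0_imp_row[OF A assms(3)] by metis
  obtain s where s: "s \<in> carrier_vec 3" "\<And>v. v \<in> carrier_vec 3 \<Longrightarrow> s \<bullet> v = 0 \<Longrightarrow> B *\<^sub>v v = 0\<^sub>v 3"
    using adj3_eq_0_imp_row[OF B assms(4)] by metis
  obtain a b c where r_eq: "r = vec3 a b c" using vec3_cases[OF r(1)] .
  obtain d e f where s_eq: "s = vec3 d e f" using vec3_cases[OF s(1)] .
  have "det (mat3 a b c d e f 0 0 0) = 0"
    by (simp add: mat3_det)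
  then obtain v where v: "v \<in> carrier_vec 3" "v \<noteq> 0\<^sub>v 3" "mat3 a b c d e f 0 0 0 *\<^sub>v v = 0\<^sub>v 3"
    using det_0_iff_vec_prod_zero_field[OF mat3_carrier] by blast
  obtain x y z where v_eq: "v = vec3 x y z" using vec3_cases[OF v(1)] .
  have "r \<bullet> v = 0" "s \<bullet> v = 0"
    using v(3) by (auto simp: r_eq s_eq v_eq mat3_mult_vec3 vec3_zero)
      (auto simp: scalar_prod_def vec3_def numeral_3_eq_3)
  then have "A *\<^sub>v v = 0\<^sub>v 3" "B *\<^sub>v v = 0\<^sub>v 3"
    using r(2) s(2) v(1) by auto
  then show ?thesis
    using v(1,2) nondegenerateD by blast
qed

text \<open>The determinant with a unit vector as third column is, up to sign, a coordinate of the
  cross product of \<open>v\<close> and \<open>w\<close>. If all these coordinates vanish,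
  \<open>w\<close> is a multiple of \<open>v\<close>, with the factor read off at a nonzero
  coordinate of \<open>v\<close>.\<close>

lemma extend_to_basis3:
  fixes v w :: "'a :: field vec"
  assumes v: "v \<in> carrier_vec 3" "v \<noteq> 0\<^sub>v 3" and w: "w \<in> carrier_vec 3"
    and "\<And>c. w \<noteq> c \<cdot>\<^sub>v v"
  obtains t where "t \<in> carrier_vec 3" "det (mat_of_cols 3 [v, w, t]) \<noteq> 0"
proof -
  note basisI = that
  obtain a b c where v_eq: "v = vec3 a b c" using vec3_cases[OF v(1)] .
  obtain d e f where w_eq: "w = vec3 d e f" using vec3_cases[OF w] .
  have cols: "mat_of_cols 3 [v, w, vec3 x y z] = mat3 a d x b e y c f z" for x y z
    by (intro eq_matI)
      (auto simp: v_eq w_eq mat_of_cols_index mat3_def vec3_def less_3_cases numeral_2_eq_2)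
  have smult: "k \<cdot>\<^sub>v v = vec3 (k*a) (k*b) (k*c)" for k
    by (intro eq_vecI) (auto simp: v_eq vec3_def)
  have *: thesis if "det (mat3 a d x b e y c f z) \<noteq> 0" for x y z
    using that by (intro basisI[of "vec3 x y z"]) (simp_all add: cols)
  show ?thesis
  proof (cases "b*f = c*e \<and> a*f = c*d \<and> a*e = b*d")
    case True
    have "a \<noteq> 0 \<or> b \<noteq> 0 \<or> c \<noteq> 0" using v(2) by (auto simp: v_eq vec3_zero)
    then have "w = (if a \<noteq> 0 then d / a else if b \<noteq> 0 then e / b else f / c) \<cdot>\<^sub>v v"
      using True by (auto simp: smult w_eq field_simps)
    with assms(4) show ?thesis by blast
  next
    case False
    then show ?thesis
      using *[of 1 0 0] *[of 0 1 0] *[of 0 0 1] by (auto simp: mat3_det algebra_simps)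
  qed
qed

text \<open>A diagonal right factor scales columns. The first scale turns \<open>q\<close> into
  \<open>p\<close>, the second turns \<open>q'\<close> into \<open>p'\<close>, and neither disturbs
  the other matrix.\<close>

lemma diag_block_symmetrizable:
  fixes p q p' q' r s :: "'a :: field"
  assumes "p \<noteq> 0" "q \<noteq> 0" "p' \<noteq> 0" "q' \<noteq> 0"
  shows "symmetrizable 3 (mat3 0 0 0 0 0 p' 0 q' r) (mat3 0 0 p 0 0 0 q 0 s)"
proof -
  let ?Q = "mat3 (p / q) 0 0 0 (p' / q') 0 0 0 1"
  have "det ?Q \<noteq> 0" "symmetrizes ?Q (mat3 0 0 0 0 0 p' 0 q' r)" "symmetrizes ?Q (mat3 0 0 p 0 0 0 q 0 s)"
    using assms by (simp_all add: mat3_det symmetrizes_def mat3_mult mat3_transpose)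
  then show ?thesis
    unfolding symmetrizable_def by (intro bexI[of _ ?Q]) simp_all
qed

lemma mat3_unit_cols:
  fixes a :: "'a :: comm_ring_1"
  shows "mat3 a b c d e f g h i *\<^sub>v vec3 1 0 0 = vec3 a d g"
    "mat3 a b c d e f g h i *\<^sub>v vec3 0 1 0 = vec3 b e h"
  by (simp_all add: mat3_mult_vec3)

text \<open>On the right the basis starts with kernel vectors of \<open>A\<close> and
  \<open>B\<close>, on the left with left kernel vectors of \<open>A\<close> and \<open>B\<close>.
  Then \<open>A\<close> has zero row and column 0, and \<open>B\<close> has zero row and column 1.
  The remaining upper left entries, \<open>(1, 1)\<close> of \<open>A\<close> and
  \<open>(0, 0)\<close> of \<open>B\<close>, vanish by the pairing relations from the
  adjugates.\<close>

lemma symmetrizable_singular: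
  fixes A B :: "'a :: field mat"
  assumes A: "A \<in> carrier_mat 3 3" and B: "B \<in> carrier_mat 3 3"
    and det: "det A = 0" "det B = 0" "tr_adj3 A B = 0" "tr_adj3 B A = 0"
    and adj: "adj3 A \<noteq> 0\<^sub>m 3 3" "adj3 B \<noteq> 0\<^sub>m 3 3"
    and nd: "nondegenerate 3 A B" "nondegenerate 3 (transpose_mat A) (transpose_mat B)"
  shows "symmetrizable 3 A B"
proof -
  have AT: "transpose_mat A \<in> carrier_mat 3 3" and BT: "transpose_mat B \<in> carrier_mat 3 3"
    using A B by simp_all
  obtain v1 w1 where vw1: "v1 \<in> carrier_vec 3" "w1 \<in> carrier_vec 3" "v1 \<noteq> 0\<^sub>v 3" "w1 \<noteq> 0\<^sub>v 3"
      "A *\<^sub>v v1 = 0\<^sub>v 3" "transpose_mat A *\<^sub>v w1 = 0\<^sub>v 3" "w1 \<bullet> (B *\<^sub>v v1) = 0"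
    using kernel_vectors_of_adj3[OF A B det(1,3) adj(1)] by metis
  obtain v2 w2 where vw2: "v2 \<in> carrier_vec 3" "w2 \<in> carrier_vec 3" "v2 \<noteq> 0\<^sub>v 3" "w2 \<noteq> 0\<^sub>v 3"
      "B *\<^sub>v v2 = 0\<^sub>v 3" "transpose_mat B *\<^sub>v w2 = 0\<^sub>v 3" "w2 \<bullet> (A *\<^sub>v v2) = 0"
    using kernel_vectors_of_adj3[OF B A det(2,4) adj(2)] by metis
  \<comment> \<open>Proportional kernel vectors of \<open>C\<close> and \<open>D\<close> would lie
    in the common kernel.\<close>
  have indep: "u2 \<noteq> c \<cdot>\<^sub>v u1"
    if "u1 \<in> carrier_vec 3" "u2 \<noteq> 0\<^sub>v 3" "C *\<^sub>v u1 = 0\<^sub>v 3" "D *\<^sub>v u2 = 0\<^sub>v 3" "u2 \<in> carrier_vec 3"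
      "C \<in> carrier_mat 3 3" "nondegenerate 3 C D"
    for u1 u2 c and C D :: "'a mat"
  proof
    assume eq: "u2 = c \<cdot>\<^sub>v u1"
    have "C *\<^sub>v u2 = c \<cdot>\<^sub>v (C *\<^sub>v u1)"
      unfolding eq using that(6,1) by (rule mult_mat_vec)
    also have "\<dots> = 0\<^sub>v 3"
      unfolding that(3) by (intro eq_vecI) simp_all
    finally show False
      using nondegenerateD[OF that(7,5)] that(2,4) by blast
  qed
  obtain t where t: "t \<in> carrier_vec 3" "det (mat_of_cols 3 [v1, v2, t]) \<noteq> 0"
    using extend_to_basis3[OF vw1(1,3) vw2(1)]
      indep[OF vw1(1) vw2(3) vw1(5) vw2(5) vw2(1) A nd(1)] by metis
  obtain e where e: "e \<in> carrier_vec 3" "det (mat_of_cols 3 [w1, w2, e]) \<noteq> 0"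
    using extend_to_basis3[OF vw1(2,4) vw2(2)]
      indep[OF vw1(2) vw2(4) vw1(6) vw2(6) vw2(2) AT nd(2)] by metis
  define Y where "Y = mat_of_cols 3 [v1, v2, t]"
  define X where "X = transpose_mat (mat_of_cols 3 [w1, w2, e])"
  have Y: "Y \<in> carrier_mat 3 3" "det Y \<noteq> 0"
    using t by (simp_all add: Y_def carrier_matI)
  have X: "X \<in> carrier_mat 3 3" "det X \<noteq> 0"
    using e det_transpose[of "mat_of_cols 3 [w1, w2, e]" 3] by (simp_all add: X_def carrier_matI)
  have entry: "(X * C * Y) $$ (i, j) = ([w1, w2, e] ! i) \<bullet> (C *\<^sub>v ([v1, v2, t] ! j))"
    if "C \<in> carrier_mat 3 3" "i < 3" "j < 3" for C i j
  proof -
    have "X * C * Y = X * (C * Y)"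
      using X(1) that(1) Y(1) by (rule assoc_mult_mat)
    moreover have "(X * (C * Y)) $$ (i, j) = row X i \<bullet> col (C * Y) j"
      using X(1) Y(1) that by simp
    moreover have "col (C * Y) j = C *\<^sub>v col Y j"
      using that(1) Y(1) that(3) by (rule col_mult2)
    moreover have "col Y j = [v1, v2, t] ! j" "row X i = [w1, w2, e] ! i"
      using that(2,3) vw1(1,2) vw2(1,2) t(1) e(1)
      by (auto simp: X_def Y_def less_3_cases row_transpose numeral_2_eq_2)
    ultimately show ?thesis by simp
  qed
  have kerl: "w \<bullet> (C *\<^sub>v v) = 0" if "transpose_mat C *\<^sub>v w = 0\<^sub>v 3"
      "C \<in> carrier_mat 3 3" "v \<in> carrier_vec 3" "w \<in> carrier_vec 3" for v w :: "'a vec" and C :: "'a mat"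
    using transpose_vec_mult_scalar[OF that(2,3,4)] that(1,3) by simp
  obtain p' q' r where NA: "X * A * Y = mat3 0 0 0 0 0 p' 0 q' r"
  proof -
    have "X * A * Y = mat3 0 0 0 0 0 ((X * A * Y) $$ (1, 2)) 0 ((X * A * Y) $$ (2, 1)) ((X * A * Y) $$ (2, 2))"
    proof (rule eq_matI)
      fix i j assume "i < dim_row (mat3 0 0 0 0 0 ((X * A * Y) $$ (1, 2)) 0 ((X * A * Y) $$ (2, 1)) ((X * A * Y) $$ (2, 2)))"
        and "j < dim_col (mat3 0 0 0 0 0 ((X * A * Y) $$ (1, 2)) 0 ((X * A * Y) $$ (2, 1)) ((X * A * Y) $$ (2, 2)))"
      then have ij: "i < 3" "j < 3" by (simp_all add: mat3_def)
      then show "(X * A * Y) $$ (i, j) = mat3 0 0 0 0 0 ((X * A * Y) $$ (1, 2)) 0 ((X * A * Y) $$ (2, 1)) ((X * A * Y) $$ (2, 2)) $$ (i, j)"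
        unfolding less_3_cases using vw1 vw2 t e kerl[OF vw1(6) A]
        by (elim disjE) (simp_all add: entry[OF A])
    qed (simp_all add: carrier_matD[OF X(1)] carrier_matD[OF Y(1)] mat3_def)
    then show ?thesis by (rule that)
  qed
  obtain p q s where NB: "X * B * Y = mat3 0 0 p 0 0 0 q 0 s"
  proof -
    have "X * B * Y = mat3 0 0 ((X * B * Y) $$ (0, 2)) 0 0 0 ((X * B * Y) $$ (2, 0)) 0 ((X * B * Y) $$ (2, 2))"
    proof (rule eq_matI)
      fix i j assume "i < dim_row (mat3 0 0 ((X * B * Y) $$ (0, 2)) 0 0 0 ((X * B * Y) $$ (2, 0)) 0 ((X * B * Y) $$ (2, 2)))"
        and "j < dim_col (mat3 0 0 ((X * B * Y) $$ (0, 2)) 0 0 0 ((X * B * Y) $$ (2, 0)) 0 ((X * B * Y) $$ (2, 2)))"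
      then have ij: "i < 3" "j < 3" by (simp_all add: mat3_def)
      then show "(X * B * Y) $$ (i, j) = mat3 0 0 ((X * B * Y) $$ (0, 2)) 0 0 0 ((X * B * Y) $$ (2, 0)) 0 ((X * B * Y) $$ (2, 2)) $$ (i, j)"
        unfolding less_3_cases using vw1 vw2 t e kerl[OF vw2(6) B]
        by (elim disjE) (simp_all add: entry[OF B])
    qed (simp_all add: carrier_matD[OF X(1)] carrier_matD[OF Y(1)] mat3_def)
    then show ?thesis by (rule that)
  qed
  have ndN: "nondegenerate 3 (X * A * Y) (X * B * Y)"
    by (rule nondegenerate_equivalent[OF X(1) Y(1) A B X(2) Y(2) nd(1)])
  have transN: "transpose_mat (X * C * Y) = transpose_mat Y * transpose_mat C * transpose_mat X"
    if C: "C \<in> carrier_mat 3 3" for C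
  proof -
    have "transpose_mat (X * C * Y) = transpose_mat Y * transpose_mat (X * C)"
      using mult_carrier_mat[OF X(1) C] Y(1) by (rule transpose_mult)
    also have "transpose_mat (X * C) = transpose_mat C * transpose_mat X"
      using X(1) C by (rule transpose_mult)
    also have "transpose_mat Y * (transpose_mat C * transpose_mat X) = transpose_mat Y * transpose_mat C * transpose_mat X"
      by (rule assoc_mult_mat[symmetric, of _ 3 3 _ 3 _ 3]) (use X C Y in simp_all)
    finally show ?thesis .
  qed
  have ndT: "nondegenerate 3 (transpose_mat (X * A * Y)) (transpose_mat (X * B * Y))"
    unfolding transN[OF A] transN[OF B]
    by (rule nondegenerate_equivalent[OF _ _ AT BT _ _ nd(2)])
      (use X Y det_transpose[OF X(1)] det_transpose[OF Y(1)] in simp_all)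
  \<comment> \<open>A zero among \<open>p\<close>, \<open>q\<close>, \<open>p'\<close>,
    \<open>q'\<close> would make a unit vector a common kernel vector of the transformed pair or of
    its transposes.\<close>
  have "q \<noteq> 0"
    using nondegenerateD[OF ndN, of "vec3 1 0 0"] by (auto simp: NA NB mat3_unit_cols vec3_zero)
  moreover have "q' \<noteq> 0"
    using nondegenerateD[OF ndN, of "vec3 0 1 0"] by (auto simp: NA NB mat3_unit_cols vec3_zero)
  moreover have "p \<noteq> 0"
    using nondegenerateD[OF ndT, of "vec3 1 0 0"]
    by (auto simp: NA NB mat3_transpose mat3_unit_cols vec3_zero)
  moreover have "p' \<noteq> 0"
    using nondegenerateD[OF ndT, of "vec3 0 1 0"]
    by (auto simp: NA NB mat3_transpose mat3_unit_cols vec3_zero)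
  ultimately have "symmetrizable 3 (X * A * Y) (X * B * Y)"
    unfolding NA NB by (intro diag_block_symmetrizable)
  then show ?thesis
    by (rule symmetrizable_equivalent[OF X(1) Y(1) A B X(2) Y(2)])
qed

lemma symmetrizable_singular_pencil:
  fixes A B :: "'a :: alg_closed_field mat"
  assumes A: "A \<in> carrier_mat 3 3" and B: "B \<in> carrier_mat 3 3"
    and det: "\<And>x y. det (x \<cdot>\<^sub>m A + y \<cdot>\<^sub>m B) = 0"
    and adj: "adj3 A \<noteq> 0\<^sub>m 3 3" "adj3 B \<noteq> 0\<^sub>m 3 3"
    and nd: "nondegenerate 3 A B" "nondegenerate 3 (transpose_mat A) (transpose_mat B)"
  shows "symmetrizable 3 A B"
proof -
  let ?f = "\<lambda>x y. x^3 * det A + x^2 * y * tr_adj3 A B + x * y^2 * tr_adj3 B A + y^3 * det B"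
  have f: "?f x y = 0" for x y
    using det[of x y] unfolding det_pencil3[OF A B] .
  have dA: "det A = 0" and dB: "det B = 0"
    using f[of 1 0] f[of 0 1] by simp_all
  \<comment> \<open>Vanishing at all points must be turned into vanishing of coefficients; over the
    field with two elements \<open>x^2 * y - x * y^2\<close> vanishes everywhere. By the value at
    \<open>(1, 1)\<close> the mixed coefficients are opposite, and the value at
    \<open>(t, 1)\<close> is \<open>t * (t - 1)\<close> times the first. Any \<open>t\<close> other
    than 0 and 1 would do; a root of \<open>t * (t - 1) = 1\<close> is one in every
    characteristic.\<close>
  have "\<exists>t. poly [:-1, -1, 1 :: 'a:] t = 0"
    by (rule alg_closed_imp_poly_has_root) simp
  then obtain t :: 'a where "t * (t - 1) = 1"
    by (auto simp: algebra_simps)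
  moreover have "tr_adj3 B A = - tr_adj3 A B"
    using f[of 1 1] by (simp add: dA dB eq_neg_iff_add_eq_0 add.commute)
  moreover have "t^2 * tr_adj3 A B + t * tr_adj3 B A = 0"
    using f[of t 1] by (simp add: dA dB)
  ultimately have "tr_adj3 A B = 0" "tr_adj3 B A = 0"
    by (auto simp: power2_eq_square algebra_simps)
  with dA dB adj nd show ?thesis
    by (intro symmetrizable_singular[OF A B])
qed

theorem pencil3_symmetrizable:
  fixes A B :: "'a :: alg_closed_field mat"
  assumes A: "A \<in> carrier_mat 3 3" and B: "B \<in> carrier_mat 3 3"
    and nd: "nondegenerate 3 A B" "nondegenerate 3 (transpose_mat A) (transpose_mat B)"
  shows "symmetrizable 3 A B"
proof (cases "\<exists>x y. det (x \<cdot>\<^sub>m A + y \<cdot>\<^sub>m B) \<noteq> 0")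
  case True
  then show ?thesis
    using symmetrizable_regular[OF A B] by blast
next
  case False
  have aux: "symmetrizable 3 C D"
    if C: "C \<in> carrier_mat 3 3" and D: "D \<in> carrier_mat 3 3"
      and det: "\<And>x y. det (x \<cdot>\<^sub>m C + y \<cdot>\<^sub>m D) = 0"
      and nd: "nondegenerate 3 C D" "nondegenerate 3 (transpose_mat C) (transpose_mat D)"
      and adj: "adj3 D \<noteq> 0\<^sub>m 3 3"
    for C D :: "'a mat"
  proof (cases "adj3 C = 0\<^sub>m 3 3")
    \<comment> \<open>Here \<open>C\<close> has rank at most one and is replaced by
      \<open>C + D\<close>. If that also had vanishing adjugate, then \<open>C + D\<close> and
      \<open>C\<close>, which span the same pencil, would have a common kernel vector.\<close>
    case True
    have CD: "C + D \<in> carrier_mat 3 3" and one: "1 \<cdot>\<^sub>m C + 1 \<cdot>\<^sub>m D = C + D"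
      using C D by (simp, intro eq_matI) auto
    have "nondegenerate 3 (C + D) C"
      using nondegenerate_combination[OF D C nondegenerate_commute[OF nd(1)]] D C
      by (simp add: comm_add_mat[of C 3 3 D])
    then have "adj3 (C + D) \<noteq> 0\<^sub>m 3 3"
      using adj3_eq_0_degenerate[OF CD C _ True] by blast
    moreover have "det (x \<cdot>\<^sub>m (C + D) + y \<cdot>\<^sub>m D) = 0" for x y
    proof -
      have "x \<cdot>\<^sub>m (C + D) + y \<cdot>\<^sub>m D = x \<cdot>\<^sub>m C + (x + y) \<cdot>\<^sub>m D"
        using C D by (intro eq_matI) (auto simp: algebra_simps)
      then show ?thesis using det by simp
    qed
    moreover have "nondegenerate 3 (C + D) D"
      by (rule nondegenerate_combination[OF C D nd(1)])
    moreover have "nondegenerate 3 (transpose_mat (C + D)) (transpose_mat D)"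
      using nondegenerate_combination[OF _ _ nd(2)] C D by (simp add: transpose_add[OF C D])
    ultimately have "symmetrizable 3 (C + D) D"
      using adj by (intro symmetrizable_singular_pencil[OF CD D])
    then show ?thesis
      using symmetrizable_combination[OF C D, of 1 1] by (simp add: one)
  next
    case False
    then show ?thesis
      using symmetrizable_singular_pencil[OF C D det _ adj nd] by blast
  qed
  show ?thesis
  proof (cases "adj3 B = 0\<^sub>m 3 3")
    \<comment> \<open>At least one of the two adjugates is nonzero; the matrices are exchanged so
      that it belongs to the second one.\<close>
    case True
    then have "adj3 A \<noteq> 0\<^sub>m 3 3"
      using adj3_eq_0_degenerate[OF A B] nd(1) by blast
    moreover have "det (x \<cdot>\<^sub>m B + y \<cdot>\<^sub>m A) = 0" for x y
      using False A B by (simp add: comm_add_mat[of "x \<cdot>\<^sub>m B" 3 3 "y \<cdot>\<^sub>m A"])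
    ultimately have "symmetrizable 3 B A"
      using nd by (intro aux[OF B A]) (auto intro: nondegenerate_commute)
    then show ?thesis by (rule symmetrizable_commute)
  next
    case 2: False
    then show ?thesis
      using False by (intro aux[OF A B _ nd]) auto
  qed
qed

section \<open>Quotients and restriction of scalars\<close>

lemma quot_sel:
  "carrier (quot M N) = a_rcosets\<^bsub>M\<^esub> N" "mult (quot M N) = rcoset_mult M N"
  "one (quot M N) = N +>\<^bsub>M\<^esub> one M" "zero (quot M N) = N" "add (quot M N) = set_add M"
  by (simp_all add: quot_def FactRing_def)

lemma quot_carrier: "carrier (quot M N) = {N +>\<^bsub>M\<^esub> x | x. x \<in> carrier M}"
  by (auto simp: quot_sel A_RCOSETS_def' a_r_coset_def')

lemma quot_add:
  assumes "abelian_subgroup N M" "x \<in> carrier M" "y \<in> carrier M"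
  shows "(N +>\<^bsub>M\<^esub> x) \<oplus>\<^bsub>quot M N\<^esub> (N +>\<^bsub>M\<^esub> y) = N +>\<^bsub>M\<^esub> (x \<oplus>\<^bsub>M\<^esub> y)"
  using abelian_subgroup.a_rcos_sum[OF assms] by (simp add: quot_sel)

lemma quot_mult:
  assumes "ideal N M" "x \<in> carrier M" "y \<in> carrier M"
  shows "(N +>\<^bsub>M\<^esub> x) \<otimes>\<^bsub>quot M N\<^esub> (N +>\<^bsub>M\<^esub> y) = N +>\<^bsub>M\<^esub> (x \<otimes>\<^bsub>M\<^esub> y)"
  using ideal.rcoset_mult_add[OF assms] by (simp add: quot_sel)

text \<open>All representatives yield the same coset, so the union in \<open>quot\<close> is
  constant. Only closure and distributivity of this one scalar are assumed, which covers modules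
  over a ring as well as the free algebra with its scalars in the field.\<close>

lemma quot_smult:
  assumes N: "abelian_subgroup N M" and x: "x \<in> carrier M"
    and closed: "\<And>y. y \<in> carrier M \<Longrightarrow> c \<odot>\<^bsub>M\<^esub> y \<in> carrier M" "\<And>y. y \<in> N \<Longrightarrow> c \<odot>\<^bsub>M\<^esub> y \<in> N"
    and distr: "\<And>y z. y \<in> carrier M \<Longrightarrow> z \<in> carrier M \<Longrightarrow>
      c \<odot>\<^bsub>M\<^esub> (y \<oplus>\<^bsub>M\<^esub> z) = c \<odot>\<^bsub>M\<^esub> y \<oplus>\<^bsub>M\<^esub> c \<odot>\<^bsub>M\<^esub> z"
  shows "c \<odot>\<^bsub>quot M N\<^esub> (N +>\<^bsub>M\<^esub> x) = N +>\<^bsub>M\<^esub> (c \<odot>\<^bsub>M\<^esub> x)"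
proof -
  interpret abelian_subgroup N M by (rule N)
  have "N +>\<^bsub>M\<^esub> (c \<odot>\<^bsub>M\<^esub> y) = N +>\<^bsub>M\<^esub> (c \<odot>\<^bsub>M\<^esub> x)" if y: "y \<in> N +>\<^bsub>M\<^esub> x" for y
  proof -
    obtain n where n: "n \<in> N" "y = n \<oplus>\<^bsub>M\<^esub> x"
      using y by (auto simp: a_r_coset_def')
    then have "c \<odot>\<^bsub>M\<^esub> y = c \<odot>\<^bsub>M\<^esub> n \<oplus>\<^bsub>M\<^esub> c \<odot>\<^bsub>M\<^esub> x"
      using distr x a_Hcarr by simp
    then have "c \<odot>\<^bsub>M\<^esub> y \<in> N +>\<^bsub>M\<^esub> (c \<odot>\<^bsub>M\<^esub> x)"
      using closed(2)[OF n(1)] by (auto simp: a_r_coset_def')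
    then show ?thesis
      using a_repr_independence'[OF _ closed(1)[OF x]] by simp
  qed
  then have "(\<Union>y\<in>N +>\<^bsub>M\<^esub> x. N +>\<^bsub>M\<^esub> (c \<odot>\<^bsub>M\<^esub> y)) = N +>\<^bsub>M\<^esub> (c \<odot>\<^bsub>M\<^esub> x)"
    by (intro UN_constant_eq[OF a_rcos_self[OF x]] ballI)
  then show ?thesis
    by (simp add: quot_def)
qed

lemma abelian_group_quot:
  assumes "abelian_subgroup N M"
  shows "abelian_group (quot M N)"
proof -
  interpret abelian_subgroup N M by (rule assms)
  have zero: "\<zero>\<^bsub>quot M N\<^esub> = N +>\<^bsub>M\<^esub> \<zero>\<^bsub>M\<^esub>"
    using a_rcos_const[OF additive_subgroup.zero_closed[OF additive_subgroup_axioms]]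
    by (simp add: quot_sel)
  note ad = quot_add[OF assms]
  show ?thesis
  proof (rule abelian_groupI)
    fix X assume "X \<in> carrier (quot M N)"
    then obtain x where x: "x \<in> carrier M" "X = N +>\<^bsub>M\<^esub> x" by (auto simp: quot_carrier)
    then have "(N +>\<^bsub>M\<^esub> (\<ominus>\<^bsub>M\<^esub> x)) \<oplus>\<^bsub>quot M N\<^esub> X = \<zero>\<^bsub>quot M N\<^esub>"
      by (simp add: ad zero l_neg)
    then show "\<exists>Y \<in> carrier (quot M N). Y \<oplus>\<^bsub>quot M N\<^esub> X = \<zero>\<^bsub>quot M N\<^esub>"
      using x by (auto simp: quot_carrier)
  qed (auto simp: quot_carrier ad zero a_ac)
qed

lemma (in Module.module) submodule_abelian_subgroup:
  assumes "LinearCombinations.submodule R N M"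
  shows "abelian_subgroup N M"
proof (rule abelian_subgroupI3)
  interpret N: LinearCombinations.submodule R N M by (rule assms)
  \<comment> \<open>A submodule is closed under addition and scalars only, so negatives are obtained
    from the scalar \<open>-1\<close>.\<close>
  have inv: "\<ominus>\<^bsub>M\<^esub> x \<in> N" if "x \<in> N" for x
  proof -
    have "x \<in> carrier M" using that N.subset by blast
    then have "\<ominus>\<^bsub>M\<^esub> x = (\<ominus> \<one>) \<odot>\<^bsub>M\<^esub> x"
      by (simp add: smult_l_minus)
    then show ?thesis using that by simp
  qed
  show "additive_subgroup N M"
    by (rule additive_subgroup.intro, rule subgroup.intro)
      (use N.subset inv in \<open>auto simp: a_inv_def[symmetric]\<close>)
qed (rule abelian_group_axioms)

lemma module_quot:
  assumes M: "Module.module R M" and N: "LinearCombinations.submodule R N M"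
  shows "Module.module R (quot M N)"
proof -
  interpret Module.module R M by (rule M)
  interpret N: LinearCombinations.submodule R N M by (rule N)
  have sub: "abelian_subgroup N M" by (rule submodule_abelian_subgroup[OF N])
  have sm: "c \<odot>\<^bsub>quot M N\<^esub> (N +>\<^bsub>M\<^esub> x) = N +>\<^bsub>M\<^esub> (c \<odot>\<^bsub>M\<^esub> x)" if "c \<in> carrier R" "x \<in> carrier M" for c x
    by (rule quot_smult[OF sub]) (use that in \<open>auto simp: smult_r_distr\<close>)
  note ad = quot_add[OF sub]
  show ?thesis
    by (rule moduleI[OF is_cring abelian_group_quot[OF sub]])
      (auto simp: quot_carrier sm ad smult_l_distr smult_r_distr smult_assoc1)
qed

lemma restrict_scalars_sel [simp]:
  "carrier (restrict_scalars h M) = carrier M" "zero (restrict_scalars h M) = zero M"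
  "add (restrict_scalars h M) = add M" "smult (restrict_scalars h M) = (\<lambda>r x. h r \<odot>\<^bsub>M\<^esub> x)"
  by (simp_all add: restrict_scalars_def)

lemma abelian_group_cong:
  assumes "abelian_group M" "carrier M' = carrier M" "zero M' = zero M" "add M' = add M"
  shows "abelian_group M'"
proof -
  interpret abelian_group M by (rule assms(1))
  show ?thesis
    by (rule abelian_groupI) (use l_neg in \<open>auto simp: assms(2-) a_ac\<close>)
qed

lemma finsum_cong_structure:
  assumes "carrier M' = carrier M" "zero M' = zero M" "add M' = add M"
  shows "finsum M' f A = finsum M f A"
  using assms by (simp add: finsum_def finprod_def)

lemma module_restrict_scalars:
  assumes M: "Module.module R M" and S: "cring S" and h: "h \<in> Ring.ring_hom S R"
  shows "Module.module S (restrict_scalars h M)"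
proof -
  interpret Module.module R M by (rule M)
  have "abelian_group (restrict_scalars h M)"
    by (rule abelian_group_cong[OF abelian_group_axioms]) simp_all
  then show ?thesis
    by (rule moduleI[OF S])
      (use h in \<open>auto simp: Ring.ring_hom_closed Ring.ring_hom_add Ring.ring_hom_mult Ring.ring_hom_one
        smult_l_distr smult_r_distr smult_assoc1\<close>)
qed

text \<open>Each module axiom is an equation that can be checked after applying the injective
  \<open>f\<close>. This later yields the module axioms for the radical of the constructed algebra
  from those of \<open>M\<close>.\<close>

lemma module_pullback:
  assumes M: "Module.module R M" and bij: "bij_betw f (carrier X) (carrier M)"
    and zero: "\<zero>\<^bsub>X\<^esub> \<in> carrier X" "f \<zero>\<^bsub>X\<^esub> = \<zero>\<^bsub>M\<^esub>"
    and add: "\<And>x y. x \<in> carrier X \<Longrightarrow> y \<in> carrier X \<Longrightarrow>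
      x \<oplus>\<^bsub>X\<^esub> y \<in> carrier X \<and> f (x \<oplus>\<^bsub>X\<^esub> y) = f x \<oplus>\<^bsub>M\<^esub> f y"
    and smult: "\<And>r x. r \<in> carrier R \<Longrightarrow> x \<in> carrier X \<Longrightarrow>
      r \<odot>\<^bsub>X\<^esub> x \<in> carrier X \<and> f (r \<odot>\<^bsub>X\<^esub> x) = r \<odot>\<^bsub>M\<^esub> f x"
  shows "Module.module R X"
proof -
  interpret Module.module R M by (rule M)
  have f: "f x \<in> carrier M" if "x \<in> carrier X" for x
    using bij that by (auto simp: bij_betw_def)
  have inj: "x = y" if "f x = f y" "x \<in> carrier X" "y \<in> carrier X" for x y
    using bij that by (auto simp: bij_betw_def inj_on_def)
  have ad: "x \<oplus>\<^bsub>X\<^esub> y \<in> carrier X" "f (x \<oplus>\<^bsub>X\<^esub> y) = f x \<oplus>\<^bsub>M\<^esub> f y"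
    if "x \<in> carrier X" "y \<in> carrier X" for x y
    using add[OF that] by simp_all
  have sm: "r \<odot>\<^bsub>X\<^esub> x \<in> carrier X" "f (r \<odot>\<^bsub>X\<^esub> x) = r \<odot>\<^bsub>M\<^esub> f x"
    if "r \<in> carrier R" "x \<in> carrier X" for r x
    using smult[OF that] by simp_all
  have "abelian_group X"
  proof (rule abelian_groupI)
    fix x assume x: "x \<in> carrier X"
    \<comment> \<open>The record \<open>X\<close> carries no negation; the additive inverse of
      \<open>x\<close> is \<open>x\<close> multiplied by \<open>-1\<close>.\<close>
    have "(\<ominus>\<^bsub>R\<^esub> \<one>\<^bsub>R\<^esub>) \<odot>\<^bsub>X\<^esub> x \<oplus>\<^bsub>X\<^esub> x = \<zero>\<^bsub>X\<^esub>"
      by (rule inj) (use x f[OF x] in \<open>simp_all add: ad sm zero smult_l_minus M.l_neg\<close>)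
    then show "\<exists>y \<in> carrier X. y \<oplus>\<^bsub>X\<^esub> x = \<zero>\<^bsub>X\<^esub>"
      using x sm(1) by auto
  qed (auto intro!: inj simp: ad zero f M.a_ac)
  then show ?thesis
    by (rule moduleI[OF is_cring])
      (auto intro!: inj simp: ad sm f smult_l_distr smult_r_distr smult_assoc1)
qed

section \<open>The free algebra\<close>

lemma free_algebra_sel:
  "carrier free_algebra = {f. finite {w. f w \<noteq> (0 :: 'k :: field)}}"
  "mult free_algebra = (\<lambda>f g w. \<Sum>i\<le>length w. f (take i w) * g (drop i w :: letter list) :: 'k)"
  "one free_algebra = (\<lambda>w. if w = [] then 1 else 0 :: 'k)"
  "zero free_algebra = (\<lambda>w. 0 :: 'k)"
  "add free_algebra = (\<lambda>f g w. f w + g w :: 'k)"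
  "Module.smult free_algebra = (\<lambda>c f w. c * f w :: 'k)"
  by (simp_all add: free_algebra_def)

lemma free_algebra_add_closed:
  "f \<in> carrier free_algebra \<Longrightarrow> g \<in> carrier free_algebra \<Longrightarrow> f \<oplus>\<^bsub>free_algebra\<^esub> g \<in> carrier free_algebra"
  unfolding free_algebra_sel mem_Collect_eq
  by (rule finite_subset[of _ "{w. f w \<noteq> 0} \<union> {w. g w \<noteq> 0}"]) auto

lemma free_algebra_smult_closed:
  "f \<in> carrier free_algebra \<Longrightarrow> c \<odot>\<^bsub>free_algebra\<^esub> f \<in> carrier free_algebra"
  unfolding free_algebra_sel mem_Collect_eq
  by (rule finite_subset[of _ "{w. f w \<noteq> 0}"]) auto

lemma free_algebra_mult_closed:
  assumes "f \<in> carrier free_algebra" "g \<in> carrier free_algebra"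
  shows "f \<otimes>\<^bsub>free_algebra\<^esub> g \<in> carrier free_algebra"
  unfolding free_algebra_sel mem_Collect_eq
proof (rule finite_subset)
  show "{w. (\<Sum>i\<le>length w. f (take i w) * g (drop i w)) \<noteq> 0}
      \<subseteq> (\<lambda>(u, v). u @ v) ` ({w. f w \<noteq> 0} \<times> {w. g w \<noteq> 0})"
  proof
    fix w assume "w \<in> {w. (\<Sum>i\<le>length w. f (take i w) * g (drop i w)) \<noteq> 0}"
    then have "\<exists>i\<le>length w. f (take i w) * g (drop i w) \<noteq> 0"
      using sum.neutral[of "{..length w}" "\<lambda>i. f (take i w) * g (drop i w)"] by auto
    then obtain i where "f (take i w) \<noteq> 0" "g (drop i w) \<noteq> 0" by auto
    then show "w \<in> (\<lambda>(u, v). u @ v) ` ({w. f w \<noteq> 0} \<times> {w. g w \<noteq> 0})"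
      by (intro image_eqI[of _ _ "(take i w, drop i w)"]) auto
  qed
  show "finite ((\<lambda>(u, v). u @ v) ` ({w. f w \<noteq> 0} \<times> {w. g w \<noteq> 0}))"
    using assms by (simp add: free_algebra_sel)
qed

lemma free_algebra_mult_assoc:
  "f \<otimes>\<^bsub>free_algebra\<^esub> g \<otimes>\<^bsub>free_algebra\<^esub> h = f \<otimes>\<^bsub>free_algebra\<^esub> (g \<otimes>\<^bsub>free_algebra\<^esub> (h :: 'k :: field freealg))"
proof
  fix w :: "letter list"
  let ?n = "length w"
  let ?T = "\<lambda>j i. f (take j w) * g (take i (drop j w)) * h (drop (i + j) w)"
  have "(f \<otimes>\<^bsub>free_algebra\<^esub> g \<otimes>\<^bsub>free_algebra\<^esub> h) w
      = (\<Sum>i\<le>?n. \<Sum>j\<le>i. f (take j (take i w)) * g (drop j (take i w)) * h (drop i w))"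
    by (simp add: free_algebra_sel sum_distrib_right min.absorb1)
  also have "\<dots> = (\<Sum>i\<le>?n. \<Sum>j\<le>i. ?T j (i - j))"
    by (intro sum.cong refl) (simp add: drop_take min.absorb1)
  also have "\<dots> = (\<Sum>(i, j)\<in>(SIGMA i:{..?n}. {..i}). ?T j (i - j))"
    by (rule sum.Sigma) auto
  \<comment> \<open>Both bracketings sum over the factorizations of \<open>w\<close> into three
    words. The pair of cut positions is replaced by the lengths of the first and the second
    factor.\<close>
  also have "\<dots> = (\<Sum>(j, i)\<in>(SIGMA j:{..?n}. {..?n - j}). ?T j i)"
    by (rule sum.reindex_bij_witness[of _ "\<lambda>(j, i). (i + j, j)" "\<lambda>(i, j). (j, i - j)"]) auto
  also have "\<dots> = (\<Sum>j\<le>?n. \<Sum>i\<le>?n - j. ?T j i)"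
    by (rule sum.Sigma[symmetric]) auto
  also have "\<dots> = (f \<otimes>\<^bsub>free_algebra\<^esub> (g \<otimes>\<^bsub>free_algebra\<^esub> h)) w"
    by (simp add: free_algebra_sel sum_distrib_left mult.assoc)
  finally show "(f \<otimes>\<^bsub>free_algebra\<^esub> g \<otimes>\<^bsub>free_algebra\<^esub> h) w = (f \<otimes>\<^bsub>free_algebra\<^esub> (g \<otimes>\<^bsub>free_algebra\<^esub> h)) w" .
qed

lemma free_algebra_ring: "ring (free_algebra :: ('k :: field, 'k freealg) module)"
proof (rule ringI)
  let ?F = "free_algebra :: ('k, 'k freealg) module"
  show "abelian_group ?F"
  proof (rule abelian_groupI)
    fix f assume "f \<in> carrier ?F"
    then have "(\<lambda>w. - f w) \<in> carrier ?F" "(\<lambda>w. - f w) \<oplus>\<^bsub>?F\<^esub> f = \<zero>\<^bsub>?F\<^esub>"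
      by (simp_all add: free_algebra_sel)
    then show "\<exists>g \<in> carrier ?F. g \<oplus>\<^bsub>?F\<^esub> f = \<zero>\<^bsub>?F\<^esub>" by blast
  qed (simp_all add: free_algebra_add_closed, simp_all add: free_algebra_sel ac_simps)
  have one: "\<one>\<^bsub>?F\<^esub> \<in> carrier ?F"
    by (simp add: free_algebra_sel)
  have l_one: "\<one>\<^bsub>?F\<^esub> \<otimes>\<^bsub>?F\<^esub> f = f" for f
  proof
    fix w
    have "(\<one>\<^bsub>?F\<^esub> \<otimes>\<^bsub>?F\<^esub> f) w = (\<Sum>i\<in>{0}. f (drop i w))"
      unfolding free_algebra_sel by (rule sum.mono_neutral_cong_right) auto
    then show "(\<one>\<^bsub>?F\<^esub> \<otimes>\<^bsub>?F\<^esub> f) w = f w" by simp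
  qed
  have r_one: "f \<otimes>\<^bsub>?F\<^esub> \<one>\<^bsub>?F\<^esub> = f" for f
  proof
    fix w
    have "(f \<otimes>\<^bsub>?F\<^esub> \<one>\<^bsub>?F\<^esub>) w = (\<Sum>i\<in>{length w}. f (take i w))"
      unfolding free_algebra_sel by (rule sum.mono_neutral_cong_right) auto
    then show "(f \<otimes>\<^bsub>?F\<^esub> \<one>\<^bsub>?F\<^esub>) w = f w" by simp
  qed
  show "monoid ?F"
    by (rule monoidI) (use one in \<open>simp_all add: free_algebra_mult_closed free_algebra_mult_assoc l_one r_one\<close>)
qed (simp_all add: free_algebra_sel sum.distrib algebra_simps)

text \<open>A description by coefficients that is meant for the \<open>n\<close>-th power of the
  ideal generated by the letters; for \<open>n = 1\<close> and \<open>n = 2\<close> this is proved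
  below.\<close>

definition augmentation_ideal :: "nat \<Rightarrow> 'k :: field freealg set" where
  "augmentation_ideal n = {f \<in> carrier free_algebra. \<forall>w. length w < n \<longrightarrow> f w = 0}"

lemma ideal_augmentation_ideal: "ideal (augmentation_ideal n :: 'k :: field freealg set) free_algebra"
proof (rule idealI[OF free_algebra_ring])
  let ?F = "free_algebra :: ('k, 'k freealg) module" and ?I = "augmentation_ideal n :: 'k freealg set"
  interpret F: ring ?F by (rule free_algebra_ring)
  have inv: "\<ominus>\<^bsub>?F\<^esub> f = (\<lambda>w. - f w)" if "f \<in> carrier ?F" for f
  proof (rule F.minus_equality)
    show "f \<in> carrier ?F" by (rule that)
  qed (use that in \<open>simp_all add: free_algebra_sel\<close>)
  show "subgroup ?I (add_monoid ?F)"
  proof (rule subgroup.intro)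
    fix f assume "f \<in> ?I"
    then show "inv\<^bsub>add_monoid ?F\<^esub> f \<in> ?I"
      using inv[of f] F.a_inv_closed[of f] by (simp add: augmentation_ideal_def a_inv_def)
  qed (auto simp: augmentation_ideal_def free_algebra_add_closed, auto simp: free_algebra_sel)
  fix f g assume f: "f \<in> ?I" and g: "g \<in> carrier ?F"
  show "g \<otimes>\<^bsub>?F\<^esub> f \<in> ?I" "f \<otimes>\<^bsub>?F\<^esub> g \<in> ?I"
    using f g by (auto simp: augmentation_ideal_def free_algebra_mult_closed)
      (auto simp: free_algebra_sel intro!: sum.neutral)
qed

lemma gen_carrier: "gen l \<in> carrier free_algebra"
  by (simp add: gen_def free_algebra_sel)

lemma gen_mult: "gen l \<otimes>\<^bsub>free_algebra\<^esub> f = (\<lambda>w. if w \<noteq> [] \<and> hd w = l then f (tl w) else 0)"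
proof
  fix w :: "letter list"
  show "(gen l \<otimes>\<^bsub>free_algebra\<^esub> f) w = (if w \<noteq> [] \<and> hd w = l then f (tl w) else 0)"
  proof (cases w)
    case Nil
    then show ?thesis by (simp add: free_algebra_sel gen_def)
  next
    case (Cons m v)
    have "(gen l \<otimes>\<^bsub>free_algebra\<^esub> f) w = (\<Sum>i\<in>{1}. gen l (take i w) * f (drop i w))"
      unfolding free_algebra_sel
    proof (rule sum.mono_neutral_right)
      show "\<forall>i\<in>{..length w} - {1}. gen l (take i w) * f (drop i w) = 0"
      proof
        fix i assume "i \<in> {..length w} - {1}"
        then have "length (take i w) \<noteq> 1" by (auto simp: min_def)
        then have "take i w \<noteq> [l]" by force
        then show "gen l (take i w) * f (drop i w) = 0" by (simp add: gen_def)
      qed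
    qed (use Cons in auto)
    then show ?thesis using Cons by (simp add: gen_def)
  qed
qed

text \<open>Left division by a letter: the part of \<open>f\<close> on words beginning with
  \<open>l\<close>, with that letter removed.\<close>

definition strip :: "letter \<Rightarrow> 'k :: field freealg \<Rightarrow> 'k freealg" where
  "strip l f = (\<lambda>w. f (l # w))"

lemma strip_carrier:
  assumes "f \<in> carrier free_algebra"
  shows "strip l f \<in> carrier free_algebra"
proof -
  have "{w. strip l f w \<noteq> 0} \<subseteq> tl ` {w. f w \<noteq> 0}"
    by (auto simp: strip_def image_iff intro!: exI[of _ "l # _"])
  then show ?thesis
    using assms finite_subset by (auto simp: free_algebra_sel)
qed

text \<open>Every nonempty word begins with exactly one letter, and left multiplication by
  \<open>gen l\<close> puts that letter back.\<close>

lemma free_algebra_decomposition: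
  assumes "f [] = 0"
  shows "f = (gen Lx \<otimes>\<^bsub>free_algebra\<^esub> strip Lx f \<oplus>\<^bsub>free_algebra\<^esub> gen Ly \<otimes>\<^bsub>free_algebra\<^esub> strip Ly f)
    \<oplus>\<^bsub>free_algebra\<^esub> gen Lz \<otimes>\<^bsub>free_algebra\<^esub> strip Lz f"
proof
  fix w
  show "f w = ((gen Lx \<otimes>\<^bsub>free_algebra\<^esub> strip Lx f \<oplus>\<^bsub>free_algebra\<^esub> gen Ly \<otimes>\<^bsub>free_algebra\<^esub> strip Ly f)
    \<oplus>\<^bsub>free_algebra\<^esub> gen Lz \<otimes>\<^bsub>free_algebra\<^esub> strip Lz f) w"
  proof (cases w)
    case Nil
    then show ?thesis using assms by (simp add: gen_mult free_algebra_sel(5))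
  next
    case (Cons l v)
    then show ?thesis by (cases l) (simp_all add: gen_mult free_algebra_sel(5) strip_def)
  qed
qed

lemma gen_ideal_eq: "gen_ideal = augmentation_ideal 1"
proof
  interpret F: ring "free_algebra :: ('a, 'a freealg) module" by (rule free_algebra_ring)
  show "gen_ideal \<subseteq> (augmentation_ideal 1 :: 'a freealg set)"
    unfolding gen_ideal_def
    by (rule F.genideal_minimal[OF ideal_augmentation_ideal])
      (auto simp: augmentation_ideal_def gen_carrier, auto simp: gen_def)
  interpret I: ideal "gen_ideal :: 'a freealg set" free_algebra
    unfolding gen_ideal_def by (rule F.genideal_ideal) (auto simp: gen_carrier)
  have gen: "gen l \<in> (gen_ideal :: 'a freealg set)" for l
  proof -
    have "{gen Lx, gen Ly, gen Lz :: 'a freealg} \<subseteq> gen_ideal"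
      unfolding gen_ideal_def by (rule F.genideal_self) (auto simp: gen_carrier)
    then show ?thesis by (cases l) auto
  qed
  show "(augmentation_ideal 1 :: 'a freealg set) \<subseteq> gen_ideal"
  proof
    fix f :: "'a freealg" assume f: "f \<in> augmentation_ideal 1"
    then have "strip l f \<in> carrier free_algebra" for l
      by (intro strip_carrier) (simp add: augmentation_ideal_def)
    then have "gen l \<otimes>\<^bsub>free_algebra\<^esub> strip l f \<in> gen_ideal" for l
      by (intro I.I_r_closed gen)
    moreover have "f [] = 0" using f by (simp add: augmentation_ideal_def)
    ultimately show "f \<in> gen_ideal"
      by (subst free_algebra_decomposition) (simp_all add: I.a_closed)
  qed
qed

lemma mem_gen_ideal: "f \<in> gen_ideal \<longleftrightarrow> f \<in> carrier free_algebra \<and> f [] = 0"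
  by (simp add: gen_ideal_eq augmentation_ideal_def)

text \<open>A word of length less than 2 has an empty part in every factorization into two, where
  elements of the ideal vanish. Conversely, if \<open>f\<close> vanishes on these words, each
  \<open>strip l f\<close> has no constant term, and the decomposition of \<open>f\<close> is a sum
  of products of two elements of the ideal.\<close>

lemma gen_ideal_square: "gen_ideal \<cdot>\<^bsub>free_algebra\<^esub> gen_ideal = augmentation_ideal 2"
proof
  show "gen_ideal \<cdot>\<^bsub>free_algebra\<^esub> gen_ideal \<subseteq> (augmentation_ideal 2 :: 'a freealg set)"
  proof
    fix f :: "'a freealg" assume "f \<in> gen_ideal \<cdot>\<^bsub>free_algebra\<^esub> gen_ideal"
    then show "f \<in> augmentation_ideal 2"
    proof (induction rule: ideal_prod.induct)
      case (prod f g)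
      then have fg: "f \<in> carrier free_algebra" "g \<in> carrier free_algebra" "f [] = 0" "g [] = 0"
        unfolding mem_gen_ideal by blast+
      have "(f \<otimes>\<^bsub>free_algebra\<^esub> g) w = 0" if "length w < 2" for w
        unfolding free_algebra_sel
      proof (intro sum.neutral ballI)
        fix i assume "i \<in> {..length w}"
        then have "take i w = [] \<or> drop i w = []"
          using that by (cases i) auto
        then show "f (take i w) * g (drop i w) = 0"
          using fg by auto
      qed
      then show ?case
        using free_algebra_mult_closed[OF fg(1,2)] unfolding augmentation_ideal_def by blast
    next
      case (sum f g)
      show ?case
        using additive_subgroup.a_closed[OF ideal.axioms(1)[OF ideal_augmentation_ideal] sum.IH] .
    qed
  qed
  show "(augmentation_ideal 2 :: 'a freealg set) \<subseteq> gen_ideal \<cdot>\<^bsub>free_algebra\<^esub> gen_ideal"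
  proof
    fix f :: "'a freealg" assume f: "f \<in> augmentation_ideal 2"
    have "strip l f \<in> gen_ideal" for l
      using f strip_carrier[of f l] unfolding mem_gen_ideal
      by (simp add: augmentation_ideal_def strip_def)
    moreover have "gen l \<in> (gen_ideal :: 'a freealg set)" for l
      unfolding mem_gen_ideal using gen_carrier by (simp add: gen_def)
    ultimately have "gen l \<otimes>\<^bsub>free_algebra\<^esub> strip l f \<in> gen_ideal \<cdot>\<^bsub>free_algebra\<^esub> gen_ideal" for l
      by (intro ideal_prod.prod)
    moreover have "f [] = 0" using f by (simp add: augmentation_ideal_def)
    ultimately show "f \<in> gen_ideal \<cdot>\<^bsub>free_algebra\<^esub> gen_ideal"
      by (subst free_algebra_decomposition) (simp_all add: ideal_prod.sum)
  qed
qed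

section \<open>The algebra \<open>L(3)\<close> in coordinates\<close>

text \<open>Index 0 is the scalar part of \<open>L3\<close> and 1 to 3 are the letters. Indices
  above 3 repeat \<open>[Lz]\<close>, hence the bounds \<open>i < 4\<close> below.\<close>

definition short_word :: "nat \<Rightarrow> letter list" where
  "short_word i = (if i = 0 then [] else if i = 1 then [Lx] else if i = 2 then [Ly] else [Lz])"

lemma short_words: "length w < 2 \<longleftrightarrow> (\<exists>i<4. w = short_word i)"
proof
  assume "length w < 2"
  then consider "w = []" | l where "w = [l]"
    by (cases w) auto
  then show "\<exists>i<4. w = short_word i"
  proof cases
    case 1
    then show ?thesis by (intro exI[of _ 0]) (simp add: short_word_def)
  next
    case 2
    then show ?thesis
      by (intro exI[of _ "case l of Lx \<Rightarrow> 1 | Ly \<Rightarrow> 2 | Lz \<Rightarrow> 3"])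
        (simp add: short_word_def split: letter.split)
  qed
qed (auto simp: short_word_def)

lemma short_word_eq_iff: "i < 4 \<Longrightarrow> j < 4 \<Longrightarrow> short_word i = short_word j \<longleftrightarrow> i = j"
  by (auto simp: short_word_def)

lemma L3_eq: "L3 = quot free_algebra (augmentation_ideal 2)"
  by (simp add: L3_def gen_ideal_square)

abbreviation L3_class :: "'k :: field freealg \<Rightarrow> 'k freealg set" where
  "L3_class f \<equiv> augmentation_ideal 2 +>\<^bsub>free_algebra\<^esub> f"

text \<open>The choice of representative is harmless for \<open>i < 4\<close>: two representatives
  differ by an element of \<open>augmentation_ideal 2\<close>, which vanishes at all short
  words.\<close>

definition L3_coeff :: "'k :: field freealg set \<Rightarrow> nat \<Rightarrow> 'k" where
  "L3_coeff C i = (SOME f. f \<in> C) (short_word i)"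

lemma abelian_subgroup_augmentation_ideal:
  "abelian_subgroup (augmentation_ideal n :: 'k :: field freealg set) free_algebra"
  using ideal_augmentation_ideal
  by (intro abelian_subgroupI3) (auto simp: ideal_def ring.is_abelian_group[OF free_algebra_ring])

lemma L3_coeff_class:
  assumes "f \<in> carrier free_algebra" "i < 4"
  shows "L3_coeff (L3_class f) i = f (short_word i)"
proof -
  have "f \<in> L3_class f"
    by (rule abelian_subgroup.a_rcos_self[OF abelian_subgroup_augmentation_ideal assms(1)])
  then have "(SOME g. g \<in> L3_class f) \<in> L3_class f"
    by (rule someI[of "\<lambda>g. g \<in> L3_class f"])
  then obtain n where n: "n \<in> augmentation_ideal 2" "(SOME g. g \<in> L3_class f) = n \<oplus>\<^bsub>free_algebra\<^esub> f"
    by (auto simp: a_r_coset_def')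
  moreover have "n (short_word i) = 0"
    using n(1) assms(2) short_words by (auto simp: augmentation_ideal_def)
  ultimately show ?thesis
    by (simp add: L3_coeff_def free_algebra_sel(5))
qed

lemma L3_carrier: "carrier L3 = {L3_class f | f. f \<in> carrier free_algebra}"
  by (simp add: L3_eq quot_carrier)

lemma L3_eqI:
  assumes "C \<in> carrier L3" "D \<in> carrier L3" and "\<And>i. i < 4 \<Longrightarrow> L3_coeff C i = L3_coeff D i"
  shows "C = D"
proof -
  obtain f g where f: "f \<in> carrier free_algebra" "C = L3_class f" and g: "g \<in> carrier free_algebra" "D = L3_class g"
    using assms(1,2) by (auto simp: L3_carrier)
  have eq: "f w = g w" if "length w < 2" for w
    using that assms(3) f g unfolding short_words by (auto simp: L3_coeff_class)
  have neg: "(\<lambda>w. - g w) \<in> carrier free_algebra"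
    using g(1) by (simp add: free_algebra_sel)
  have "f \<oplus>\<^bsub>free_algebra\<^esub> (\<lambda>w. - g w) \<in> augmentation_ideal 2"
    using eq free_algebra_add_closed[OF f(1) neg]
    by (simp add: augmentation_ideal_def) (simp add: free_algebra_sel)
  moreover have "f = (f \<oplus>\<^bsub>free_algebra\<^esub> (\<lambda>w. - g w)) \<oplus>\<^bsub>free_algebra\<^esub> g"
    by (simp add: free_algebra_sel)
  ultimately have "f \<in> L3_class g"
    unfolding a_r_coset_def' by blast
  then show ?thesis
    using abelian_subgroup.a_repr_independence'[OF abelian_subgroup_augmentation_ideal _ g(1)] f g by simp
qed

definition L3_elem :: "(nat \<Rightarrow> 'k :: field) \<Rightarrow> 'k freealg set" where
  "L3_elem u = L3_class (\<lambda>w. \<Sum>i<4. if w = short_word i then u i else 0)"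

lemma L3_elem: "L3_elem u \<in> carrier L3" "i < 4 \<Longrightarrow> L3_coeff (L3_elem u) i = u i"
proof -
  let ?f = "\<lambda>w. \<Sum>i<4. if w = short_word i then u i else 0"
  have "{w. ?f w \<noteq> 0} \<subseteq> short_word ` {..<4}"
    by (auto elim!: sum.not_neutral_contains_not_neutral split: if_splits)
  then have f: "?f \<in> carrier free_algebra"
    using finite_subset by (auto simp: free_algebra_sel)
  then show "L3_elem u \<in> carrier L3"
    by (auto simp: L3_elem_def L3_carrier)
  assume i: "i < 4"
  have "?f (short_word i) = (\<Sum>j<4. if j = i then u j else 0)"
    by (rule sum.cong) (use i short_word_eq_iff in auto)
  also have "\<dots> = u i"
    using i by simp
  finally show "L3_coeff (L3_elem u) i = u i"
    unfolding L3_elem_def L3_coeff_class[OF f i] .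
qed

lemma L3_add:
  assumes "C \<in> carrier L3" "D \<in> carrier L3"
  shows "C \<oplus>\<^bsub>L3\<^esub> D \<in> carrier L3"
    "i < 4 \<Longrightarrow> L3_coeff (C \<oplus>\<^bsub>L3\<^esub> D) i = L3_coeff C i + L3_coeff D i"
proof -
  obtain f g where f: "f \<in> carrier free_algebra" "C = L3_class f" and g: "g \<in> carrier free_algebra" "D = L3_class g"
    using assms by (auto simp: L3_carrier)
  have eq: "C \<oplus>\<^bsub>L3\<^esub> D = L3_class (f \<oplus>\<^bsub>free_algebra\<^esub> g)"
    using quot_add[OF abelian_subgroup_augmentation_ideal f(1) g(1)] f g by (simp add: L3_eq)
  note fg = free_algebra_add_closed[OF f(1) g(1)]
  show "C \<oplus>\<^bsub>L3\<^esub> D \<in> carrier L3"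
    unfolding eq L3_carrier using fg by blast
  show "L3_coeff (C \<oplus>\<^bsub>L3\<^esub> D) i = L3_coeff C i + L3_coeff D i" if "i < 4"
    unfolding eq unfolding f(2) g(2) L3_coeff_class[OF fg that] L3_coeff_class[OF f(1) that] L3_coeff_class[OF g(1) that]
    by (simp add: free_algebra_sel)
qed

lemma L3_mult:
  assumes "C \<in> carrier L3" "D \<in> carrier L3"
  shows "C \<otimes>\<^bsub>L3\<^esub> D \<in> carrier L3"
    "i < 4 \<Longrightarrow> L3_coeff (C \<otimes>\<^bsub>L3\<^esub> D) i =
      (if i = 0 then L3_coeff C 0 * L3_coeff D 0 else L3_coeff C 0 * L3_coeff D i + L3_coeff C i * L3_coeff D 0)"
proof -
  obtain f g where f: "f \<in> carrier free_algebra" "C = L3_class f" and g: "g \<in> carrier free_algebra" "D = L3_class g"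
    using assms by (auto simp: L3_carrier)
  have eq: "C \<otimes>\<^bsub>L3\<^esub> D = L3_class (f \<otimes>\<^bsub>free_algebra\<^esub> g)"
    using quot_mult[OF ideal_augmentation_ideal f(1) g(1)] f g by (simp add: L3_eq)
  note fg = free_algebra_mult_closed[OF f(1) g(1)]
  show "C \<otimes>\<^bsub>L3\<^esub> D \<in> carrier L3"
    unfolding eq L3_carrier using fg by blast
  show "L3_coeff (C \<otimes>\<^bsub>L3\<^esub> D) i =
      (if i = 0 then L3_coeff C 0 * L3_coeff D 0 else L3_coeff C 0 * L3_coeff D i + L3_coeff C i * L3_coeff D 0)"
    if i: "i < 4"
  proof -
    have c: "L3_coeff C j = f (short_word j)" "L3_coeff D j = g (short_word j)" if "j < 4" for j
      using L3_coeff_class that f g by auto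
    have "L3_coeff (C \<otimes>\<^bsub>L3\<^esub> D) i = (f \<otimes>\<^bsub>free_algebra\<^esub> g) (short_word i)"
      unfolding eq by (rule L3_coeff_class[OF fg i])
    then show ?thesis
      using i by (auto simp: c free_algebra_sel short_word_def)
  qed
qed

lemma L3_smult:
  assumes "C \<in> carrier L3"
  shows "c \<odot>\<^bsub>L3\<^esub> C \<in> carrier L3"
    "i < 4 \<Longrightarrow> L3_coeff (c \<odot>\<^bsub>L3\<^esub> C) i = c * L3_coeff C i"
proof -
  obtain f where f: "f \<in> carrier free_algebra" "C = L3_class f"
    using assms by (auto simp: L3_carrier)
  have "c \<odot>\<^bsub>quot free_algebra (augmentation_ideal 2)\<^esub> L3_class f = L3_class (c \<odot>\<^bsub>free_algebra\<^esub> f)"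
  proof (rule quot_smult[OF abelian_subgroup_augmentation_ideal f(1)])
    fix g :: "'a freealg" assume "g \<in> augmentation_ideal 2"
    then show "c \<odot>\<^bsub>free_algebra\<^esub> g \<in> augmentation_ideal 2"
      by (simp add: augmentation_ideal_def free_algebra_smult_closed) (simp add: free_algebra_sel)
  qed (simp_all add: free_algebra_smult_closed, simp add: free_algebra_sel distrib_left)
  then have eq: "c \<odot>\<^bsub>L3\<^esub> C = L3_class (c \<odot>\<^bsub>free_algebra\<^esub> f)"
    by (simp add: L3_eq f(2))
  note cf = free_algebra_smult_closed[OF f(1), of c]
  show "c \<odot>\<^bsub>L3\<^esub> C \<in> carrier L3"
    unfolding eq L3_carrier using cf by blast
  show "L3_coeff (c \<odot>\<^bsub>L3\<^esub> C) i = c * L3_coeff C i" if "i < 4"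
    unfolding eq unfolding f(2) L3_coeff_class[OF cf that] L3_coeff_class[OF f(1) that]
    by (simp add: free_algebra_sel)
qed

lemma L3_one:
  "\<one>\<^bsub>L3\<^esub> \<in> carrier (L3 :: ('a :: field, 'a freealg set) module)"
  "i < 4 \<Longrightarrow> L3_coeff (\<one>\<^bsub>L3\<^esub> :: 'a freealg set) i = (if i = 0 then 1 else 0)"
proof -
  have one: "\<one>\<^bsub>free_algebra\<^esub> \<in> carrier (free_algebra :: ('a, 'a freealg) module)"
    by (simp add: free_algebra_sel)
  have eq: "\<one>\<^bsub>L3\<^esub> = L3_class (\<one>\<^bsub>free_algebra\<^esub> :: 'a freealg)"
    by (simp add: L3_eq quot_sel)
  show "\<one>\<^bsub>L3\<^esub> \<in> carrier (L3 :: ('a, 'a freealg set) module)"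
    unfolding eq L3_carrier using one by blast
  show "L3_coeff (\<one>\<^bsub>L3\<^esub> :: 'a freealg set) i = (if i = 0 then 1 else 0)" if "i < 4"
    unfolding eq L3_coeff_class[OF one that] using that by (auto simp: free_algebra_sel short_word_def)
qed

lemma L3_zero:
  "\<zero>\<^bsub>L3\<^esub> \<in> carrier (L3 :: ('a :: field, 'a freealg set) module)"
  "i < 4 \<Longrightarrow> L3_coeff (\<zero>\<^bsub>L3\<^esub> :: 'a freealg set) i = 0"
proof -
  have zero: "\<zero>\<^bsub>free_algebra\<^esub> \<in> carrier (free_algebra :: ('a, 'a freealg) module)"
    by (simp add: free_algebra_sel)
  have eq: "\<zero>\<^bsub>L3\<^esub> = L3_class (\<zero>\<^bsub>free_algebra\<^esub> :: 'a freealg)"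
    unfolding L3_eq quot_sel
    by (rule abelian_subgroup.a_rcos_const[OF abelian_subgroup_augmentation_ideal, symmetric],
        rule additive_subgroup.zero_closed[OF ideal.axioms(1)[OF ideal_augmentation_ideal]])
  show "\<zero>\<^bsub>L3\<^esub> \<in> carrier (L3 :: ('a, 'a freealg set) module)"
    unfolding eq L3_carrier using zero by blast
  show "L3_coeff (\<zero>\<^bsub>L3\<^esub> :: 'a freealg set) i = 0" if "i < 4"
    unfolding eq L3_coeff_class[OF zero that] by (auto simp: free_algebra_sel)
qed

section \<open>Local rings\<close>

text \<open>An ideal containing an element outside \<open>I\<close> contains 1. So every proper
  ideal lies in \<open>I\<close>, and \<open>I\<close> is the only maximal one.\<close>

lemma maximalideal_iff_nonunits:
  assumes R: "cring R" and I: "ideal I R" and "\<one>\<^bsub>R\<^esub> \<notin> I"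
    and units: "\<And>x. x \<in> carrier R \<Longrightarrow> x \<notin> I \<Longrightarrow> \<exists>y\<in>carrier R. y \<otimes>\<^bsub>R\<^esub> x = \<one>\<^bsub>R\<^esub>"
  shows "maximalideal K R \<longleftrightarrow> K = I"
proof
  interpret cring R by (rule R)
  have sub: "K \<subseteq> I" if K: "ideal K R" "K \<noteq> carrier R" for K
  proof
    interpret K: ideal K R by (rule K(1))
    fix x assume x: "x \<in> K"
    show "x \<in> I"
    proof (rule ccontr)
      assume "x \<notin> I"
      then obtain y where "y \<in> carrier R" "y \<otimes>\<^bsub>R\<^esub> x = \<one>\<^bsub>R\<^esub>"
        using units x K.Icarr by blast
      then have "\<one>\<^bsub>R\<^esub> \<in> K"
        using K.I_l_closed[OF x] by metis
      then show False
        using K.one_imp_carrier K(2) by blast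
    qed
  qed
  have I_ne: "I \<noteq> carrier R" using assms(3) by auto
  show "maximalideal K R \<Longrightarrow> K = I"
  proof -
    assume K: "maximalideal K R"
    then have "K \<subseteq> I"
      using sub maximalideal.axioms(1) maximalideal.I_notcarr by blast
    then show "K = I"
      using maximalideal.I_maximal[OF K I] I_ne ideal.Icarr[OF I] by blast
  qed
  show "K = I \<Longrightarrow> maximalideal K R"
  proof -
    assume "K = I"
    moreover have "maximalideal I R"
    proof (rule maximalidealI[OF I])
      fix J assume "ideal J R" "I \<subseteq> J"
      then show "J = I \<or> J = carrier R" using sub by blast
    qed (use I_ne in blast)
    ultimately show ?thesis by simp
  qed
qed

lemma radical_eq_nonunits:
  assumes "cring R" "ideal I R" "\<one>\<^bsub>R\<^esub> \<notin> I"
    and "\<And>x. x \<in> carrier R \<Longrightarrow> x \<notin> I \<Longrightarrow> \<exists>y\<in>carrier R. y \<otimes>\<^bsub>R\<^esub> x = \<one>\<^bsub>R\<^esub>"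
  shows "radical R = I" "local_cring R"
proof -
  have max: "maximalideal K R \<longleftrightarrow> K = I" for K
    using assms by (rule maximalideal_iff_nonunits)
  show "radical R = I"
    using ideal.Icarr[OF assms(2)] by (auto simp: radical_def max)
  show "local_cring R"
    using assms(1) by (simp add: local_cring_def max)
qed

text \<open>Commutativity of \<open>L3\<close> is an assumption here because it comes for free from
  \<open>module L3 M\<close>, which includes that the scalars form a commutative ring.\<close>

lemma L3_radical:
  assumes "cring (L3 :: ('k :: field, 'k freealg set) module)"
  shows "radical (L3 :: ('k, 'k freealg set) module) = {C \<in> carrier L3. L3_coeff C 0 = 0}"
proof (rule radical_eq_nonunits(1)[OF assms])
  let ?L = "L3 :: ('k, 'k freealg set) module" and ?E = "{C \<in> carrier L3. L3_coeff C 0 = (0 :: 'k)}"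
  interpret cring ?L by (rule assms)
  have inv: "L3_coeff (\<ominus>\<^bsub>?L\<^esub> C) 0 = - L3_coeff C 0" if "C \<in> carrier ?L" for C
  proof -
    have "L3_coeff (C \<oplus>\<^bsub>?L\<^esub> \<ominus>\<^bsub>?L\<^esub> C) 0 = 0"
      unfolding r_neg[OF that] by (simp add: L3_zero)
    then show ?thesis
      using that by (simp add: L3_add eq_neg_iff_add_eq_0 add.commute)
  qed
  show "ideal ?E ?L"
  proof (rule idealI[OF ring_axioms])
    show "subgroup ?E (add_monoid ?L)"
      by (rule subgroup.intro) (auto simp: L3_add L3_zero inv a_inv_def[symmetric])
  qed (auto simp: L3_mult)
  show "\<one>\<^bsub>?L\<^esub> \<notin> ?E"
    by (simp add: L3_one)
  fix C :: "'k freealg set" assume C: "C \<in> carrier ?L" "C \<notin> ?E"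
  then have c: "L3_coeff C 0 \<noteq> 0" by simp
  \<comment> \<open>The inverse of \<open>c + e\<close> with \<open>c\<close> a nonzero scalar and
    \<open>e * e = 0\<close> is \<open>1/c - e/c^2\<close>.\<close>
  let ?D = "L3_elem (\<lambda>i. if i = 0 then 1 / L3_coeff C 0 else - L3_coeff C i / (L3_coeff C 0)^2)"
  have "?D \<otimes>\<^bsub>?L\<^esub> C = \<one>\<^bsub>?L\<^esub>"
    by (rule L3_eqI)
      (use c in \<open>auto simp: L3_mult L3_elem L3_one C field_simps power2_eq_square\<close>)
  then show "\<exists>D\<in>carrier ?L. D \<otimes>\<^bsub>?L\<^esub> C = \<one>\<^bsub>?L\<^esub>"
    using L3_elem(1) by blast
qed

section \<open>The algebra of a pair of bilinear forms\<close>

text \<open>Coordinate 0 is the scalar part, the coordinates 1 to 3 span \<open>J/J\<^sup>2\<close>, and the coordinates 4 and 5 span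
  \<open>J\<^sup>2\<close>; only \<open>c 4\<close> and \<open>c 5\<close> matter.\<close>

definition form :: "(nat \<Rightarrow> nat \<Rightarrow> nat \<Rightarrow> 'k :: field) \<Rightarrow> nat \<Rightarrow> 'k vec \<Rightarrow> 'k vec \<Rightarrow> 'k" where
  "form c l u v = (if l < 4 then 0 else \<Sum>i\<in>{1..3}. \<Sum>j\<in>{1..3}. c l i j * u $ i * v $ j)"

definition form_algebra :: "(nat \<Rightarrow> nat \<Rightarrow> nat \<Rightarrow> 'k :: field) \<Rightarrow> ('k, 'k vec) module" where
  "form_algebra c = \<lparr>carrier = carrier_vec 6,
     mult = (\<lambda>u v. vec 6 (\<lambda>l. if l = 0 then u $ 0 * v $ 0
        else u $ 0 * v $ l + u $ l * v $ 0 + form c l u v)),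
     one = unit_vec 6 0, zero = 0\<^sub>v 6, add = (+), smult = (\<cdot>\<^sub>v)\<rparr>"

lemma form_algebra_sel:
  "carrier (form_algebra c) = carrier_vec 6" "one (form_algebra c) = unit_vec 6 0"
  "zero (form_algebra c) = 0\<^sub>v 6" "add (form_algebra c) = (+)" "Module.smult (form_algebra c) = (\<cdot>\<^sub>v)"
  by (simp_all add: form_algebra_def)

lemma form_algebra_mult_closed: "u \<otimes>\<^bsub>form_algebra c\<^esub> v \<in> carrier_vec 6"
  by (simp add: form_algebra_def)

lemma form_algebra_mult_index:
  "l < 6 \<Longrightarrow> (u \<otimes>\<^bsub>form_algebra c\<^esub> v) $ l =
     (if l = 0 then u $ 0 * v $ 0 else u $ 0 * v $ l + u $ l * v $ 0 + form c l u v)"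
  by (simp add: form_algebra_def)

lemma form_cong:
  assumes "\<And>i. i \<in> {1..3} \<Longrightarrow> u $ i = u' $ i" "\<And>i. i \<in> {1..3} \<Longrightarrow> v $ i = v' $ i"
  shows "form c l u v = form c l u' v'"
  using assms by (simp add: form_def)

lemma form_commute:
  assumes "\<And>l i j. c l i j = c l j i"
  shows "form c l u v = form c l v u"
proof -
  have "(\<Sum>i\<in>{1..3}. \<Sum>j\<in>{1..3}. c l i j * u $ i * v $ j) = (\<Sum>j\<in>{1..3}. \<Sum>i\<in>{1..3}. c l i j * u $ i * v $ j)"
    by (rule sum.swap)
  also have "\<dots> = (\<Sum>j\<in>{1..3}. \<Sum>i\<in>{1..3}. c l j i * v $ j * u $ i)"
    using assms by (intro sum.cong refl) (simp add: ac_simps)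
  finally show ?thesis by (simp add: form_def)
qed

text \<open>Linearity is required of the coordinates 1 to 3 alone, since \<open>form\<close> reads
  no others. In this shape it applies to products in the algebra, whose coordinates 1 to 3 are
  linear combinations of those of the factors.\<close>

lemma form_linear_left:
  assumes "\<And>i. i \<in> {1..3} \<Longrightarrow> u $ i = a * v $ i + b * w $ i"
  shows "form c l u x = a * form c l v x + b * form c l w x"
proof -
  have "(\<Sum>i\<in>{1..3}. \<Sum>j\<in>{1..3}. c l i j * u $ i * x $ j) =
      (\<Sum>i\<in>{1..3}. \<Sum>j\<in>{1..3}. a * (c l i j * v $ i * x $ j) + b * (c l i j * w $ i * x $ j))"
    using assms by (intro sum.cong refl) (simp add: algebra_simps)
  then show ?thesis
    by (simp add: form_def sum.distrib sum_distrib_left)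
qed

lemma form_linear_right:
  assumes "\<And>i. i \<in> {1..3} \<Longrightarrow> u $ i = a * v $ i + b * w $ i"
  shows "form c l x u = a * form c l x v + b * form c l x w"
proof -
  have "(\<Sum>i\<in>{1..3}. \<Sum>j\<in>{1..3}. c l i j * x $ i * u $ j) =
      (\<Sum>i\<in>{1..3}. \<Sum>j\<in>{1..3}. a * (c l i j * x $ i * v $ j) + b * (c l i j * x $ i * w $ j))"
    using assms by (intro sum.cong refl) (simp add: algebra_simps)
  then show ?thesis
    by (simp add: form_def sum.distrib sum_distrib_left)
qed

lemma form_zero:
  assumes "\<And>i. i \<in> {1..3} \<Longrightarrow> u $ i = 0"
  shows "form c l u v = 0" "form c l v u = 0"
  using assms by (simp_all add: form_def)

lemma form_low: "l < 4 \<Longrightarrow> form c l u v = 0"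
  by (simp add: form_def)

text \<open>\<open>form\<close> reads coordinates 1 to 3 and writes only to 4 and 5, so inside
  \<open>form\<close> a product \<open>u * v\<close> counts as \<open>u $ 0\<close> times
  \<open>v\<close> plus \<open>v $ 0\<close> times \<open>u\<close>. Both bracketings then expand to
  the same sum, and symmetry of \<open>c\<close> is left to serve commutativity.\<close>

lemma form_algebra_assoc:
  "(u \<otimes>\<^bsub>form_algebra c\<^esub> v) \<otimes>\<^bsub>form_algebra c\<^esub> w = u \<otimes>\<^bsub>form_algebra c\<^esub> (v \<otimes>\<^bsub>form_algebra c\<^esub> w)"
proof (rule eq_vecI)
  note dim = carrier_vecD[OF form_algebra_mult_closed]
  show "dim_vec ((u \<otimes>\<^bsub>form_algebra c\<^esub> v) \<otimes>\<^bsub>form_algebra c\<^esub> w)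
      = dim_vec (u \<otimes>\<^bsub>form_algebra c\<^esub> (v \<otimes>\<^bsub>form_algebra c\<^esub> w))"
    by (simp only: dim)
  fix l assume "l < dim_vec (u \<otimes>\<^bsub>form_algebra c\<^esub> (v \<otimes>\<^bsub>form_algebra c\<^esub> w))"
  then have l: "l < 6" by (simp only: dim)
  have 1: "form c l (u \<otimes>\<^bsub>form_algebra c\<^esub> v) w = u $ 0 * form c l v w + v $ 0 * form c l u w"
    by (rule form_linear_left) (simp add: form_algebra_mult_index form_low)
  have 2: "form c l u (v \<otimes>\<^bsub>form_algebra c\<^esub> w) = v $ 0 * form c l u w + w $ 0 * form c l u v"
    by (rule form_linear_right) (simp add: form_algebra_mult_index form_low)
  show "((u \<otimes>\<^bsub>form_algebra c\<^esub> v) \<otimes>\<^bsub>form_algebra c\<^esub> w) $ l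
      = (u \<otimes>\<^bsub>form_algebra c\<^esub> (v \<otimes>\<^bsub>form_algebra c\<^esub> w)) $ l"
    using l by (simp add: form_algebra_mult_index 1 2) (simp add: algebra_simps)
qed

lemma form_algebra_algebra:
  assumes sym: "\<And>l i j. c l i j = c l j i"
  shows "algebra class_ring (form_algebra (c :: nat \<Rightarrow> nat \<Rightarrow> nat \<Rightarrow> 'k :: field))"
proof -
  let ?A = "form_algebra c"
  note mc = form_algebra_mult_closed and mi = form_algebra_mult_index
  have agrp: "abelian_group ?A"
    by (rule abelian_group_cong[of "module_vec TYPE('k) 6"])
      (use vec_module[of 6, where ?'a = 'k] in
        \<open>simp_all add: Module.module_def form_algebra_sel module_vec_simps\<close>)
  have comm: "u \<otimes>\<^bsub>?A\<^esub> v = v \<otimes>\<^bsub>?A\<^esub> u" for u v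
    using form_commute[of c, OF sym] by (intro eq_vecI) (auto simp: form_algebra_def)
  have form_unit: "form c l (unit_vec 6 0) v = 0" for l v
    by (rule form_zero(1)) simp
  have one: "\<one>\<^bsub>?A\<^esub> \<otimes>\<^bsub>?A\<^esub> v = v" if "v \<in> carrier_vec 6" for v
    by (rule eq_vecI)
      (use that in \<open>auto simp: form_algebra_sel(2) mi form_unit carrier_vecD[OF mc]\<close>)
  have one': "v \<otimes>\<^bsub>?A\<^esub> unit_vec 6 0 = v" if "v \<in> carrier_vec 6" for v
    using one[OF that] comm[of v "unit_vec 6 0"] by (simp only: form_algebra_sel)
  have distr: "(u + v) \<otimes>\<^bsub>?A\<^esub> w = u \<otimes>\<^bsub>?A\<^esub> w + v \<otimes>\<^bsub>?A\<^esub> w"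
    if "u \<in> carrier_vec 6" "v \<in> carrier_vec 6" for u v w
  proof (rule eq_vecI)
    fix l assume "l < dim_vec (u \<otimes>\<^bsub>?A\<^esub> w + v \<otimes>\<^bsub>?A\<^esub> w)"
    then have l: "l < 6" by (simp add: carrier_vecD[OF mc])
    have "form c l (u + v) w = 1 * form c l u w + 1 * form c l v w"
      by (rule form_linear_left) (use that in simp)
    then show "((u + v) \<otimes>\<^bsub>?A\<^esub> w) $ l = (u \<otimes>\<^bsub>?A\<^esub> w + v \<otimes>\<^bsub>?A\<^esub> w) $ l"
      using l that by (simp add: mi carrier_vecD[OF mc] algebra_simps)
  qed (simp add: carrier_vecD[OF mc])
  have smult: "(a \<cdot>\<^sub>v u) \<otimes>\<^bsub>?A\<^esub> w = a \<cdot>\<^sub>v (u \<otimes>\<^bsub>?A\<^esub> w)" if "u \<in> carrier_vec 6" for a u w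
  proof (rule eq_vecI)
    fix l assume "l < dim_vec (a \<cdot>\<^sub>v (u \<otimes>\<^bsub>?A\<^esub> w))"
    then have l: "l < 6" by (simp add: carrier_vecD[OF mc])
    have "form c l (a \<cdot>\<^sub>v u) w = a * form c l u w + 0 * form c l u w"
      by (rule form_linear_left) (use that in simp)
    then show "((a \<cdot>\<^sub>v u) \<otimes>\<^bsub>?A\<^esub> w) $ l = (a \<cdot>\<^sub>v (u \<otimes>\<^bsub>?A\<^esub> w)) $ l"
      using l that by (simp add: mi carrier_vecD[OF mc] algebra_simps)
  qed (simp add: carrier_vecD[OF mc])
  have cring: "cring ?A"
  proof (rule cringI[OF agrp])
    show "comm_monoid ?A"
      by (rule comm_monoidI) (simp_all add: form_algebra_sel mc form_algebra_assoc comm one')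
  qed (simp add: form_algebra_sel distr)
  show ?thesis
    by (rule algebraI[OF class_cring.cring_axioms cring])
      (simp_all add: form_algebra_sel smult add_smult_distrib_vec smult_add_distrib_vec smult_smult_assoc)
qed

text \<open>Spans are built from addition and scalars, and these are the ones of the coordinate
  space of dimension 6.\<close>

lemma form_algebra_fin_dim:
  assumes "algebra class_ring (form_algebra (c :: nat \<Rightarrow> nat \<Rightarrow> nat \<Rightarrow> 'k :: field))"
  shows "vectorspace.fin_dim class_ring (form_algebra c)"
proof -
  let ?V = "module_vec TYPE('k) 6"
  have mA: "Module.module class_ring (form_algebra c)"
    by (rule algebra.module[OF assms])
  have vA: "vectorspace class_ring (form_algebra c)"
    unfolding vectorspace_def using mA class_field by blast
  have span: "LinearCombinations.module.span class_ring (form_algebra c) S =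
      LinearCombinations.module.span class_ring ?V S" for S
    unfolding LinearCombinations.module.span_def[OF mA] LinearCombinations.module.span_def[OF vec_module] LinearCombinations.module.lincomb_def[OF mA]
      LinearCombinations.module.lincomb_def[OF vec_module]
    by (simp add: form_algebra_sel module_vec_simps
        finsum_cong_structure[of "form_algebra c" ?V, unfolded form_algebra_sel module_vec_simps])
  show ?thesis
    using vec_space.fin_dim[of 6, where ?'a = 'k]
    unfolding vectorspace.fin_dim_def[OF vA] vectorspace.fin_dim_def[OF vec_vs]
    by (simp add: span form_algebra_sel module_vec_simps)
qed

lemma form_algebra_radical:
  assumes sym: "\<And>l i j. c l i j = c l j i"
  shows "radical (form_algebra (c :: nat \<Rightarrow> nat \<Rightarrow> nat \<Rightarrow> 'k :: field)) = {v \<in> carrier_vec 6. v $ 0 = 0}"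
    "local_cring (form_algebra c)" "ideal {v \<in> carrier_vec 6. v $ 0 = 0} (form_algebra c)"
proof -
  let ?A = "form_algebra c" and ?J = "{v \<in> carrier_vec 6. v $ 0 = (0 :: 'k)}"
  interpret algebra class_ring ?A
    by (rule form_algebra_algebra[OF sym])
  have cr: "cring ?A" by (rule M_cring)
  then have rg: "ring ?A" by (simp add: cring_def)
  have inv: "(\<ominus>\<^bsub>?A\<^esub> v) = - v" if "v \<in> carrier_vec 6" for v
    by (rule abelian_group.minus_equality[OF ring.is_abelian_group[OF rg]])
      (use that in \<open>auto simp: form_algebra_sel\<close>)
  show I: "ideal ?J ?A"
  proof (rule idealI[OF rg])
    show "subgroup ?J (add_monoid ?A)"
    proof (rule subgroup.intro)
      fix v assume "v \<in> ?J"
      then show "inv\<^bsub>add_monoid ?A\<^esub> v \<in> ?J"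
        using inv[of v] by (auto simp: a_inv_def)
    qed (auto simp: form_algebra_sel)
  qed (auto simp: form_algebra_sel form_algebra_mult_closed form_algebra_mult_index)
  have one: "\<one>\<^bsub>?A\<^esub> \<notin> ?J"
    by (simp add: form_algebra_sel)
  have unit: "\<exists>u\<in>carrier ?A. u \<otimes>\<^bsub>?A\<^esub> v = \<one>\<^bsub>?A\<^esub>" if v: "v \<in> carrier ?A" "v \<notin> ?J" for v
  proof
    have v0: "v $ 0 \<noteq> 0" using v by (simp add: form_algebra_sel)
    \<comment> \<open>\<open>w\<close> has the coordinates 1 to 3 of the inverse. As
      \<open>form\<close> reads only these, coordinates 4 and 5 of \<open>u\<close> can be solved
      for with \<open>form c l w v\<close> in place of \<open>form c l u v\<close>.\<close>
    define w where "w = vec 6 (\<lambda>i. - v $ i / (v $ 0)^2)"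
    define u where "u = vec 6 (\<lambda>l. if l = 0 then 1 / v $ 0
      else - (v $ l / v $ 0 + form c l w v) / v $ 0)"
    have "form c l u v = form c l w v" for l
      by (rule form_cong) (auto simp: u_def w_def form_low power2_eq_square)
    then show "u \<otimes>\<^bsub>?A\<^esub> v = \<one>\<^bsub>?A\<^esub>"
      using v0 by (intro eq_vecI)
        (auto simp: form_algebra_sel form_algebra_mult_index carrier_vecD[OF form_algebra_mult_closed] u_def)
    show "u \<in> carrier ?A"
      by (simp add: u_def form_algebra_sel)
  qed
  show "radical ?A = ?J" "local_cring ?A"
    using radical_eq_nonunits[OF cr I one unit] by blast+
qed

text \<open>One inclusion only: for degenerate structure constants the square of the radical is
  smaller. Equality is shown in \<open>J2_eq\<close>, where the structure constants come from a
  module.\<close>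

lemma form_algebra_radical_square:
  assumes "v \<in> J \<cdot>\<^bsub>form_algebra c\<^esub> J" and J: "J = {v \<in> carrier_vec 6. v $ 0 = 0}"
  shows "v \<in> carrier_vec 6" "i < 4 \<Longrightarrow> v $ i = 0"
proof -
  have "v \<in> carrier_vec 6 \<and> (\<forall>i<4. v $ i = 0)"
    using assms(1)
  proof (induction rule: ideal_prod.induct)
    case (prod u v)
    then show ?case
      by (auto simp: J form_algebra_mult_closed form_algebra_mult_index form_low)
  next
    case (sum u v)
    then show ?case by (auto simp: form_algebra_sel)
  qed
  then show "v \<in> carrier_vec 6" "i < 4 \<Longrightarrow> v $ i = 0" by auto
qed

section \<open>Bases adapted to a subspace\<close>

text \<open>Independent subsets of \<open>U\<close> have at most \<open>dim\<close> elements, so one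
  of greatest size exists; it spans \<open>U\<close>, since a vector outside its span could be
  added.\<close>

lemma (in vectorspace) subspace_fin_dim:
  assumes fd: fin_dim and U: "LinearCombinations.submodule K U V"
  shows "vectorspace.fin_dim K (V\<lparr>carrier := U\<rparr>)"
proof -
  interpret U: LinearCombinations.submodule K U V by (rule U)
  have vsU: "vectorspace K (V\<lparr>carrier := U\<rparr>)"
    unfolding vectorspace_def using submodule_is_module[OF U] field_axioms by blast
  let ?P = "\<lambda>n. \<exists>A. A \<subseteq> U \<and> lin_indpt A \<and> card A = n"
  have fin: "finite A" "card A \<le> dim" if "A \<subseteq> U" "lin_indpt A" for A
    using li_le_dim[OF fd, of A] that U.subset by auto
  have "lin_indpt {}"
    by (rule finite_lin_indpt2) auto
  then have P0: "?P 0"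
    by (intro exI[of _ "{}"]) auto
  have bound: "k \<le> dim" if "?P k" for k
    using that fin(2) by auto
  define n where "n = (GREATEST n. ?P n)"
  have n: "?P n" "\<And>k. ?P k \<Longrightarrow> k \<le> n"
    unfolding n_def using GreatestI_nat[of ?P, OF P0 bound] Greatest_le_nat[of ?P, OF _ bound] by blast+
  from n(1) obtain A where A: "A \<subseteq> U" "lin_indpt A" "card A = n" by blast
  have "U \<subseteq> span A"
  proof (rule ccontr)
    assume "\<not> U \<subseteq> span A"
    then obtain x where x: "x \<in> U" "x \<notin> span A" by blast
    have AV: "A \<subseteq> carrier V" using A(1) U.subset by blast
    have "x \<notin> A" using x(2) in_own_span[OF AV] by blast
    then have "lin_indpt (A \<union> {x})"
      using lin_dep_iff_in_span[OF AV A(2), of x] x U.subset by blast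
    moreover have "card (A \<union> {x}) = Suc n"
      using A(3) fin(1)[OF A(1,2)] \<open>x \<notin> A\<close> by simp
    moreover have "A \<union> {x} \<subseteq> U" using A(1) x(1) by blast
    ultimately have "?P (Suc n)" by (intro exI[of _ "A \<union> {x}"] conjI)
    then have "Suc n \<le> n" by (rule n(2))
    then show False by simp
  qed
  moreover have "span A \<subseteq> U"
    by (rule span_is_subset[OF A(1) U])
  ultimately have "LinearCombinations.module.span K (V\<lparr>carrier := U\<rparr>) A = U"
    using span_li_not_depend(1)[OF A(1) U] by blast
  then show ?thesis
    unfolding vectorspace.fin_dim_def[OF vsU] using A fin(1)[OF A(1,2)] by auto
qed

text \<open>Indexed by numbers rather than by a set of vectors, so that the coefficients can serve
  as vector coordinates and matrix entries.\<close>

definition lin_comb :: "('k, 'v, 'e) module_scheme \<Rightarrow> nat \<Rightarrow> (nat \<Rightarrow> 'v) \<Rightarrow> (nat \<Rightarrow> 'k) \<Rightarrow> 'v" where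
  "lin_comb V n b u = finsum V (\<lambda>i. u i \<odot>\<^bsub>V\<^esub> b i) {..<n}"

context
  fixes V :: "('k :: field, 'v, 'e) module_scheme"
  assumes V: "Module.module class_ring V"
begin

interpretation V: Module.module class_ring V
  by (rule V)

lemma smult_carrier: "x \<in> carrier V \<Longrightarrow> a \<odot>\<^bsub>V\<^esub> x \<in> carrier V"
  by (rule V.smult_closed) simp_all

lemma lin_comb_0: "lin_comb V 0 b u = \<zero>\<^bsub>V\<^esub>"
  by (simp add: lin_comb_def)

lemma lin_comb_Suc:
  assumes "\<And>i. i \<le> n \<Longrightarrow> b i \<in> carrier V"
  shows "lin_comb V (Suc n) b u = u n \<odot>\<^bsub>V\<^esub> b n \<oplus>\<^bsub>V\<^esub> lin_comb V n b u"
  unfolding lin_comb_def lessThan_Suc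
  by (rule V.finsum_insert) (use assms in \<open>auto intro: smult_carrier\<close>)

lemma lin_comb_closed:
  assumes "\<And>i. i < n \<Longrightarrow> b i \<in> carrier V"
  shows "lin_comb V n b u \<in> carrier V"
  unfolding lin_comb_def using assms by (auto intro!: V.finsum_closed smult_carrier)

lemma lin_comb_cong:
  assumes "\<And>i. i < n \<Longrightarrow> b i \<in> carrier V" "\<And>i. i < n \<Longrightarrow> u i = w i"
  shows "lin_comb V n b u = lin_comb V n b w"
  unfolding lin_comb_def using assms by (intro V.finsum_cong') (auto intro!: smult_carrier)

lemma lin_comb_add:
  assumes "\<And>i. i < n \<Longrightarrow> b i \<in> carrier V"
  shows "lin_comb V n b (\<lambda>i. u i + w i) = lin_comb V n b u \<oplus>\<^bsub>V\<^esub> lin_comb V n b w"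
proof -
  have "lin_comb V n b (\<lambda>i. u i + w i) = finsum V (\<lambda>i. u i \<odot>\<^bsub>V\<^esub> b i \<oplus>\<^bsub>V\<^esub> w i \<odot>\<^bsub>V\<^esub> b i) {..<n}"
    unfolding lin_comb_def using assms V.smult_l_distr
    by (intro V.finsum_cong') (auto intro!: smult_carrier)
  also have "\<dots> = lin_comb V n b u \<oplus>\<^bsub>V\<^esub> lin_comb V n b w"
    unfolding lin_comb_def using assms by (intro V.finsum_addf) (auto intro!: smult_carrier)
  finally show ?thesis .
qed

lemma lin_comb_smult:
  assumes "\<And>i. i < n \<Longrightarrow> b i \<in> carrier V"
  shows "lin_comb V n b (\<lambda>i. a * u i) = a \<odot>\<^bsub>V\<^esub> lin_comb V n b u"
proof -
  have "a \<odot>\<^bsub>V\<^esub> lin_comb V n b u = finsum V (\<lambda>i. a \<odot>\<^bsub>V\<^esub> (u i \<odot>\<^bsub>V\<^esub> b i)) {..<n}"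
    unfolding lin_comb_def using assms by (intro V.finsum_smult_ldistr) (auto intro!: smult_carrier)
  also have "\<dots> = lin_comb V n b (\<lambda>i. a * u i)"
    unfolding lin_comb_def using assms V.smult_assoc1
    by (intro V.finsum_cong') (auto intro!: smult_carrier)
  finally show ?thesis by simp
qed

lemma lin_comb_zero:
  assumes "\<And>i. i < n \<Longrightarrow> b i \<in> carrier V" "\<And>i. i < n \<Longrightarrow> u i = 0"
  shows "lin_comb V n b u = \<zero>\<^bsub>V\<^esub>"
proof -
  have "0 \<odot>\<^bsub>V\<^esub> x = \<zero>\<^bsub>V\<^esub>" if "x \<in> carrier V" for x
    using V.smult_l_null[OF that] by simp
  then show ?thesis
    unfolding lin_comb_def using assms by (intro V.add.finprod_one_eqI[folded finsum_def]) auto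
qed

end

lemma indexed_basis:
  fixes V :: "('k :: field, 'v, 'e) module_scheme"
  assumes V: "vectorspace class_ring V" and fd: "vectorspace.fin_dim class_ring V"
    and n: "vectorspace.dim class_ring V = n"
  obtains b where "\<And>i. i < n \<Longrightarrow> b i \<in> carrier V"
    "\<And>x. x \<in> carrier V \<Longrightarrow> \<exists>u. x = lin_comb V n b u"
    "\<And>u i. lin_comb V n b u = \<zero>\<^bsub>V\<^esub> \<Longrightarrow> i < n \<Longrightarrow> u i = 0"
proof -
  interpret V: vectorspace class_ring V by (rule V)
  obtain B where B: "finite B" "V.basis B"
    using V.finite_basis_exists[OF fd] by blast
  have BV: "B \<subseteq> carrier V" and li: "V.lin_indpt B" and gen: "V.gen_set B"
    using B(2) by (simp_all add: V.basis_def)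
  have "card B = n" using V.dim_basis[OF B] n by simp
  then obtain h where h: "bij_betw h {..<n} B"
    using ex_bij_betw_nat_finite[OF B(1)] by (auto simp: atLeast0LessThan)
  then have hB: "h ` {..<n} = B" and inj: "inj_on h {..<n}"
    by (auto simp: bij_betw_def)
  have lc: "V.lincomb a B = lin_comb V n h (\<lambda>i. a (h i))" for a
  proof -
    have "V.lincomb a B = finsum V (\<lambda>v. a v \<odot>\<^bsub>V\<^esub> v) (h ` {..<n})"
      by (simp add: V.lincomb_def hB)
    also have "\<dots> = finsum V (\<lambda>i. a (h i) \<odot>\<^bsub>V\<^esub> h i) {..<n}"
      using BV hB inj smult_carrier[OF V.module_axioms]
      by (intro V.finsum_reindex) auto
    finally show ?thesis by (simp add: lin_comb_def)
  qed
  show ?thesis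
  proof
    show hc: "h i \<in> carrier V" if "i < n" for i
      using that hB BV by blast
    show "\<exists>u. x = lin_comb V n h u" if "x \<in> carrier V" for x
    proof -
      have "x \<in> V.span B" using that gen by simp
      then obtain a where "V.lincomb a B = x"
        using V.finite_in_span[OF B(1) BV] by blast
      then show ?thesis using lc by blast
    qed
    fix u i assume u: "lin_comb V n h u = \<zero>\<^bsub>V\<^esub>" and i: "i < n"
    define a where "a v = u (the_inv_into {..<n} h v)" for v
    have a: "a (h j) = u j" if "j < n" for j
      using the_inv_into_f_f[OF inj] that by (simp add: a_def)
    have "V.lincomb a B = lin_comb V n h u"
      unfolding lc using a hc by (intro lin_comb_cong[OF V.module_axioms]) auto
    then have "V.lincomb a B = \<zero>\<^bsub>V\<^esub>" using u by simp
    then have "a v = 0" if "v \<in> B" for v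
      using li that B(1) unfolding V.lin_dep_def by fastforce
    then show "u i = 0"
      using a[OF i] i hB by auto
  qed
qed

lemma lin_comb_quot:
  fixes V :: "('k :: field, 'v, 'e) module_scheme"
  assumes V: "Module.module class_ring V" and U: "LinearCombinations.submodule class_ring U V"
    and t: "\<And>i. i < n \<Longrightarrow> t i \<in> carrier V"
  shows "lin_comb (quot V U) n (\<lambda>i. U +>\<^bsub>V\<^esub> t i) u = U +>\<^bsub>V\<^esub> lin_comb V n t u"
  using t
proof (induction n)
  interpret V: Module.module class_ring V by (rule V)
  interpret U: LinearCombinations.submodule class_ring U V by (rule U)
  interpret Q: Module.module class_ring "quot V U" by (rule module_quot[OF V U])
  have sub: "abelian_subgroup U V" by (rule V.submodule_abelian_subgroup[OF U])
  {
    case 0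
    show ?case
      using abelian_subgroup.a_rcos_const[OF sub U.zero_closed]
      by (simp add: lin_comb_0[OF V.module_axioms] lin_comb_0[OF Q.module_axioms] quot_sel)
  next
    case (Suc n)
    have tn: "t n \<in> carrier V" and t: "\<And>i. i \<le> n \<Longrightarrow> t i \<in> carrier V" using Suc.prems by auto
    have sm: "u n \<odot>\<^bsub>quot V U\<^esub> (U +>\<^bsub>V\<^esub> t n) = U +>\<^bsub>V\<^esub> (u n \<odot>\<^bsub>V\<^esub> t n)"
      by (rule quot_smult[OF sub tn])
        (use V.smult_r_distr U.smult_closed in \<open>auto intro: smult_carrier[OF V]\<close>)
    have "lin_comb (quot V U) (Suc n) (\<lambda>i. U +>\<^bsub>V\<^esub> t i) u
       = (U +>\<^bsub>V\<^esub> (u n \<odot>\<^bsub>V\<^esub> t n)) \<oplus>\<^bsub>quot V U\<^esub> (U +>\<^bsub>V\<^esub> lin_comb V n t u)"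
      using t Suc by (subst lin_comb_Suc[OF Q.module_axioms]) (auto simp: quot_carrier sm)
    also have "\<dots> = U +>\<^bsub>V\<^esub> (u n \<odot>\<^bsub>V\<^esub> t n \<oplus>\<^bsub>V\<^esub> lin_comb V n t u)"
      using t by (intro quot_add[OF sub] smult_carrier[OF V] tn lin_comb_closed[OF V]) auto
    finally show ?case
      using t by (simp add: lin_comb_Suc[OF V])
  }
qed

text \<open>The \<open>t i\<close> are representatives of a basis of the quotient, the
  \<open>s i\<close> a basis of \<open>U\<close>. They are kept as two families because only the
  first is changed later.\<close>

lemma adapted_basis:
  fixes V :: "('k :: field, 'v, 'e) module_scheme"
  assumes V: "vectorspace class_ring V" and fd: "vectorspace.fin_dim class_ring V"
    and U: "LinearCombinations.submodule class_ring U V"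
    and n: "vectorspace.dim class_ring (quot V U) = n"
    and m: "vectorspace.dim class_ring (V\<lparr>carrier := U\<rparr>) = m"
  obtains t s where "\<And>i. i < n \<Longrightarrow> t i \<in> carrier V" "\<And>i. i < m \<Longrightarrow> s i \<in> U"
    "\<And>x. x \<in> carrier V \<Longrightarrow> \<exists>u w. x = lin_comb V n t u \<oplus>\<^bsub>V\<^esub> lin_comb V m s w"
    "\<And>x. x \<in> U \<Longrightarrow> \<exists>w. x = lin_comb V m s w"
    "\<And>u w. lin_comb V n t u \<oplus>\<^bsub>V\<^esub> lin_comb V m s w = \<zero>\<^bsub>V\<^esub> \<Longrightarrow> (\<forall>i<n. u i = 0) \<and> (\<forall>i<m. w i = 0)"
proof -
  interpret V: vectorspace class_ring V by (rule V)
  interpret U: LinearCombinations.submodule class_ring U V by (rule U)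
  have Vm: "Module.module class_ring V" ..
  have sub: "abelian_subgroup U V" by (rule V.submodule_abelian_subgroup[OF U])
  have Qm: "Module.module class_ring (quot V U)" by (rule module_quot[OF Vm U])
  then have Q: "vectorspace class_ring (quot V U)"
    unfolding vectorspace_def using class_field by blast
  have sm: "c \<odot>\<^bsub>quot V U\<^esub> (U +>\<^bsub>V\<^esub> x) = U +>\<^bsub>V\<^esub> (c \<odot>\<^bsub>V\<^esub> x)" if "x \<in> carrier V" for c x
    by (rule quot_smult[OF sub that])
      (use V.smult_r_distr U.smult_closed in \<open>auto intro: smult_carrier[OF Vm]\<close>)
  \<comment> \<open>The quotient is finite-dimensional as the image of \<open>V\<close> under the
    projection.\<close>
  have "linear_map class_ring V (quot V U) (\<lambda>x. U +>\<^bsub>V\<^esub> x)"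
    unfolding linear_map_def mod_hom_def mod_hom_axioms_def LinearCombinations.module_hom_def
    using V Q Vm Qm by (auto simp: quot_carrier quot_add[OF sub] sm)
  then have Qfd: "vectorspace.fin_dim class_ring (quot V U)"
    by (rule linear_map.image_fin_dim[OF _ fd]) (auto simp: quot_carrier)
  obtain q where q: "\<And>i. i < n \<Longrightarrow> q i \<in> carrier (quot V U)"
    "\<And>x. x \<in> carrier (quot V U) \<Longrightarrow> \<exists>u. x = lin_comb (quot V U) n q u"
    "\<And>u i. lin_comb (quot V U) n q u = \<zero>\<^bsub>quot V U\<^esub> \<Longrightarrow> i < n \<Longrightarrow> u i = 0"
    using indexed_basis[OF Q Qfd n] by metis
  have "\<forall>i. \<exists>x. i < n \<longrightarrow> x \<in> carrier V \<and> q i = U +>\<^bsub>V\<^esub> x"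
    using q(1) by (auto simp: quot_carrier)
  then obtain t where t: "\<And>i. i < n \<Longrightarrow> t i \<in> carrier V" "\<And>i. i < n \<Longrightarrow> q i = U +>\<^bsub>V\<^esub> t i"
    by metis
  have qt: "lin_comb (quot V U) n q u = U +>\<^bsub>V\<^esub> lin_comb V n t u" for u
  proof -
    have "lin_comb (quot V U) n q u = lin_comb (quot V U) n (\<lambda>i. U +>\<^bsub>V\<^esub> t i) u"
      unfolding lin_comb_def
      by (intro abelian_monoid.finsum_cong')
        (use t q(1) Qm smult_carrier[OF Qm] in \<open>auto simp: Module.module_def abelian_group_def\<close>)
    also have "\<dots> = U +>\<^bsub>V\<^esub> lin_comb V n t u"
      by (rule lin_comb_quot[OF Vm U t(1)])
    finally show ?thesis .
  qed
  have Us: "vectorspace class_ring (V\<lparr>carrier := U\<rparr>)"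
    unfolding vectorspace_def using V.submodule_is_module[OF U] class_field by blast
  obtain s where s: "\<And>i. i < m \<Longrightarrow> s i \<in> carrier (V\<lparr>carrier := U\<rparr>)"
    "\<And>x. x \<in> carrier (V\<lparr>carrier := U\<rparr>) \<Longrightarrow> \<exists>w. x = lin_comb (V\<lparr>carrier := U\<rparr>) m s w"
    "\<And>w i. lin_comb (V\<lparr>carrier := U\<rparr>) m s w = \<zero>\<^bsub>V\<lparr>carrier := U\<rparr>\<^esub> \<Longrightarrow> i < m \<Longrightarrow> w i = 0"
    using indexed_basis[OF Us V.subspace_fin_dim[OF fd U] m] by metis
  have sU: "s i \<in> U" if "i < m" for i using s(1)[OF that] by simp
  then have sV: "s i \<in> carrier V" if "i < m" for i using that U.subset by blast
  have ss: "lin_comb (V\<lparr>carrier := U\<rparr>) m s w = lin_comb V m s w" for w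
    using sU
  proof (induction m)
    case (Suc m)
    then have "s i \<in> U" if "i \<le> m" for i using that by auto
    then show ?case
      using Suc.IH Suc.prems U.subset
      by (subst lin_comb_Suc[OF Vm], blast, subst lin_comb_Suc[OF V.submodule_is_module[OF U]]) auto
  qed (simp add: lin_comb_0[OF Vm] lin_comb_0[OF V.submodule_is_module[OF U]])
  have lcU: "lin_comb V m s w \<in> U" for w
    using lin_comb_closed[OF V.submodule_is_module[OF U], of m s w] sU by (simp add: ss)
  show ?thesis
  proof
    show "t i \<in> carrier V" if "i < n" for i by (rule t(1)[OF that])
    show "s i \<in> U" if "i < m" for i by (rule sU[OF that])
    show gU: "\<exists>w. x = lin_comb V m s w" if "x \<in> U" for x
      using s(2)[of x] that by (simp add: ss)
    show "\<exists>u w. x = lin_comb V n t u \<oplus>\<^bsub>V\<^esub> lin_comb V m s w" if x: "x \<in> carrier V" for x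
    proof -
      have "U +>\<^bsub>V\<^esub> x \<in> carrier (quot V U)" using x by (auto simp: quot_carrier)
      then obtain u where "U +>\<^bsub>V\<^esub> x = U +>\<^bsub>V\<^esub> lin_comb V n t u"
        using q(2) qt by metis
      then have "x \<in> U +>\<^bsub>V\<^esub> lin_comb V n t u"
        using abelian_subgroup.a_rcos_self[OF sub x] by simp
      then obtain y where y: "y \<in> U" "x = y \<oplus>\<^bsub>V\<^esub> lin_comb V n t u"
        by (auto simp: a_r_coset_def')
      then have "x = lin_comb V n t u \<oplus>\<^bsub>V\<^esub> y"
        using V.M.a_comm[of y "lin_comb V n t u"] U.subset lin_comb_closed[OF Vm, of n t u] t(1)
        by (simp add: subsetD)
      then show ?thesis using gU[OF y(1)] by blast
    qed
    fix u w assume 0: "lin_comb V n t u \<oplus>\<^bsub>V\<^esub> lin_comb V m s w = \<zero>\<^bsub>V\<^esub>"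
    have c: "lin_comb V n t u \<in> carrier V" "lin_comb V m s w \<in> carrier V"
      using lin_comb_closed[OF Vm, of n t u] lin_comb_closed[OF Vm, of m s w] t(1) sV by auto
    \<comment> \<open>The combination of the \<open>t i\<close> lies in \<open>U\<close>, so it is
      zero in the quotient, where their classes are independent.\<close>
    have "lin_comb V n t u = \<ominus>\<^bsub>V\<^esub> lin_comb V m s w"
      using V.M.minus_equality[OF 0 c(2) c(1)] by simp
    also have "\<dots> \<in> U"
      using lcU abelian_subgroup.axioms(1)[OF sub] additive_subgroup.a_inv_closed[of U V] V.M.abelian_group_axioms
      by (metis additive_subgroup.a_inv_closed)
    finally have "lin_comb (quot V U) n q u = \<zero>\<^bsub>quot V U\<^esub>"
      unfolding qt using abelian_subgroup.a_rcos_const[OF sub] by (simp add: quot_sel)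
    then have u: "u i = 0" if "i < n" for i using q(3) that by blast
    then have "lin_comb V n t u = \<zero>\<^bsub>V\<^esub>"
      using t(1) by (intro lin_comb_zero[OF Vm]) auto
    then have "lin_comb V m s w = \<zero>\<^bsub>V\<^esub>" using 0 c by simp
    then have "w i = 0" if "i < m" for i
      using s(3) that by (simp add: ss)
    with u show "(\<forall>i<n. u i = 0) \<and> (\<forall>i<m. w i = 0)" by blast
  qed
qed

section \<open>Modules over \<open>L(3)\<close>\<close>

definition L3_scalar :: "'k :: field \<Rightarrow> 'k freealg set" where
  "L3_scalar c = c \<odot>\<^bsub>L3\<^esub> \<one>\<^bsub>L3\<^esub>"

lemma L3_scalar:
  "L3_scalar c \<in> carrier L3" "i < 4 \<Longrightarrow> L3_coeff (L3_scalar c) i = (if i = 0 then c else 0)"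
  by (simp_all add: L3_scalar_def L3_smult L3_one)

lemma L3_scalar_hom: "L3_scalar \<in> Ring.ring_hom class_ring (L3 :: ('k :: field, 'k freealg set) module)"
proof (rule Ring.ring_hom_memI)
  fix a b :: 'k
  show "L3_scalar (a \<otimes>\<^bsub>class_ring\<^esub> b) = L3_scalar a \<otimes>\<^bsub>L3\<^esub> L3_scalar b"
    by (rule L3_eqI) (simp_all add: L3_scalar L3_mult)
  show "L3_scalar (a \<oplus>\<^bsub>class_ring\<^esub> b) = L3_scalar a \<oplus>\<^bsub>L3\<^esub> L3_scalar b"
    by (rule L3_eqI) (simp_all add: L3_scalar L3_add)
  show "L3_scalar \<one>\<^bsub>class_ring\<^esub> = (\<one>\<^bsub>L3\<^esub> :: 'k freealg set)"
    by (rule L3_eqI) (simp_all add: L3_scalar L3_one)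
qed (simp add: L3_scalar)

abbreviation k_space :: "('k :: field freealg set, 'm, 'c) module_scheme \<Rightarrow> ('k, 'm) module" where
  "k_space M \<equiv> restrict_scalars L3_scalar M"

lemma kdim_L3: "kdim L3 M = vectorspace.dim class_ring (k_space M)"
  by (simp add: kdim_def L3_scalar_def[abs_def])

text \<open>The letters are numbered from 0 here, while their coordinates in \<open>L3\<close> are 1
  to 3; hence the shift by \<open>Suc\<close>.\<close>

definition L3_gen :: "nat \<Rightarrow> 'k :: field freealg set" where
  "L3_gen i = L3_elem (\<lambda>j. if j = Suc i then 1 else 0)"

lemma L3_gen:
  "L3_gen i \<in> carrier L3" "j < 4 \<Longrightarrow> L3_coeff (L3_gen i) j = (if j = Suc i then 1 else 0)"
  by (simp_all add: L3_gen_def L3_elem)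

text \<open>\<open>dim_vector\<close> restricts scalars after passing to the quotient, whereas the
  adapted basis lives in the quotient of the restricted space. Both have the same cosets and the
  same action on representatives.\<close>

lemma quot_k_space: "quot (k_space M) N = k_space (quot M N)"
proof -
  have "set_add (k_space M) = set_add M" "rcoset_mult (k_space M) = rcoset_mult M"
    by (intro ext; simp add: set_add_def' rcoset_mult_def a_r_coset_def' restrict_scalars_def)+
  then show ?thesis
    by (simp add: quot_def FactRing_def A_RCOSETS_def' a_r_coset_def')
      (simp add: restrict_scalars_def)
qed

lemma carrier_update_k_space: "(k_space M)\<lparr>carrier := N\<rparr> = k_space (M\<lparr>carrier := N\<rparr>)"
  by (simp add: restrict_scalars_def)

section \<open>The action of the radical \<open>E\<close> on a module\<close>

locale L3_module =
  fixes M :: "('k :: field freealg set, 'm) module"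
  assumes L3_module: "Module.module L3 M"
begin

sublocale Module.module L3 M
  by (rule L3_module)

lemma k_module: "Module.module class_ring (k_space M)"
  by (rule module_restrict_scalars[OF L3_module class_cring.cring_axioms L3_scalar_hom])

lemma k_vectorspace: "vectorspace class_ring (k_space M)"
  unfolding vectorspace_def using k_module class_field by blast

abbreviation E :: "'k freealg set set" where "E \<equiv> radical L3"

abbreviation EM :: "'m set" where "EM \<equiv> ideal_smult L3 E M"

lemma E_def: "E = {C \<in> carrier L3. L3_coeff C 0 = 0}"
  by (rule L3_radical[OF R.is_cring])

lemma EM_gen_subset: "{a \<odot>\<^bsub>M\<^esub> x | a x. a \<in> E \<and> x \<in> carrier M} \<subseteq> carrier M"
  by (auto simp: E_def)

lemma EM_submodule: "LinearCombinations.submodule L3 EM M"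
  unfolding ideal_smult_def by (rule span_is_submodule[OF EM_gen_subset])

lemma EM_smult: "a \<in> E \<Longrightarrow> x \<in> carrier M \<Longrightarrow> a \<odot>\<^bsub>M\<^esub> x \<in> EM"
  unfolding ideal_smult_def using in_own_span[OF EM_gen_subset] by blast

lemma EM_subset: "EM \<subseteq> carrier M"
  using LinearCombinations.submodule.subset[OF EM_submodule] .

lemma E_mult: "C \<in> E \<Longrightarrow> D \<in> E \<Longrightarrow> C \<otimes>\<^bsub>L3\<^esub> D = \<zero>\<^bsub>L3\<^esub>"
  by (rule L3_eqI) (auto simp: E_def L3_mult L3_zero)

lemma smult_commute:
  assumes "C \<in> carrier L3" "D \<in> carrier L3" "y \<in> carrier M"
  shows "C \<odot>\<^bsub>M\<^esub> (D \<odot>\<^bsub>M\<^esub> y) = D \<odot>\<^bsub>M\<^esub> (C \<odot>\<^bsub>M\<^esub> y)"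
  using smult_assoc1[of C D y] smult_assoc1[of D C y] R.m_comm[of C D] assms by simp

text \<open>The elements killed by \<open>C\<close> form a submodule, as \<open>L3\<close> is
  commutative, and it contains the generators of \<open>EM\<close> because
  \<open>E^2 = 0\<close>.\<close>

lemma E_EM:
  assumes "C \<in> E" "y \<in> EM"
  shows "C \<odot>\<^bsub>M\<^esub> y = \<zero>\<^bsub>M\<^esub>"
proof -
  let ?N = "{y \<in> carrier M. C \<odot>\<^bsub>M\<^esub> y = \<zero>\<^bsub>M\<^esub>}"
  have C: "C \<in> carrier L3" using assms(1) by (simp add: E_def)
  have "LinearCombinations.submodule L3 ?N M"
  proof (rule LinearCombinations.submodule.intro[OF L3_module])
    fix D :: "'k freealg set" and y assume D: "D \<in> carrier L3" and y: "y \<in> ?N"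
    have "C \<odot>\<^bsub>M\<^esub> (D \<odot>\<^bsub>M\<^esub> y) = D \<odot>\<^bsub>M\<^esub> (C \<odot>\<^bsub>M\<^esub> y)"
      using C D y smult_commute by blast
    then show "D \<odot>\<^bsub>M\<^esub> y \<in> ?N" using D y by simp
  qed (auto simp: C smult_r_distr)
  moreover have "{a \<odot>\<^bsub>M\<^esub> x | a x. a \<in> E \<and> x \<in> carrier M} \<subseteq> ?N"
  proof
    fix z assume "z \<in> {a \<odot>\<^bsub>M\<^esub> x | a x. a \<in> E \<and> x \<in> carrier M}"
    then obtain a x where z: "z = a \<odot>\<^bsub>M\<^esub> x" "a \<in> E" "x \<in> carrier M" by blast
    have a: "a \<in> carrier L3" using z(2) by (simp add: E_def)
    have "C \<odot>\<^bsub>M\<^esub> z = (C \<otimes>\<^bsub>L3\<^esub> a) \<odot>\<^bsub>M\<^esub> x"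
      using C a z(3) by (simp add: z(1) smult_assoc1)
    then show "z \<in> ?N"
      using E_mult[OF assms(1) z(2)] a z(1,3) by simp
  qed
  ultimately have "EM \<subseteq> ?N"
    unfolding ideal_smult_def by (intro span_is_subset)
  with assms(2) show ?thesis by blast
qed

lemma smult_decomposition:
  assumes "C \<in> carrier L3" "x \<in> carrier M"
  shows "C \<odot>\<^bsub>M\<^esub> x = L3_scalar (L3_coeff C 0) \<odot>\<^bsub>M\<^esub> x \<oplus>\<^bsub>M\<^esub>
    lin_comb (k_space M) 3 (\<lambda>i. L3_gen i \<odot>\<^bsub>M\<^esub> x) (\<lambda>i. L3_coeff C (Suc i))"
proof -
  let ?s = "\<lambda>i. L3_scalar (L3_coeff C (Suc i)) \<otimes>\<^bsub>L3\<^esub> L3_gen i"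
  have C: "C = L3_scalar (L3_coeff C 0) \<oplus>\<^bsub>L3\<^esub> (?s 2 \<oplus>\<^bsub>L3\<^esub> (?s 1 \<oplus>\<^bsub>L3\<^esub> ?s 0))"
  proof (rule L3_eqI[OF assms(1)])
    fix i :: nat assume "i < 4"
    then have "i = 0 \<or> i = 1 \<or> i = 2 \<or> i = 3" by auto
    then show "L3_coeff C i = L3_coeff (L3_scalar (L3_coeff C 0) \<oplus>\<^bsub>L3\<^esub> (?s 2 \<oplus>\<^bsub>L3\<^esub> (?s 1 \<oplus>\<^bsub>L3\<^esub> ?s 0))) i"
      by (elim disjE) (simp_all add: L3_add L3_mult L3_scalar L3_gen numeral_3_eq_3 numeral_2_eq_2)
  qed (simp add: L3_add L3_mult L3_scalar L3_gen)
  have "C \<odot>\<^bsub>M\<^esub> x = (L3_scalar (L3_coeff C 0) \<oplus>\<^bsub>L3\<^esub> (?s 2 \<oplus>\<^bsub>L3\<^esub> (?s 1 \<oplus>\<^bsub>L3\<^esub> ?s 0))) \<odot>\<^bsub>M\<^esub> x"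
    using C by simp
  also have "\<dots> = L3_scalar (L3_coeff C 0) \<odot>\<^bsub>M\<^esub> x \<oplus>\<^bsub>M\<^esub>
      (?s 2 \<odot>\<^bsub>M\<^esub> x \<oplus>\<^bsub>M\<^esub> (?s 1 \<odot>\<^bsub>M\<^esub> x \<oplus>\<^bsub>M\<^esub> ?s 0 \<odot>\<^bsub>M\<^esub> x))"
    using assms(2) by (simp add: smult_l_distr L3_scalar L3_gen L3_add L3_mult)
  also have "?s 2 \<odot>\<^bsub>M\<^esub> x \<oplus>\<^bsub>M\<^esub> (?s 1 \<odot>\<^bsub>M\<^esub> x \<oplus>\<^bsub>M\<^esub> ?s 0 \<odot>\<^bsub>M\<^esub> x)
      = lin_comb (k_space M) 3 (\<lambda>i. L3_gen i \<odot>\<^bsub>M\<^esub> x) (\<lambda>i. L3_coeff C (Suc i))"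
    using assms(2) by (simp add: numeral_3_eq_3 numeral_2_eq_2 lin_comb_Suc[OF k_module] lin_comb_0[OF k_module]
        smult_assoc1 L3_scalar L3_gen)
  finally show ?thesis .
qed

lemma smult_EM:
  assumes "C \<in> carrier L3" "y \<in> EM"
  shows "C \<odot>\<^bsub>M\<^esub> y = L3_scalar (L3_coeff C 0) \<odot>\<^bsub>M\<^esub> y"
proof -
  let ?D = "L3_elem (\<lambda>i. if i = 0 then 0 else L3_coeff C i)"
  have D: "?D \<in> E" by (simp add: E_def L3_elem)
  then have Dc: "?D \<in> carrier L3" by (simp add: E_def)
  have y: "y \<in> carrier M" using assms(2) EM_subset by blast
  have "C = L3_scalar (L3_coeff C 0) \<oplus>\<^bsub>L3\<^esub> ?D"
    by (rule L3_eqI) (use assms(1) in \<open>auto simp: L3_add L3_scalar L3_elem\<close>)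
  then have "C \<odot>\<^bsub>M\<^esub> y = (L3_scalar (L3_coeff C 0) \<oplus>\<^bsub>L3\<^esub> ?D) \<odot>\<^bsub>M\<^esub> y"
    by simp
  also have "\<dots> = L3_scalar (L3_coeff C 0) \<odot>\<^bsub>M\<^esub> y \<oplus>\<^bsub>M\<^esub> ?D \<odot>\<^bsub>M\<^esub> y"
    using y Dc by (simp add: smult_l_distr L3_scalar)
  also have "\<dots> = L3_scalar (L3_coeff C 0) \<odot>\<^bsub>M\<^esub> y"
    using E_EM[OF D assms(2)] y by (simp add: L3_scalar)
  finally show ?thesis .
qed

lemma k_submodule:
  assumes "LinearCombinations.submodule L3 N M"
  shows "LinearCombinations.submodule class_ring N (k_space M)"
proof -
  interpret N: LinearCombinations.submodule L3 N M by (rule assms)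
  show ?thesis
    by (rule LinearCombinations.submodule.intro[OF k_module]) (use N.subset in \<open>auto simp: L3_scalar\<close>)
qed

text \<open>If \<open>S\<close> generates over \<open>L3\<close>, then \<open>S\<close> together
  with its multiples by the three letters spans over the field: this span is stable under the
  letters, since a product of two letters is zero in \<open>L3\<close>.\<close>

lemma k_fin_dim:
  assumes "finitely_generated L3 M"
  shows "vectorspace.fin_dim class_ring (k_space M)"
proof -
  let ?V = "k_space M"
  interpret V: vectorspace class_ring ?V by (rule k_vectorspace)
  obtain S where S: "finite S" "S \<subseteq> carrier M" "span S = carrier M"
    using assms by (auto simp: finitely_generated_def)
  let ?T = "S \<union> (\<Union>i<3. (\<lambda>s. L3_gen i \<odot>\<^bsub>M\<^esub> s) ` S)"
  have T: "finite ?T" "?T \<subseteq> carrier ?V"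
    using S by (auto simp: L3_gen)
  let ?W = "V.span ?T"
  have W: "LinearCombinations.submodule class_ring ?W ?V"
    by (rule V.span_is_submodule[OF T(2)])
  interpret W: LinearCombinations.submodule class_ring ?W ?V by (rule W)
  have WT: "?T \<subseteq> ?W" by (rule V.in_own_span[OF T(2)])
  have WM: "?W \<subseteq> carrier M" using W.subset by simp
  have gens: "L3_gen i \<odot>\<^bsub>M\<^esub> w \<in> ?W" if i: "i < 3" and w: "w \<in> ?W" for i w
  proof -
    let ?N = "{w \<in> carrier M. L3_gen i \<odot>\<^bsub>M\<^esub> w \<in> ?W}"
    have "LinearCombinations.submodule class_ring ?N ?V"
    proof (rule LinearCombinations.submodule.intro[OF k_module])
      fix v w assume "v \<in> ?N" "w \<in> ?N"
      then show "v \<oplus>\<^bsub>?V\<^esub> w \<in> ?N"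
        using W.m_closed by (simp add: smult_r_distr L3_gen)
    next
      show "\<zero>\<^bsub>?V\<^esub> \<in> ?N" using W.zero_closed by (simp add: L3_gen)
    next
      fix c :: 'k and v assume c: "c \<in> carrier class_ring" and v: "v \<in> ?N"
      then have "L3_gen i \<odot>\<^bsub>M\<^esub> (L3_scalar c \<odot>\<^bsub>M\<^esub> v) = L3_scalar c \<odot>\<^bsub>M\<^esub> (L3_gen i \<odot>\<^bsub>M\<^esub> v)"
        by (intro smult_commute) (simp_all add: L3_gen L3_scalar)
      then show "c \<odot>\<^bsub>?V\<^esub> v \<in> ?N"
        using v W.smult_closed[OF c] by (simp add: L3_scalar)
    qed auto
    moreover have "?T \<subseteq> ?N"
    proof
      fix x assume "x \<in> ?T"
      then consider "x \<in> S" | j s where "j < 3" "s \<in> S" "x = L3_gen j \<odot>\<^bsub>M\<^esub> s" by blast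
      then show "x \<in> ?N"
      proof cases
        case 1
        then have "L3_gen i \<odot>\<^bsub>M\<^esub> x \<in> ?T" using i by blast
        then show ?thesis using 1 S(2) WT by blast
      next
        case 2
        then have s: "s \<in> carrier M" using S(2) by blast
        have "L3_gen i \<odot>\<^bsub>M\<^esub> x = (L3_gen i \<otimes>\<^bsub>L3\<^esub> L3_gen j) \<odot>\<^bsub>M\<^esub> s"
          using s by (simp add: 2 smult_assoc1 L3_gen)
        also have "\<dots> = \<zero>\<^bsub>M\<^esub>"
          using E_mult[of "L3_gen i" "L3_gen j"] s by (simp add: E_def L3_gen)
        finally show ?thesis
          using s W.zero_closed by (simp add: 2 L3_gen)
      qed
    qed
    ultimately have "?W \<subseteq> ?N" by (intro V.span_is_subset)
    then show ?thesis using w by blast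
  qed
  have "LinearCombinations.submodule L3 ?W M"
  proof (rule LinearCombinations.submodule.intro[OF L3_module WM])
    show "v \<oplus>\<^bsub>M\<^esub> w \<in> ?W" if "v \<in> ?W" "w \<in> ?W" for v w
      using W.m_closed[OF that] by simp
    show "\<zero>\<^bsub>M\<^esub> \<in> ?W" using W.zero_closed by simp
    fix C :: "'k freealg set" and w assume C: "C \<in> carrier L3" and w: "w \<in> ?W"
    have sc: "L3_scalar c \<odot>\<^bsub>M\<^esub> v \<in> ?W" if "v \<in> ?W" for c v
      using W.smult_closed[of c v] that by simp
    have "lin_comb ?V 3 (\<lambda>i. L3_gen i \<odot>\<^bsub>M\<^esub> w) u \<in> ?W" for u
      using lin_comb_closed[OF V.submodule_is_module[OF W], of 3 "\<lambda>i. L3_gen i \<odot>\<^bsub>M\<^esub> w" u] gens[OF _ w]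
        w WM W.subset sc W.m_closed W.zero_closed
      by (simp add: numeral_3_eq_3 lin_comb_Suc[OF k_module] lin_comb_0[OF k_module] L3_gen subsetD)
    then show "C \<odot>\<^bsub>M\<^esub> w \<in> ?W"
      using smult_decomposition[OF C, of w] w WM sc W.m_closed by (simp add: subsetD)
  qed
  then have "span S \<subseteq> ?W"
    using WT by (intro span_is_subset) auto
  then have "?W = carrier ?V"
    using S(3) WM by simp
  then show ?thesis
    unfolding V.fin_dim_def using T by blast
qed

end

section \<open>Coordinates and structure constants of a module\<close>

lemma lin_comb_lin_comb:
  fixes V :: "('k :: field, 'v, 'e) module_scheme"
  assumes V: "Module.module class_ring V" and t: "\<And>i. i < m \<Longrightarrow> t i \<in> carrier V"
  shows "lin_comb V n (\<lambda>j. lin_comb V m t (q j)) u = lin_comb V m t (\<lambda>i. \<Sum>j<n. u j * q j i)"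
proof (induction n)
  case 0
  show ?case
    using t by (simp add: lin_comb_0[OF V] lin_comb_zero[OF V])
next
  case (Suc n)
  have "lin_comb V (Suc n) (\<lambda>j. lin_comb V m t (q j)) u
      = u n \<odot>\<^bsub>V\<^esub> lin_comb V m t (q n) \<oplus>\<^bsub>V\<^esub> lin_comb V m t (\<lambda>i. \<Sum>j<n. u j * q j i)"
    using t by (subst lin_comb_Suc[OF V]) (simp_all add: lin_comb_closed[OF V] Suc)
  also have "u n \<odot>\<^bsub>V\<^esub> lin_comb V m t (q n) = lin_comb V m t (\<lambda>i. u n * q n i)"
    using t by (rule lin_comb_smult[OF V, symmetric])
  also have "lin_comb V m t (\<lambda>i. u n * q n i) \<oplus>\<^bsub>V\<^esub> lin_comb V m t (\<lambda>i. \<Sum>j<n. u j * q j i)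
      = lin_comb V m t (\<lambda>i. u n * q n i + (\<Sum>j<n. u j * q j i))"
    using t by (rule lin_comb_add[OF V, symmetric])
  finally show ?case
    by (simp add: add.commute)
qed

lemma lin_comb_cong_basis:
  fixes V :: "('k :: field, 'v, 'e) module_scheme"
  assumes V: "Module.module class_ring V" and "\<And>i. i < n \<Longrightarrow> b i \<in> carrier V" "\<And>i. i < n \<Longrightarrow> a i = b i"
  shows "lin_comb V n a u = lin_comb V n b u"
proof -
  interpret Module.module class_ring V by (rule V)
  show ?thesis
    unfolding lin_comb_def using assms by (intro finsum_cong') (auto intro!: smult_carrier[OF V])
qed

context L3_module
begin

lemma smult_lin_comb:
  assumes C: "C \<in> carrier L3" and t: "\<And>i. i < n \<Longrightarrow> t i \<in> carrier M"
  shows "C \<odot>\<^bsub>M\<^esub> lin_comb (k_space M) n t u = lin_comb (k_space M) n (\<lambda>i. C \<odot>\<^bsub>M\<^esub> t i) u"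
  using t
proof (induction n)
  case 0
  then show ?case using C by (simp add: lin_comb_0[OF k_module])
next
  case (Suc n)
  have t: "t i \<in> carrier M" if "i \<le> n" for i using Suc.prems that by simp
  have cl: "lin_comb (k_space M) n t u \<in> carrier M"
    using lin_comb_closed[OF k_module, of n t u] t by simp
  have "C \<odot>\<^bsub>M\<^esub> lin_comb (k_space M) (Suc n) t u
      = C \<odot>\<^bsub>M\<^esub> (L3_scalar (u n) \<odot>\<^bsub>M\<^esub> t n) \<oplus>\<^bsub>M\<^esub> C \<odot>\<^bsub>M\<^esub> lin_comb (k_space M) n t u"
    using t C cl by (subst lin_comb_Suc[OF k_module]) (simp_all add: smult_r_distr L3_scalar)
  also have "C \<odot>\<^bsub>M\<^esub> (L3_scalar (u n) \<odot>\<^bsub>M\<^esub> t n) = L3_scalar (u n) \<odot>\<^bsub>M\<^esub> (C \<odot>\<^bsub>M\<^esub> t n)"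
    using t C by (intro smult_commute) (simp_all add: L3_scalar)
  also have "C \<odot>\<^bsub>M\<^esub> lin_comb (k_space M) n t u = lin_comb (k_space M) n (\<lambda>i. C \<odot>\<^bsub>M\<^esub> t i) u"
    using Suc by simp
  finally show ?case
    using t C by (subst lin_comb_Suc[OF k_module]) simp_all
qed

text \<open>The \<open>t i\<close> lift a basis of \<open>M/EM\<close>, and the \<open>s l\<close> form a basis of \<open>EM\<close>.\<close>

definition coordinates :: "(nat \<Rightarrow> 'm) \<Rightarrow> (nat \<Rightarrow> 'm) \<Rightarrow> (nat \<Rightarrow> nat \<Rightarrow> nat \<Rightarrow> 'k) \<Rightarrow> bool" where
  "coordinates t s b \<longleftrightarrow> (\<forall>i<3. t i \<in> carrier M) \<and> (\<forall>l<2. s l \<in> EM) \<and>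
     (\<forall>x\<in>carrier M. \<exists>u w. x = lin_comb (k_space M) 3 t u \<oplus>\<^bsub>M\<^esub> lin_comb (k_space M) 2 s w) \<and>
     (\<forall>x\<in>EM. \<exists>w. x = lin_comb (k_space M) 2 s w) \<and>
     (\<forall>u w. lin_comb (k_space M) 3 t u \<oplus>\<^bsub>M\<^esub> lin_comb (k_space M) 2 s w = \<zero>\<^bsub>M\<^esub> \<longrightarrow>
        (\<forall>i<3. u i = 0) \<and> (\<forall>l<2. w l = 0)) \<and>
     (\<forall>i<3. \<forall>j<3. L3_gen i \<odot>\<^bsub>M\<^esub> t j = lin_comb (k_space M) 2 s (\<lambda>l. b l i j))"

lemma coordinates_exist:
  assumes "finitely_generated L3 M" "dim_vector L3 M = (3, 2)"
  obtains t s b where "coordinates t s b"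
proof -
  have "kdim L3 (quot M EM) = 3" "kdim L3 (M\<lparr>carrier := EM\<rparr>) = 2"
    using assms(2) by (simp_all add: dim_vector_def Let_def)
  then have dims: "vectorspace.dim class_ring (quot (k_space M) EM) = 3"
    "vectorspace.dim class_ring ((k_space M)\<lparr>carrier := EM\<rparr>) = 2"
    by (simp_all only: kdim_L3 quot_k_space carrier_update_k_space)
  show ?thesis
  proof (rule adapted_basis[OF k_vectorspace k_fin_dim[OF assms(1)] k_submodule[OF EM_submodule] dims])
    fix t s
    assume ts: "\<And>i. i < 3 \<Longrightarrow> t i \<in> carrier (k_space M)" "\<And>i. i < 2 \<Longrightarrow> s i \<in> EM"
      "\<And>x. x \<in> carrier (k_space M) \<Longrightarrow> \<exists>u w. x = lin_comb (k_space M) 3 t u \<oplus>\<^bsub>k_space M\<^esub> lin_comb (k_space M) 2 s w"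
      "\<And>x. x \<in> EM \<Longrightarrow> \<exists>w. x = lin_comb (k_space M) 2 s w"
      "\<And>u w. lin_comb (k_space M) 3 t u \<oplus>\<^bsub>k_space M\<^esub> lin_comb (k_space M) 2 s w = \<zero>\<^bsub>k_space M\<^esub> \<Longrightarrow>
        (\<forall>i<3. u i = 0) \<and> (\<forall>i<2. w i = 0)"
    have "\<forall>i j. \<exists>w. i < 3 \<and> j < 3 \<longrightarrow> L3_gen i \<odot>\<^bsub>M\<^esub> t j = lin_comb (k_space M) 2 s w"
    proof (intro allI)
      fix i j
      show "\<exists>w. i < 3 \<and> j < 3 \<longrightarrow> L3_gen i \<odot>\<^bsub>M\<^esub> t j = lin_comb (k_space M) 2 s w"
      proof (cases "i < 3 \<and> j < 3")
        case True
        have "L3_gen i \<odot>\<^bsub>M\<^esub> t j \<in> EM"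
          using True ts(1)[of j] by (intro EM_smult) (simp_all add: E_def L3_gen)
        then show ?thesis using ts(4) by blast
      qed blast
    qed
    then obtain w where w: "\<And>i j. i < 3 \<Longrightarrow> j < 3 \<Longrightarrow> L3_gen i \<odot>\<^bsub>M\<^esub> t j = lin_comb (k_space M) 2 s (w i j)"
      by metis
    have "coordinates t s (\<lambda>l i j. w i j l)"
      unfolding coordinates_def using ts w by simp
    then show thesis by (rule that)
  qed
qed

context
  fixes t s b
  assumes coord: "coordinates t s b"
begin

abbreviation "T \<equiv> lin_comb (k_space M) 3 t"
abbreviation "S \<equiv> lin_comb (k_space M) 2 s"

lemma coordinates_carrier:
  "i < 3 \<Longrightarrow> t i \<in> carrier M" "l < 2 \<Longrightarrow> s l \<in> EM" "l < 2 \<Longrightarrow> s l \<in> carrier M"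
  "T u \<in> carrier M" "S w \<in> EM" "S w \<in> carrier M"
proof -
  show t: "t i \<in> carrier M" if "i < 3" for i using coord that by (simp add: coordinates_def)
  show s: "s l \<in> EM" if "l < 2" for l using coord that by (simp add: coordinates_def)
  then show sM: "s l \<in> carrier M" if "l < 2" for l using that EM_subset by blast
  show "T u \<in> carrier M" using lin_comb_closed[OF k_module, of 3 t u] t by simp
  show "S w \<in> carrier M" using lin_comb_closed[OF k_module, of 2 s w] sM by simp
  interpret U: LinearCombinations.submodule L3 EM M by (rule EM_submodule)
  show "S w \<in> EM"
    using s sM U.m_closed U.smult_closed U.zero_closed
    by (simp add: numeral_2_eq_2 lin_comb_Suc[OF k_module] lin_comb_0[OF k_module] L3_scalar)
qed

lemma TS_add: "T (\<lambda>i. u i + u' i) = T u \<oplus>\<^bsub>M\<^esub> T u'" "S (\<lambda>l. w l + w' l) = S w \<oplus>\<^bsub>M\<^esub> S w'"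
  using lin_comb_add[OF k_module, of 3 t u u'] lin_comb_add[OF k_module, of 2 s w w'] coordinates_carrier(1,3)
  by simp_all

lemma TS_smult: "T (\<lambda>i. a * u i) = L3_scalar a \<odot>\<^bsub>M\<^esub> T u" "S (\<lambda>l. a * w l) = L3_scalar a \<odot>\<^bsub>M\<^esub> S w"
  using lin_comb_smult[OF k_module, of 3 t a u] lin_comb_smult[OF k_module, of 2 s a w] coordinates_carrier(1,3)
  by simp_all

lemma TS_zero: "(\<And>i. i < 3 \<Longrightarrow> u i = 0) \<Longrightarrow> T u = \<zero>\<^bsub>M\<^esub>" "(\<And>l. l < 2 \<Longrightarrow> w l = 0) \<Longrightarrow> S w = \<zero>\<^bsub>M\<^esub>"
  using lin_comb_zero[OF k_module, of 3 t u] lin_comb_zero[OF k_module, of 2 s w] coordinates_carrier(1,3)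
  by simp_all

lemma TS_exhaust:
  assumes "x \<in> carrier M"
  obtains u w where "x = T u \<oplus>\<^bsub>M\<^esub> S w"
proof -
  have "\<forall>x\<in>carrier M. \<exists>u w. x = T u \<oplus>\<^bsub>M\<^esub> S w"
    using coord by (simp add: coordinates_def)
  with assms that show ?thesis by blast
qed

lemma TS_independent:
  assumes "T u \<oplus>\<^bsub>M\<^esub> S w = \<zero>\<^bsub>M\<^esub>"
  shows "i < 3 \<Longrightarrow> u i = 0" "l < 2 \<Longrightarrow> w l = 0"
  using coord assms by (simp_all add: coordinates_def)

lemma TS_inject:
  assumes "T u \<oplus>\<^bsub>M\<^esub> S w = T u' \<oplus>\<^bsub>M\<^esub> S w'"
  shows "i < 3 \<Longrightarrow> u i = u' i" "l < 2 \<Longrightarrow> w l = w' l"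
proof -
  have "T (\<lambda>i. u i + -1 * u' i) \<oplus>\<^bsub>M\<^esub> S (\<lambda>l. w l + -1 * w' l)
      = (T u \<oplus>\<^bsub>M\<^esub> L3_scalar (-1) \<odot>\<^bsub>M\<^esub> T u') \<oplus>\<^bsub>M\<^esub> (S w \<oplus>\<^bsub>M\<^esub> L3_scalar (-1) \<odot>\<^bsub>M\<^esub> S w')"
    by (simp only: TS_add TS_smult)
  also have "\<dots> = (T u \<oplus>\<^bsub>M\<^esub> S w) \<oplus>\<^bsub>M\<^esub> L3_scalar (-1) \<odot>\<^bsub>M\<^esub> (T u' \<oplus>\<^bsub>M\<^esub> S w')"
    using coordinates_carrier(4,6) by (simp add: smult_r_distr L3_scalar M.a_ac)
  also have "\<dots> = L3_scalar 1 \<odot>\<^bsub>M\<^esub> (T u' \<oplus>\<^bsub>M\<^esub> S w') \<oplus>\<^bsub>M\<^esub> L3_scalar (-1) \<odot>\<^bsub>M\<^esub> (T u' \<oplus>\<^bsub>M\<^esub> S w')"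
  proof -
    have "L3_scalar (1 :: 'k) = \<one>\<^bsub>L3\<^esub>"
      by (rule L3_eqI) (simp_all add: L3_scalar L3_one)
    then show ?thesis using coordinates_carrier(4,6) assms by simp
  qed
  also have "\<dots> = (L3_scalar 1 \<oplus>\<^bsub>L3\<^esub> L3_scalar (-1)) \<odot>\<^bsub>M\<^esub> (T u' \<oplus>\<^bsub>M\<^esub> S w')"
    using coordinates_carrier(4,6) by (intro smult_l_distr[symmetric]) (simp_all add: L3_scalar)
  also have "L3_scalar 1 \<oplus>\<^bsub>L3\<^esub> L3_scalar (-1) = \<zero>\<^bsub>L3\<^esub>"
    by (rule L3_eqI) (simp_all add: L3_scalar L3_zero L3_add)
  also have "\<zero>\<^bsub>L3\<^esub> \<odot>\<^bsub>M\<^esub> (T u' \<oplus>\<^bsub>M\<^esub> S w') = \<zero>\<^bsub>M\<^esub>"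
    using coordinates_carrier(4,6) by simp
  finally have 0: "T (\<lambda>i. u i + -1 * u' i) \<oplus>\<^bsub>M\<^esub> S (\<lambda>l. w l + -1 * w' l) = \<zero>\<^bsub>M\<^esub>" .
  show "u i = u' i" if "i < 3" using TS_independent(1)[OF 0 that] by simp
  show "w l = w' l" if "l < 2" using TS_independent(2)[OF 0 that] by simp
qed

lemma gen_T: "i < 3 \<Longrightarrow> L3_gen i \<odot>\<^bsub>M\<^esub> T u = S (\<lambda>l. \<Sum>j<3. u j * b l i j)"
proof -
  assume i: "i < 3"
  have "L3_gen i \<odot>\<^bsub>M\<^esub> T u = lin_comb (k_space M) 3 (\<lambda>j. L3_gen i \<odot>\<^bsub>M\<^esub> t j) u"
    by (rule smult_lin_comb[OF L3_gen(1) coordinates_carrier(1)])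
  also have "\<dots> = lin_comb (k_space M) 3 (\<lambda>j. S (\<lambda>l. b l i j)) u"
    using coord i coordinates_carrier(6)
    by (intro lin_comb_cong_basis[OF k_module]) (auto simp: coordinates_def)
  also have "\<dots> = S (\<lambda>l. \<Sum>j<3. u j * b l i j)"
    using coordinates_carrier(3) by (intro lin_comb_lin_comb[OF k_module]) simp
  finally show ?thesis .
qed

lemma smult_T:
  assumes "C \<in> carrier L3"
  shows "C \<odot>\<^bsub>M\<^esub> T u = T (\<lambda>i. L3_coeff C 0 * u i) \<oplus>\<^bsub>M\<^esub>
    S (\<lambda>l. \<Sum>i<3. \<Sum>j<3. b l i j * L3_coeff C (Suc i) * u j)"
proof -
  have "lin_comb (k_space M) 3 (\<lambda>i. L3_gen i \<odot>\<^bsub>M\<^esub> T u) (\<lambda>i. L3_coeff C (Suc i))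
     = lin_comb (k_space M) 3 (\<lambda>i. S (\<lambda>l. \<Sum>j<3. u j * b l i j)) (\<lambda>i. L3_coeff C (Suc i))"
    using coordinates_carrier(6) by (intro lin_comb_cong_basis[OF k_module]) (auto simp: gen_T)
  also have "\<dots> = S (\<lambda>l. \<Sum>i<3. L3_coeff C (Suc i) * (\<Sum>j<3. u j * b l i j))"
    using coordinates_carrier(3) by (intro lin_comb_lin_comb[OF k_module]) simp
  also have "\<dots> = S (\<lambda>l. \<Sum>i<3. \<Sum>j<3. b l i j * L3_coeff C (Suc i) * u j)"
    by (simp add: sum_distrib_left ac_simps)
  finally show ?thesis
    using smult_decomposition[OF assms coordinates_carrier(4)] by (simp add: TS_smult)
qed

lemma smult_S: "C \<in> carrier L3 \<Longrightarrow> C \<odot>\<^bsub>M\<^esub> S w = S (\<lambda>l. L3_coeff C 0 * w l)"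
  using smult_EM[OF _ coordinates_carrier(5)] by (simp add: TS_smult)

lemma smult_TS:
  assumes C: "C \<in> carrier L3"
  shows "C \<odot>\<^bsub>M\<^esub> (T u \<oplus>\<^bsub>M\<^esub> S w) = T (\<lambda>i. L3_coeff C 0 * u i) \<oplus>\<^bsub>M\<^esub>
    S (\<lambda>l. (\<Sum>i<3. \<Sum>j<3. b l i j * L3_coeff C (Suc i) * u j) + L3_coeff C 0 * w l)"
  using coordinates_carrier(4,6) C
  by (simp add: smult_r_distr smult_T smult_S TS_add M.a_assoc)

text \<open>A common left kernel vector \<open>a\<close> is an element of \<open>E\<close>, with the
  letters as basis, that kills all \<open>t j\<close>. It kills \<open>EM\<close> anyway, hence all
  of \<open>M\<close>.\<close>

lemma faithful_nondegenerate:
  assumes "faithful L3 M" and 0: "\<And>l j. l < 2 \<Longrightarrow> j < 3 \<Longrightarrow> (\<Sum>i<3. a i * b l i j) = 0" and "i < 3"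
  shows "a i = 0"
proof -
  let ?C = "L3_elem (\<lambda>i. if i = 0 then 0 else a (i - 1))"
  have C: "?C \<in> carrier L3" "L3_coeff ?C 0 = 0" "\<And>i. i < 3 \<Longrightarrow> L3_coeff ?C (Suc i) = a i"
    by (simp_all add: L3_elem)
  have "?C \<odot>\<^bsub>M\<^esub> x = \<zero>\<^bsub>M\<^esub>" if xM: "x \<in> carrier M" for x
  proof -
    obtain u w where x: "x = T u \<oplus>\<^bsub>M\<^esub> S w" using TS_exhaust[OF xM] .
    have "(\<Sum>i<3. \<Sum>j<3. b l i j * L3_coeff ?C (Suc i) * u j) = 0" if l: "l < 2" for l
    proof -
      have "(\<Sum>i<3. \<Sum>j<3. b l i j * L3_coeff ?C (Suc i) * u j) = (\<Sum>i<3. \<Sum>j<3. b l i j * a i * u j)"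
        using C(3) by simp
      also have "\<dots> = (\<Sum>j<3. \<Sum>i<3. b l i j * a i * u j)"
        by (rule sum.swap)
      also have "\<dots> = (\<Sum>j<3. (\<Sum>i<3. a i * b l i j) * u j)"
        by (simp add: sum_distrib_left sum_distrib_right ac_simps)
      also have "\<dots> = 0" using 0[OF l] by simp
      finally show ?thesis .
    qed
    then show ?thesis
      unfolding x smult_TS[OF C(1)] C(2) by (simp add: TS_zero)
  qed
  then have "?C = \<zero>\<^bsub>L3\<^esub>"
    using assms(1) C(1) unfolding faithful_def by blast
  then have "L3_coeff ?C (Suc i) = 0"
    using L3_zero(2)[of "Suc i"] assms(3) by simp
  then show ?thesis using C(3)[OF assms(3)] by simp
qed

text \<open>A common right kernel vector \<open>u\<close> gives an element \<open>T u\<close>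
  outside \<open>EM\<close> that is killed by \<open>E\<close>. The line through it is a simple
  submodule and has a complement.\<close>

lemma no_simple_summand_nondegenerate:
  assumes nss: "\<not> has_simple_summand L3 M"
    and 0: "\<And>l i. l < 2 \<Longrightarrow> i < 3 \<Longrightarrow> (\<Sum>j<3. b l i j * u j) = 0" and p: "p < 3"
  shows "u p = 0"
proof (rule ccontr)
  assume up: "u p \<noteq> 0"
  have CT: "C \<odot>\<^bsub>M\<^esub> T (\<lambda>i. a * u i) = T (\<lambda>i. (L3_coeff C 0 * a) * u i)" if C: "C \<in> carrier L3" for C a
  proof -
    have "(\<Sum>i<3. \<Sum>j<3. b l i j * L3_coeff C (Suc i) * (a * u j)) = 0" if l: "l < 2" for l
    proof -
      have "(\<Sum>i<3. \<Sum>j<3. b l i j * L3_coeff C (Suc i) * (a * u j))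
          = (\<Sum>i<3. L3_coeff C (Suc i) * a * (\<Sum>j<3. b l i j * u j))"
        by (simp add: sum_distrib_left ac_simps)
      also have "\<dots> = 0" using 0[OF l] by simp
      finally show ?thesis .
    qed
    then show ?thesis
      using coordinates_carrier(4) unfolding smult_T[OF C] by (simp add: TS_zero mult.assoc)
  qed
  define S1 where "S1 = {T (\<lambda>i. a * u i) | a. True}"
  \<comment> \<open>Dropping a coordinate \<open>p\<close> with \<open>u p\<close> nonzero leaves a
    complement of the line \<open>S1\<close>. It is a submodule because it contains
    \<open>EM\<close>, where all products with \<open>E\<close> land.\<close>
  define T1 where "T1 = {T u' \<oplus>\<^bsub>M\<^esub> S w | u' w. u' p = 0}"
  have zero: "T (\<lambda>i. 0 * u i) = \<zero>\<^bsub>M\<^esub>" by (rule TS_zero) simp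
  have S1: "LinearCombinations.submodule L3 S1 M"
  proof (rule LinearCombinations.submodule.intro[OF L3_module])
    fix x y assume "x \<in> S1" "y \<in> S1"
    then obtain a c where xy: "x = T (\<lambda>i. a * u i)" "y = T (\<lambda>i. c * u i)" by (auto simp: S1_def)
    have "x \<oplus>\<^bsub>M\<^esub> y = T (\<lambda>i. (a + c) * u i)"
      unfolding xy TS_add(1)[symmetric] by (simp add: distrib_right)
    then show "x \<oplus>\<^bsub>M\<^esub> y \<in> S1" unfolding S1_def by blast
  next
    show "\<zero>\<^bsub>M\<^esub> \<in> S1" unfolding S1_def zero[symmetric] by blast
  next
    fix C :: "'k freealg set" and x assume "C \<in> carrier L3" "x \<in> S1"
    then show "C \<odot>\<^bsub>M\<^esub> x \<in> S1" by (auto simp: S1_def CT)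
  qed (auto simp: S1_def coordinates_carrier(4))
  have T1: "LinearCombinations.submodule L3 T1 M"
  proof (rule LinearCombinations.submodule.intro[OF L3_module])
    fix x y assume "x \<in> T1" "y \<in> T1"
    then obtain u1 w1 u2 w2 where xy: "x = T u1 \<oplus>\<^bsub>M\<^esub> S w1" "y = T u2 \<oplus>\<^bsub>M\<^esub> S w2" "u1 p = 0" "u2 p = 0"
      by (auto simp: T1_def)
    have "x \<oplus>\<^bsub>M\<^esub> y = T (\<lambda>i. u1 i + u2 i) \<oplus>\<^bsub>M\<^esub> S (\<lambda>l. w1 l + w2 l)"
      unfolding xy TS_add using coordinates_carrier(4,6) by (simp add: M.a_ac)
    moreover have "(\<lambda>i. u1 i + u2 i) p = 0" using xy by simp
    ultimately show "x \<oplus>\<^bsub>M\<^esub> y \<in> T1" unfolding T1_def by blast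
  next
    have "\<zero>\<^bsub>M\<^esub> = T (\<lambda>_. 0) \<oplus>\<^bsub>M\<^esub> S (\<lambda>l. 0)" by (simp add: TS_zero)
    then show "\<zero>\<^bsub>M\<^esub> \<in> T1" unfolding T1_def by blast
  next
    fix C :: "'k freealg set" and x assume C: "C \<in> carrier L3" and "x \<in> T1"
    then obtain u1 w1 where x: "x = T u1 \<oplus>\<^bsub>M\<^esub> S w1" "u1 p = 0" by (auto simp: T1_def)
    have "(\<lambda>i. L3_coeff C 0 * u1 i) p = 0" using x by simp
    then show "C \<odot>\<^bsub>M\<^esub> x \<in> T1" unfolding x(1) smult_TS[OF C] T1_def by blast
  qed (auto simp: T1_def coordinates_carrier(4,6))
  have T1u: "T (\<lambda>i. 1 * u i) \<noteq> \<zero>\<^bsub>M\<^esub>"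
  proof
    assume "T (\<lambda>i. 1 * u i) = \<zero>\<^bsub>M\<^esub>"
    then have "T u \<oplus>\<^bsub>M\<^esub> S (\<lambda>l. 0) = T (\<lambda>i. 0) \<oplus>\<^bsub>M\<^esub> S (\<lambda>l. 0)"
      by (simp add: TS_zero)
    then have "u p = 0" by (rule TS_inject(1)[OF _ p])
    then show False using up by simp
  qed
  have "simple_module L3 (M\<lparr>carrier := S1\<rparr>)"
    unfolding simple_module_def
  proof (intro conjI allI impI)
    show "Module.module L3 (M\<lparr>carrier := S1\<rparr>)" by (rule submodule_is_module[OF S1])
    show "carrier (M\<lparr>carrier := S1\<rparr>) \<noteq> {\<zero>\<^bsub>M\<lparr>carrier := S1\<rparr>\<^esub>}"
    proof -
      have "T (\<lambda>i. 1 * u i) \<in> S1" unfolding S1_def by blast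
      then show ?thesis using T1u by auto
    qed
    fix N assume N: "LinearCombinations.submodule L3 N (M\<lparr>carrier := S1\<rparr>)"
    then interpret N: LinearCombinations.submodule L3 N "M\<lparr>carrier := S1\<rparr>" .
    have NS: "N \<subseteq> S1" using N.subset by simp
    have sm: "C \<odot>\<^bsub>M\<^esub> x \<in> N" if "C \<in> carrier L3" "x \<in> N" for C x
      using N.smult_closed[OF that] by simp
    show "N = {\<zero>\<^bsub>M\<lparr>carrier := S1\<rparr>\<^esub>} \<or> N = carrier (M\<lparr>carrier := S1\<rparr>)"
    proof (cases "N \<subseteq> {\<zero>\<^bsub>M\<^esub>}")
      case True
      then show ?thesis using N.zero_closed by auto
    next
      case False
      then obtain a where a: "T (\<lambda>i. a * u i) \<in> N" "T (\<lambda>i. a * u i) \<noteq> \<zero>\<^bsub>M\<^esub>"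
        using NS by (auto simp: S1_def)
      have "a \<noteq> 0" using a(2) zero by auto
      have "T (\<lambda>i. c * u i) \<in> N" for c
        using sm[OF L3_scalar(1) a(1), of "c / a"] \<open>a \<noteq> 0\<close> by (simp add: CT L3_scalar)
      then have "S1 \<subseteq> N" by (auto simp: S1_def)
      then show ?thesis using NS by simp
    qed
  qed
  moreover have "S1 \<inter> T1 = {\<zero>\<^bsub>M\<^esub>}"
  proof
    show "S1 \<inter> T1 \<subseteq> {\<zero>\<^bsub>M\<^esub>}"
    proof
      fix x assume "x \<in> S1 \<inter> T1"
      then have "x \<in> S1" "x \<in> T1" by simp_all
      obtain a where a: "x = T (\<lambda>i. a * u i)" using \<open>x \<in> S1\<close> unfolding S1_def by blast
      obtain u' w where u': "x = T u' \<oplus>\<^bsub>M\<^esub> S w" "u' p = 0"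
        using \<open>x \<in> T1\<close> unfolding T1_def by blast
      note x = a u'
      then have "T (\<lambda>i. a * u i) \<oplus>\<^bsub>M\<^esub> S (\<lambda>l. 0) = T u' \<oplus>\<^bsub>M\<^esub> S w"
        using coordinates_carrier(4) by (simp add: TS_zero)
      then have "a * u p = u' p" by (rule TS_inject(1)[OF _ p])
      then show "x \<in> {\<zero>\<^bsub>M\<^esub>}" using up x zero by simp
    qed
    show "{\<zero>\<^bsub>M\<^esub>} \<subseteq> S1 \<inter> T1"
      using LinearCombinations.submodule.zero_closed[OF S1] LinearCombinations.submodule.zero_closed[OF T1] by blast
  qed
  moreover have "S1 <+>\<^bsub>M\<^esub> T1 = carrier M"
  proof
    show "S1 <+>\<^bsub>M\<^esub> T1 \<subseteq> carrier M"
      using LinearCombinations.submodule.subset[OF S1] LinearCombinations.submodule.subset[OF T1]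
      by (auto simp: set_add_def')
    show "carrier M \<subseteq> S1 <+>\<^bsub>M\<^esub> T1"
    proof
      fix x assume "x \<in> carrier M"
      then obtain u' w where x: "x = T u' \<oplus>\<^bsub>M\<^esub> S w" using TS_exhaust by blast
      define a where "a = u' p / u p"
      define v where "v i = u' i - a * u i" for i
      have "T u' = T (\<lambda>i. a * u i + v i)" by (simp add: v_def)
      then have "x = T (\<lambda>i. a * u i) \<oplus>\<^bsub>M\<^esub> (T v \<oplus>\<^bsub>M\<^esub> S w)"
        unfolding x TS_add using coordinates_carrier(4,6) by (simp add: M.a_assoc)
      moreover have "v p = 0" using up by (simp add: v_def a_def)
      ultimately show "x \<in> S1 <+>\<^bsub>M\<^esub> T1"
        unfolding set_add_def' S1_def T1_def by blast
    qed
  qed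
  ultimately show False
    using nss S1 T1 unfolding has_simple_summand_def by blast
qed

text \<open>The letters and the basis of \<open>EM\<close> stay, and only the lifts of the basis of
  \<open>M/EM\<close> are recombined. The matrix of each form is therefore multiplied by
  \<open>q\<close> on the right alone.\<close>

lemma coordinates_change:
  assumes q': "\<And>i j. i < 3 \<Longrightarrow> j < 3 \<Longrightarrow> (\<Sum>k<3. q i k * q' k j) = (if i = j then 1 else 0)"
    and q: "\<And>i j. i < 3 \<Longrightarrow> j < 3 \<Longrightarrow> (\<Sum>k<3. q' i k * q k j) = (if i = j then 1 else 0)"
  shows "coordinates (\<lambda>j. T (\<lambda>i. q i j)) s (\<lambda>l i j. \<Sum>k<3. b l i k * q k j)"
proof -
  let ?t = "\<lambda>j. T (\<lambda>i. q i j)"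
  have t: "lin_comb (k_space M) 3 ?t u = T (\<lambda>i. \<Sum>j<3. u j * q i j)" for u
    using coordinates_carrier(1) by (intro lin_comb_lin_comb[OF k_module]) simp
  have surj: "\<exists>u' w. x = lin_comb (k_space M) 3 ?t u' \<oplus>\<^bsub>M\<^esub> S w" if xM: "x \<in> carrier M" for x
  proof -
    obtain u w where x: "x = T u \<oplus>\<^bsub>M\<^esub> S w" using TS_exhaust[OF xM] .
    have "(\<Sum>j<3. (\<Sum>k<3. q' j k * u k) * q i j) = u i" if i: "i < 3" for i
    proof -
      have "(\<Sum>j<3. (\<Sum>k<3. q' j k * u k) * q i j) = (\<Sum>j<3. \<Sum>k<3. (q i j * q' j k) * u k)"
        by (simp add: sum_distrib_left sum_distrib_right ac_simps)
      also have "\<dots> = (\<Sum>k<3. \<Sum>j<3. (q i j * q' j k) * u k)"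
        by (rule sum.swap)
      also have "\<dots> = (\<Sum>k<3. (\<Sum>j<3. q i j * q' j k) * u k)"
        by (simp add: sum_distrib_right)
      also have "\<dots> = (\<Sum>k<3. if i = k then u k else 0)"
        using q'[OF i] by (intro sum.cong) auto
      also have "\<dots> = u i" using i by simp
      finally show ?thesis .
    qed
    then have "lin_comb (k_space M) 3 ?t (\<lambda>j. \<Sum>k<3. q' j k * u k) = T u"
      unfolding t using coordinates_carrier(1) by (intro lin_comb_cong[OF k_module]) simp_all
    then show ?thesis
      unfolding x by (intro exI[of _ "\<lambda>j. \<Sum>k<3. q' j k * u k"] exI[of _ w]) simp
  qed
  have inj: "(\<forall>i<3. u i = 0) \<and> (\<forall>l<2. w l = 0)"
    if "lin_comb (k_space M) 3 ?t u \<oplus>\<^bsub>M\<^esub> S w = \<zero>\<^bsub>M\<^esub>" for u w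
  proof -
    have "T (\<lambda>i. \<Sum>j<3. u j * q i j) \<oplus>\<^bsub>M\<^esub> S w = \<zero>\<^bsub>M\<^esub>" using that by (simp only: t)
    then have 0: "\<And>i. i < 3 \<Longrightarrow> (\<Sum>j<3. u j * q i j) = 0" and w: "\<forall>l<2. w l = 0"
      using TS_independent by blast+
    have "u i = 0" if i: "i < 3" for i
    proof -
      have "u i = (\<Sum>j<3. if i = j then u j else 0)" using i by simp
      also have "\<dots> = (\<Sum>j<3. (\<Sum>k<3. q' i k * q k j) * u j)"
        using q[OF i] by (intro sum.cong) auto
      also have "\<dots> = (\<Sum>j<3. \<Sum>k<3. q' i k * (u j * q k j))"
        by (simp add: sum_distrib_left sum_distrib_right ac_simps)
      also have "\<dots> = (\<Sum>k<3. \<Sum>j<3. q' i k * (u j * q k j))"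
        by (rule sum.swap)
      also have "\<dots> = (\<Sum>k<3. q' i k * (\<Sum>j<3. u j * q k j))"
        by (simp add: sum_distrib_left)
      also have "\<dots> = 0" using 0 by simp
      finally show ?thesis .
    qed
    with w show ?thesis by blast
  qed
  have mult: "L3_gen i \<odot>\<^bsub>M\<^esub> ?t j = S (\<lambda>l. \<Sum>k<3. b l i k * q k j)" if "i < 3" for i j
    unfolding gen_T[OF that] by (simp add: mult.commute)
  have "\<forall>i<3. ?t i \<in> carrier M" "\<forall>l<2. s l \<in> EM"
    using coordinates_carrier(2,4) by simp_all
  moreover have "\<forall>x\<in>carrier M. \<exists>u w. x = lin_comb (k_space M) 3 ?t u \<oplus>\<^bsub>M\<^esub> S w"
    by (intro ballI surj)
  moreover have "\<forall>x\<in>EM. \<exists>w. x = S w"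
    using coord by (simp add: coordinates_def)
  moreover have "\<forall>u w. lin_comb (k_space M) 3 ?t u \<oplus>\<^bsub>M\<^esub> S w = \<zero>\<^bsub>M\<^esub> \<longrightarrow>
      (\<forall>i<3. u i = 0) \<and> (\<forall>l<2. w l = 0)"
    by (intro allI impI inj)
  moreover have "\<forall>i<3. \<forall>j<3. L3_gen i \<odot>\<^bsub>M\<^esub> ?t j = S (\<lambda>l. \<Sum>k<3. b l i k * q k j)"
    by (intro allI impI mult)
  ultimately show ?thesis
    unfolding coordinates_def by (intro conjI)
qed

end

end

section \<open>The algebra realizing a module with symmetric structure constants\<close>

lemma ideal_module_sel:
  "carrier (ideal_module A J) = J" "zero (ideal_module A J) = zero A" "add (ideal_module A J) = add A"
  "Module.smult (ideal_module A J) = mult A"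
  by (simp_all add: ideal_module_def)

lemma module_over_quot_sel:
  "carrier (module_over_quot N) = carrier N" "zero (module_over_quot N) = zero N"
  "add (module_over_quot N) = add N"
  "Module.smult (module_over_quot N) = (\<lambda>C x. the_elem ((\<lambda>a. a \<odot>\<^bsub>N\<^esub> x) ` C))"
  by (simp_all add: module_over_quot_def)

context L3_module
begin

context
  fixes t s b
  assumes coord: "coordinates t s b"
    and sym: "\<forall>l<2. \<forall>i<3. \<forall>j<3. b l i j = b l j i"
begin

text \<open>Indices are shifted to the numbering of \<open>form_algebra\<close>. The value 0
  elsewhere makes symmetry hold for all indices, as \<open>form_algebra_algebra\<close> demands, in
  spite of truncated subtraction.\<close>

definition struct_const :: "nat \<Rightarrow> nat \<Rightarrow> nat \<Rightarrow> 'k" where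
  "struct_const l i j = (if l \<in> {4..5} \<and> i \<in> {1..3} \<and> j \<in> {1..3} then b (l - 4) (i - 1) (j - 1) else 0)"

lemma struct_const_sym: "struct_const l i j = struct_const l j i"
  using sym[rule_format, of "l - 4" "i - 1" "j - 1"] by (auto simp: struct_const_def)

abbreviation "A \<equiv> form_algebra struct_const"

abbreviation "J \<equiv> {v \<in> carrier_vec 6. v $ 0 = (0 :: 'k)}"

abbreviation "J2 \<equiv> J \<cdot>\<^bsub>A\<^esub> J"

lemma A_ring: "ring A"
  using algebra.M_cring[OF form_algebra_algebra[OF struct_const_sym]] by (simp add: cring_def)

lemma J2_ideal: "ideal J2 A"
  using form_algebra_radical(3)[OF struct_const_sym] by (intro ring.ideal_prod_is_ideal[OF A_ring])

lemma J2_subgroup: "abelian_subgroup J2 A"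
  using ideal.axioms(1)[OF J2_ideal] ring.is_abelian_group[OF A_ring]
  by (intro abelian_subgroupI3)

lemma form_struct_const:
  assumes "l < 2"
  shows "form struct_const (l + 4) u v = (\<Sum>i<3. \<Sum>j<3. b l i j * u $ Suc i * v $ Suc j)"
proof -
  have "form struct_const (l + 4) u v
      = (\<Sum>i<3. \<Sum>j<3. struct_const (l + 4) (Suc i) (Suc j) * u $ Suc i * v $ Suc j)"
    by (simp add: form_def sum.atLeast1_atMost_eq)
  also have "\<dots> = (\<Sum>i<3. \<Sum>j<3. b l i j * u $ Suc i * v $ Suc j)"
    using assms by (intro sum.cong refl) (simp add: struct_const_def)
  finally show ?thesis .
qed

text \<open>The inverse of the coordinate map of \<open>M\<close>. Coordinate 0 is ignored, so it is
  a bijection on \<open>J\<close> only.\<close>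

definition to_M :: "'k vec \<Rightarrow> 'm" where
  "to_M v = lin_comb (k_space M) 3 t (\<lambda>i. v $ Suc i) \<oplus>\<^bsub>M\<^esub> lin_comb (k_space M) 2 s (\<lambda>l. v $ (l + 4))"

lemma to_M_closed: "to_M v \<in> carrier M"
  using coordinates_carrier(4,6)[OF coord] by (simp add: to_M_def)

lemma to_M_add:
  assumes "u \<in> carrier_vec 6" "v \<in> carrier_vec 6"
  shows "to_M (u + v) = to_M u \<oplus>\<^bsub>M\<^esub> to_M v"
proof -
  note c = coordinates_carrier[OF coord]
  have "lin_comb (k_space M) 3 t (\<lambda>i. (u + v) $ Suc i) = lin_comb (k_space M) 3 t (\<lambda>i. u $ Suc i + v $ Suc i)"
    using assms c(1) by (intro lin_comb_cong[OF k_module]) simp_all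
  moreover have "lin_comb (k_space M) 2 s (\<lambda>l. (u + v) $ (l + 4)) = lin_comb (k_space M) 2 s (\<lambda>l. u $ (l + 4) + v $ (l + 4))"
    using assms c(3) by (intro lin_comb_cong[OF k_module]) simp_all
  ultimately show ?thesis
    using c(4,6) by (simp add: to_M_def TS_add[OF coord] M.a_ac)
qed

lemma to_M_zero: "to_M (0\<^sub>v 6) = \<zero>\<^bsub>M\<^esub>"
proof -
  have "lin_comb (k_space M) 3 t (\<lambda>i. 0\<^sub>v 6 $ Suc i) = \<zero>\<^bsub>M\<^esub>"
    by (rule TS_zero(1)[OF coord]) simp
  moreover have "lin_comb (k_space M) 2 s (\<lambda>l. 0\<^sub>v 6 $ (l + 4)) = \<zero>\<^bsub>M\<^esub>"
    by (rule TS_zero(2)[OF coord]) simp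
  ultimately show ?thesis by (simp add: to_M_def)
qed

lemma to_M_bij: "bij_betw to_M J (carrier M)"
proof (rule bij_betw_imageI)
  show "inj_on to_M J"
  proof (rule inj_onI)
    fix u v assume u: "u \<in> J" and v: "v \<in> J" and eq: "to_M u = to_M v"
    note inj = TS_inject[OF coord eq[unfolded to_M_def]]
    show "u = v"
    proof (rule eq_vecI)
      fix i assume "i < dim_vec v"
      then have "i = 0 \<or> i = Suc 0 \<or> i = Suc 1 \<or> i = Suc 2 \<or> i = 0 + 4 \<or> i = 1 + 4"
        using v by auto
      then show "u $ i = v $ i"
        using u v inj(1)[of 0] inj(1)[of 1] inj(1)[of 2] inj(2)[of 0] inj(2)[of 1] by auto
    qed (use u v in auto)
  qed
  show "to_M ` J = carrier M"
  proof
    show "carrier M \<subseteq> to_M ` J"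
    proof
      fix x assume "x \<in> carrier M"
      then obtain u w where x: "x = lin_comb (k_space M) 3 t u \<oplus>\<^bsub>M\<^esub> lin_comb (k_space M) 2 s w"
        using TS_exhaust[OF coord] by metis
      define v where "v = vec 6 (\<lambda>i. if i = 0 then 0 else if i < 4 then u (i - 1) else w (i - 4))"
      have "lin_comb (k_space M) 3 t (\<lambda>i. v $ Suc i) = lin_comb (k_space M) 3 t u"
        using coordinates_carrier(1)[OF coord] by (intro lin_comb_cong[OF k_module]) (simp_all add: v_def)
      moreover have "lin_comb (k_space M) 2 s (\<lambda>l. v $ (l + 4)) = lin_comb (k_space M) 2 s w"
        using coordinates_carrier(3)[OF coord] by (intro lin_comb_cong[OF k_module]) (simp_all add: v_def)
      ultimately have "x = to_M v" by (simp add: to_M_def x)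
      moreover have "v \<in> J" by (simp add: v_def)
      ultimately show "x \<in> to_M ` J" by blast
    qed
  qed (auto simp: to_M_closed)
qed

text \<open>A linear section of the projection modulo \<open>J2\<close>. It is not multiplicative:
  the product of two lifts may have nonzero coordinates 4 and 5.\<close>

definition lift :: "'k freealg set \<Rightarrow> 'k vec" where
  "lift C = vec 6 (\<lambda>i. if i < 4 then L3_coeff C i else 0)"

lemma lift_carrier: "lift C \<in> carrier_vec 6"
  by (simp add: lift_def)

lemma lift_index: "i < 4 \<Longrightarrow> lift C $ i = L3_coeff C i"
  by (simp add: lift_def)

lemma lift_mult_J:
  assumes "v \<in> J"
  shows "lift C \<otimes>\<^bsub>A\<^esub> v \<in> J"
  using assms by (simp add: form_algebra_mult_closed form_algebra_mult_index)

text \<open>The structure constants were chosen so that multiplication of \<open>J\<close> by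
  \<open>lift C\<close> follows the same formula as \<open>smult_TS\<close>. Everything on the
  module structure of \<open>J\<close> reduces to this.\<close>

lemma to_M_lift_mult:
  assumes C: "C \<in> carrier L3" and v: "v \<in> J"
  shows "to_M (lift C \<otimes>\<^bsub>A\<^esub> v) = C \<odot>\<^bsub>M\<^esub> to_M v"
proof -
  have "lin_comb (k_space M) 3 t (\<lambda>i. (lift C \<otimes>\<^bsub>A\<^esub> v) $ Suc i)
      = lin_comb (k_space M) 3 t (\<lambda>i. L3_coeff C 0 * v $ Suc i)"
    using coordinates_carrier(1)[OF coord] v
    by (intro lin_comb_cong[OF k_module]) (simp_all add: form_algebra_mult_index lift_index form_low)
  moreover have "lin_comb (k_space M) 2 s (\<lambda>l. (lift C \<otimes>\<^bsub>A\<^esub> v) $ (l + 4))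
      = lin_comb (k_space M) 2 s (\<lambda>l. (\<Sum>i<3. \<Sum>j<3. b l i j * L3_coeff C (Suc i) * v $ Suc j)
          + L3_coeff C 0 * v $ (l + 4))"
  proof (rule lin_comb_cong[OF k_module])
    fix l :: nat assume l: "l < 2"
    have "form struct_const (l + 4) (lift C) v = (\<Sum>i<3. \<Sum>j<3. b l i j * L3_coeff C (Suc i) * v $ Suc j)"
      unfolding form_struct_const[OF l] by (intro sum.cong refl) (simp add: lift_index)
    then show "(lift C \<otimes>\<^bsub>A\<^esub> v) $ (l + 4)
        = (\<Sum>i<3. \<Sum>j<3. b l i j * L3_coeff C (Suc i) * v $ Suc j) + L3_coeff C 0 * v $ (l + 4)"
      using v l by (subst form_algebra_mult_index) (simp_all add: lift_index)
  qed (use coordinates_carrier(3)[OF coord] in simp)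
  ultimately show ?thesis
    unfolding to_M_def smult_TS[OF coord C] by simp
qed

text \<open>For the inclusion from right to left, \<open>to_M\<close> maps \<open>J2\<close> onto a
  submodule containing every product of \<open>E\<close> and \<open>M\<close>, hence
  \<open>EM\<close>. A vector supported in coordinates 4 and 5 is sent into \<open>EM\<close>, so it
  lies in \<open>J2\<close> by injectivity of \<open>to_M\<close> on \<open>J\<close>.\<close>

lemma J2_eq: "J2 = {v \<in> carrier_vec 6. \<forall>i<4. v $ i = 0}"
proof
  show "J2 \<subseteq> {v \<in> carrier_vec 6. \<forall>i<4. v $ i = 0}"
    using form_algebra_radical_square[OF _ refl] by blast
  interpret J2: ideal J2 A by (rule J2_ideal)
  have J2J: "J2 \<subseteq> J"
  proof
    fix v assume v: "v \<in> J2"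
    show "v \<in> J"
      using form_algebra_radical_square(1)[OF v refl] form_algebra_radical_square(2)[OF v refl, of 0] by simp
  qed
  let ?Y = "to_M ` J2"
  have "LinearCombinations.submodule L3 ?Y M"
  proof (rule LinearCombinations.submodule.intro[OF L3_module])
    fix x y assume "x \<in> ?Y" "y \<in> ?Y"
    then obtain u v where uv: "u \<in> J2" "v \<in> J2" "x = to_M u" "y = to_M v" by blast
    have "u \<in> carrier_vec 6" "v \<in> carrier_vec 6" using uv(1,2) J2J by auto
    then have "x \<oplus>\<^bsub>M\<^esub> y = to_M (u \<oplus>\<^bsub>A\<^esub> v)"
      by (simp add: uv to_M_add form_algebra_sel)
    moreover have "u \<oplus>\<^bsub>A\<^esub> v \<in> J2" using uv(1,2) by (rule ideal_prod.sum)
    ultimately show "x \<oplus>\<^bsub>M\<^esub> y \<in> ?Y" by blast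
  next
    have "0\<^sub>v 6 \<in> J2"
      using additive_subgroup.zero_closed[OF ideal.axioms(1)[OF J2_ideal]] by (simp add: form_algebra_sel)
    then show "\<zero>\<^bsub>M\<^esub> \<in> ?Y" 
      by (intro image_eqI[of _ to_M, OF to_M_zero[symmetric]])
  next
    fix C :: "'k freealg set" and x assume C: "C \<in> carrier L3" and "x \<in> ?Y"
    then obtain v where v: "v \<in> J2" "x = to_M v" by blast
    have "lift C \<otimes>\<^bsub>A\<^esub> v \<in> J2"
      using J2.I_l_closed[OF v(1)] lift_carrier by (simp add: form_algebra_sel)
    moreover have "C \<odot>\<^bsub>M\<^esub> x = to_M (lift C \<otimes>\<^bsub>A\<^esub> v)"
      using to_M_lift_mult[OF C, of v] v J2J by auto
    ultimately show "C \<odot>\<^bsub>M\<^esub> x \<in> ?Y" by blast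
  qed (auto simp: to_M_closed)
  moreover have "{a \<odot>\<^bsub>M\<^esub> x | a x. a \<in> E \<and> x \<in> carrier M} \<subseteq> ?Y"
  proof
    fix z assume "z \<in> {a \<odot>\<^bsub>M\<^esub> x | a x. a \<in> E \<and> x \<in> carrier M}"
    then obtain a x where z: "z = a \<odot>\<^bsub>M\<^esub> x" "a \<in> E" "x \<in> carrier M" by blast
    then have a: "a \<in> carrier L3" "L3_coeff a 0 = 0" by (simp_all add: E_def)
    obtain v where v: "v \<in> J" "x = to_M v"
      using z(3) to_M_bij unfolding bij_betw_def by blast
    have "lift a \<in> J" using a(2) by (simp add: lift_carrier lift_index)
    then have "lift a \<otimes>\<^bsub>A\<^esub> v \<in> J2" using v(1) by (rule ideal_prod.prod)
    moreover have "z = to_M (lift a \<otimes>\<^bsub>A\<^esub> v)"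
      unfolding z(1) v(2) by (rule to_M_lift_mult[OF a(1) v(1), symmetric])
    ultimately show "z \<in> ?Y" by blast
  qed
  ultimately have EM: "EM \<subseteq> ?Y"
    unfolding ideal_smult_def by (intro span_is_subset)
  show "{v \<in> carrier_vec 6. \<forall>i<4. v $ i = 0} \<subseteq> J2"
  proof
    fix v :: "'k vec" assume v: "v \<in> {v \<in> carrier_vec 6. \<forall>i<4. v $ i = 0}"
    have "lin_comb (k_space M) 3 t (\<lambda>i. v $ Suc i) = \<zero>\<^bsub>M\<^esub>"
      using v by (intro TS_zero(1)[OF coord]) simp
    then have "to_M v = lin_comb (k_space M) 2 s (\<lambda>l. v $ (l + 4))"
      using coordinates_carrier(6)[OF coord] by (simp add: to_M_def)
    then have "to_M v \<in> ?Y"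
      using coordinates_carrier(5)[OF coord] EM by auto
    then obtain u where u: "u \<in> J2" "to_M v = to_M u" by blast
    have "v \<in> J" "u \<in> J" using v u(1) J2J by auto
    then have "v = u"
      by (rule inj_onD[OF bij_betw_imp_inj_on[OF to_M_bij] u(2)])
    with u(1) show "v \<in> J2" by simp
  qed
qed

lemma coset_eq_iff:
  assumes u: "u \<in> carrier_vec 6" and v: "v \<in> carrier_vec 6"
  shows "J2 +>\<^bsub>A\<^esub> u = J2 +>\<^bsub>A\<^esub> v \<longleftrightarrow> (\<forall>i<4. u $ i = v $ i)"
proof
  assume "J2 +>\<^bsub>A\<^esub> u = J2 +>\<^bsub>A\<^esub> v"
  then have "u \<in> J2 +>\<^bsub>A\<^esub> v"
    using abelian_subgroup.a_rcos_self[OF J2_subgroup, of u] u by (simp add: form_algebra_sel)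
  then obtain n where "n \<in> J2" "u = n + v"
    by (auto simp: a_r_coset_def' form_algebra_sel)
  then show "\<forall>i<4. u $ i = v $ i"
    using v by (auto simp: J2_eq)
next
  assume *: "\<forall>i<4. u $ i = v $ i"
  have "u - v \<in> J2" using u v * by (simp add: J2_eq)
  moreover have "u = (u - v) \<oplus>\<^bsub>A\<^esub> v"
    using u v by (intro eq_vecI) (auto simp: form_algebra_sel)
  ultimately have "u \<in> J2 +>\<^bsub>A\<^esub> v"
    unfolding a_r_coset_def' by blast
  then show "J2 +>\<^bsub>A\<^esub> u = J2 +>\<^bsub>A\<^esub> v"
    using abelian_subgroup.a_repr_independence'[OF J2_subgroup, of u v] v by (simp add: form_algebra_sel)
qed

definition L3_to_quot :: "'k freealg set \<Rightarrow> 'k vec set" where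
  "L3_to_quot C = J2 +>\<^bsub>A\<^esub> lift C"

text \<open>\<open>lift\<close> fails to be multiplicative only in coordinates 4 and 5, which
  \<open>J2\<close> absorbs; the remaining four coordinates multiply as in
  \<open>L3\<close>.\<close>

lemma L3_to_quot_iso: "L3_to_quot \<in> algebra_iso L3 (quot A J2)"
proof -
  have c: "carrier A = carrier_vec 6" by (simp add: form_algebra_sel)
  have coset: "L3_to_quot C = J2 +>\<^bsub>A\<^esub> v" if "v \<in> carrier_vec 6" "\<And>i. i < 4 \<Longrightarrow> L3_coeff C i = v $ i" for C v
    unfolding L3_to_quot_def using coset_eq_iff[OF lift_carrier that(1)] that(2) by (simp add: lift_index)
  have "L3_to_quot \<in> Ring.ring_hom L3 (quot A J2)"
  proof (rule Ring.ring_hom_memI)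
    fix C D :: "'k freealg set" assume C: "C \<in> carrier L3"
    show "L3_to_quot C \<in> carrier (quot A J2)"
      using lift_carrier[of C] by (auto simp: quot_carrier L3_to_quot_def c)
    assume D: "D \<in> carrier L3"
    have "L3_to_quot C \<otimes>\<^bsub>quot A J2\<^esub> L3_to_quot D = J2 +>\<^bsub>A\<^esub> (lift C \<otimes>\<^bsub>A\<^esub> lift D)"
      unfolding L3_to_quot_def by (rule quot_mult[OF J2_ideal]) (simp_all add: c lift_carrier)
    then show "L3_to_quot (C \<otimes>\<^bsub>L3\<^esub> D) = L3_to_quot C \<otimes>\<^bsub>quot A J2\<^esub> L3_to_quot D"
      using C D coset[of "lift C \<otimes>\<^bsub>A\<^esub> lift D" "C \<otimes>\<^bsub>L3\<^esub> D"]
      by (simp add: form_algebra_mult_closed form_algebra_mult_index L3_mult lift_index form_low)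
    have "L3_to_quot C \<oplus>\<^bsub>quot A J2\<^esub> L3_to_quot D = J2 +>\<^bsub>A\<^esub> (lift C \<oplus>\<^bsub>A\<^esub> lift D)"
      unfolding L3_to_quot_def by (rule quot_add[OF J2_subgroup]) (simp_all add: c lift_carrier)
    then show "L3_to_quot (C \<oplus>\<^bsub>L3\<^esub> D) = L3_to_quot C \<oplus>\<^bsub>quot A J2\<^esub> L3_to_quot D"
      using C D coset[of "lift C \<oplus>\<^bsub>A\<^esub> lift D" "C \<oplus>\<^bsub>L3\<^esub> D"] lift_carrier[of C] lift_carrier[of D]
      by (simp add: form_algebra_sel L3_add lift_index)
  next
    show "L3_to_quot \<one>\<^bsub>L3\<^esub> = \<one>\<^bsub>quot A J2\<^esub>"
      using coset[of "unit_vec 6 0" "\<one>\<^bsub>L3\<^esub>"] by (simp add: quot_sel form_algebra_sel L3_one)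
  qed
  moreover have "bij_betw L3_to_quot (carrier L3) (carrier (quot A J2))"
  proof (rule bij_betw_imageI)
    show "inj_on L3_to_quot (carrier L3)"
    proof (rule inj_onI)
      fix C D assume CD: "C \<in> carrier L3" "D \<in> carrier L3" "L3_to_quot C = L3_to_quot D"
      then have "\<forall>i<4. lift C $ i = lift D $ i"
        unfolding L3_to_quot_def using coset_eq_iff[OF lift_carrier lift_carrier] by blast
      then show "C = D" using CD(1,2) by (intro L3_eqI) (simp_all add: lift_index)
    qed
    show "L3_to_quot ` carrier L3 = carrier (quot A J2)"
    proof
      show "carrier (quot A J2) \<subseteq> L3_to_quot ` carrier L3"
      proof
        fix X assume "X \<in> carrier (quot A J2)"
        then obtain v where v: "v \<in> carrier_vec 6" "X = J2 +>\<^bsub>A\<^esub> v" by (auto simp: quot_carrier c)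
        have "L3_to_quot (L3_elem (\<lambda>i. v $ i)) = X"
          unfolding v(2) by (rule coset[OF v(1)]) (simp add: L3_elem)
        then show "X \<in> L3_to_quot ` carrier L3" using L3_elem(1) by blast
      qed
    qed (use lift_carrier in \<open>auto simp: quot_carrier L3_to_quot_def c\<close>)
  qed
  moreover have "L3_to_quot (a \<odot>\<^bsub>L3\<^esub> C) = a \<odot>\<^bsub>quot A J2\<^esub> L3_to_quot C" if C: "C \<in> carrier L3" for a C
  proof -
    have "a \<odot>\<^bsub>quot A J2\<^esub> L3_to_quot C = J2 +>\<^bsub>A\<^esub> (a \<odot>\<^bsub>A\<^esub> lift C)"
      unfolding L3_to_quot_def
      by (rule quot_smult[OF J2_subgroup])
        (auto simp: form_algebra_sel lift_carrier J2_eq smult_add_distrib_vec)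
    then show ?thesis
      using C coset[of "a \<odot>\<^bsub>A\<^esub> lift C" "a \<odot>\<^bsub>L3\<^esub> C"] lift_carrier[of C]
      by (simp add: form_algebra_sel L3_smult lift_index)
  qed
  ultimately show ?thesis
    by (simp add: algebra_iso_def ring_iso_def)
qed

lemma J2_J:
  assumes "u \<in> J2" "v \<in> J"
  shows "u \<otimes>\<^bsub>A\<^esub> v = 0\<^sub>v 6"
proof -
  have u: "u \<in> carrier_vec 6" "\<And>i. i < 4 \<Longrightarrow> u $ i = 0" using assms(1) by (auto simp: J2_eq)
  have "form struct_const l u v = 0" for l
    by (rule form_zero(1)) (use u in auto)
  then show ?thesis
    using assms(2) u
    by (intro eq_vecI) (auto simp: form_algebra_mult_index carrier_vecD[OF form_algebra_mult_closed])
qed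

text \<open>Representatives of a coset differ by elements of \<open>J2\<close>, which kill
  \<open>J\<close>. So the image is a singleton, as \<open>the_elem\<close> needs.\<close>

lemma L3_to_quot_action:
  assumes "v \<in> J"
  shows "the_elem ((\<lambda>a. a \<otimes>\<^bsub>A\<^esub> v) ` L3_to_quot C) = lift C \<otimes>\<^bsub>A\<^esub> v"
proof -
  interpret ring A by (rule A_ring)
  have "a \<otimes>\<^bsub>A\<^esub> v = lift C \<otimes>\<^bsub>A\<^esub> v" if a: "a \<in> L3_to_quot C" for a
  proof -
    obtain n where n: "n \<in> J2" "a = n \<oplus>\<^bsub>A\<^esub> lift C"
      using a by (auto simp: L3_to_quot_def a_r_coset_def')
    have "n \<in> carrier A" "v \<in> carrier A" "lift C \<in> carrier A"
      using n(1) assms lift_carrier by (auto simp: J2_eq form_algebra_sel)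
    then have "a \<otimes>\<^bsub>A\<^esub> v = n \<otimes>\<^bsub>A\<^esub> v \<oplus>\<^bsub>A\<^esub> lift C \<otimes>\<^bsub>A\<^esub> v"
      by (simp only: n(2) l_distr)
    then show ?thesis
      using J2_J[OF n(1) assms] form_algebra_mult_closed[of struct_const "lift C" v]
      by (simp add: form_algebra_sel)
  qed
  moreover have "lift C \<in> L3_to_quot C"
    using abelian_subgroup.a_rcos_self[OF J2_subgroup, of "lift C"] lift_carrier
    by (simp add: L3_to_quot_def form_algebra_sel)
  ultimately have "(\<lambda>a. a \<otimes>\<^bsub>A\<^esub> v) ` L3_to_quot C = {lift C \<otimes>\<^bsub>A\<^esub> v}"
    by blast
  then show ?thesis by simp
qed

lemma form_algebra_realizes:
  "fd_comm_local_algebra A" "radical A = J" "annihilates J2 (ideal_module A J)"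
  "module_isomorphic L3 (restrict_scalars L3_to_quot (module_over_quot (ideal_module A J))) M"
proof -
  have alg: "algebra class_ring A" by (rule form_algebra_algebra[OF struct_const_sym])
  then show "fd_comm_local_algebra A"
    using form_algebra_fin_dim[OF alg] form_algebra_radical(2)[OF struct_const_sym]
    by (simp add: fd_comm_local_algebra_def)
  show "radical A = J" by (rule form_algebra_radical(1)[OF struct_const_sym])
  show "annihilates J2 (ideal_module A J)"
    unfolding annihilates_def ideal_module_sel using J2_J by (simp add: form_algebra_sel)
  let ?X = "restrict_scalars L3_to_quot (module_over_quot (ideal_module A J))"
  have sel: "carrier ?X = J" "zero ?X = 0\<^sub>v 6" "add ?X = (+)"
    by (simp_all add: module_over_quot_sel ideal_module_sel form_algebra_sel)
  have sm: "C \<odot>\<^bsub>?X\<^esub> v = lift C \<otimes>\<^bsub>A\<^esub> v" if "v \<in> J" for C v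
    using L3_to_quot_action[OF that] by (simp add: module_over_quot_sel ideal_module_sel)
  have add: "u \<oplus>\<^bsub>?X\<^esub> v \<in> carrier ?X \<and> to_M (u \<oplus>\<^bsub>?X\<^esub> v) = to_M u \<oplus>\<^bsub>M\<^esub> to_M v"
    if "u \<in> carrier ?X" "v \<in> carrier ?X" for u v
    using that carrier_vecD[of v 6] unfolding sel by (auto simp: to_M_add)
  have smult: "C \<odot>\<^bsub>?X\<^esub> v \<in> carrier ?X \<and> to_M (C \<odot>\<^bsub>?X\<^esub> v) = C \<odot>\<^bsub>M\<^esub> to_M v"
    if C: "C \<in> carrier L3" and v: "v \<in> carrier ?X" for C v
  proof -
    have vJ: "v \<in> J" using v sel(1) by simp
    show ?thesis
      unfolding sm[OF vJ] sel(1) using lift_mult_J[OF vJ] to_M_lift_mult[OF C vJ] by (intro conjI)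
  qed
  \<comment> \<open>The module axioms are transported from \<open>M\<close> along
    \<open>to_M\<close>, so none has to be checked for the quotient action itself.\<close>
  have X: "Module.module L3 ?X"
    by (rule module_pullback[where f = to_M, OF L3_module _ _ _ add smult])
      (unfold sel, use to_M_bij to_M_zero in simp_all)
  have "to_M \<in> LinearCombinations.module_hom L3 ?X M"
    unfolding LinearCombinations.module_hom_def using add smult to_M_closed by blast
  then show "module_isomorphic L3 ?X M"
    unfolding module_isomorphic_def using X L3_module to_M_bij
    by (intro conjI bexI[of _ to_M]) (simp_all only: sel(1))
qed

end

end

section \<open>Making the structure constants symmetric, and the conclusion\<close>

lemma sum_mat_vec:
  assumes "i < 3" "v \<in> carrier_vec 3"
  shows "(mat 3 3 (\<lambda>(i, j). f i j) *\<^sub>v v) $ i = (\<Sum>j<3. f i j * v $ j)"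
  using assms by (simp add: scalar_prod_def atLeast0LessThan)

text \<open>In \<open>B l\<close> the row index is a letter and the column index a lift of a basis
  vector of \<open>M/EM\<close>. Hence right kernels concern simple summands and left kernels
  concern faithfulness, and the right factor \<open>Q\<close> is a change of the lifts.\<close>

lemma symmetric_coordinates:
  fixes M :: "('k :: alg_closed_field freealg set, 'm) module"
  assumes "L3_module M" and coord: "L3_module.coordinates M t s b"
    and "faithful L3 M" "\<not> has_simple_summand L3 M"
  shows "\<exists>t' b'. L3_module.coordinates M t' s b' \<and> (\<forall>l<2. \<forall>i<3. \<forall>j<3. b' l i j = b' l j i)"
proof -
  interpret L3_module M by (rule assms(1))
  define B where "B l = mat 3 3 (\<lambda>(i, j). b l i j)" for l
  have B: "B l \<in> carrier_mat 3 3" for l by (simp add: B_def)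
  have BT: "transpose_mat (B l) = mat 3 3 (\<lambda>(i, j). b l j i)" for l
    by (intro eq_matI) (simp_all add: B_def)
  have "nondegenerate 3 (B 0) (B 1)"
    unfolding nondegenerate_def
  proof (intro ballI impI)
    fix v :: "'k vec" assume v: "v \<in> carrier_vec 3" and 0: "B 0 *\<^sub>v v = 0\<^sub>v 3 \<and> B 1 *\<^sub>v v = 0\<^sub>v 3"
    have "(\<Sum>j<3. b l i j * v $ j) = 0" if l: "l < 2" and i: "i < 3" for l i
    proof -
      have "B l *\<^sub>v v = 0\<^sub>v 3" using 0 l by (auto simp: less_2_cases_iff)
      then show ?thesis
        using sum_mat_vec[OF i v, of "b l"] i by (simp add: B_def)
    qed
    then have "v $ p = 0" if "p < 3" for p
      using no_simple_summand_nondegenerate[OF coord assms(4) _ that, of "\<lambda>j. v $ j"] by blast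
    then show "v = 0\<^sub>v 3"
      using v by (intro eq_vecI) auto
  qed
  moreover have "nondegenerate 3 (transpose_mat (B 0)) (transpose_mat (B 1))"
    unfolding nondegenerate_def
  proof (intro ballI impI)
    fix v :: "'k vec" assume v: "v \<in> carrier_vec 3"
      and 0: "transpose_mat (B 0) *\<^sub>v v = 0\<^sub>v 3 \<and> transpose_mat (B 1) *\<^sub>v v = 0\<^sub>v 3"
    have "(\<Sum>i<3. v $ i * b l i j) = 0" if l: "l < 2" and j: "j < 3" for l j
    proof -
      have "transpose_mat (B l) *\<^sub>v v = 0\<^sub>v 3" using 0 l by (auto simp: less_2_cases_iff)
      then show ?thesis
        using sum_mat_vec[OF j v, of "\<lambda>j i. b l i j"] j by (simp add: BT mult.commute)
    qed
    then have "v $ p = 0" if "p < 3" for p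
      using faithful_nondegenerate[OF coord assms(3) _ that, of "\<lambda>j. v $ j"] by blast
    then show "v = 0\<^sub>v 3"
      using v by (intro eq_vecI) auto
  qed
  ultimately obtain Q where Q: "Q \<in> carrier_mat 3 3" "det Q \<noteq> 0" "symmetrizes Q (B 0)" "symmetrizes Q (B 1)"
    using pencil3_symmetrizable[OF B B] unfolding symmetrizable_def by blast
  obtain Q' where Q': "Q' \<in> carrier_mat 3 3" "Q * Q' = 1\<^sub>m 3" "Q' * Q = 1\<^sub>m 3"
    using obtain_mat_inverse[OF Q(1,2)] by metis
  have prod: "(X * Y) $$ (i, j) = (\<Sum>k<3. X $$ (i, k) * Y $$ (k, j))"
    if "X \<in> carrier_mat 3 3" "Y \<in> carrier_mat 3 3" "i < 3" "j < 3" for X Y :: "'k mat" and i j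
    using that by (simp add: scalar_prod_def atLeast0LessThan)
  let ?b = "\<lambda>l i j. \<Sum>k<3. b l i k * Q $$ (k, j)"
  have "coordinates (\<lambda>j. lin_comb (k_space M) 3 t (\<lambda>i. Q $$ (i, j))) s ?b"
  proof (rule coordinates_change[OF coord])
    fix i j :: nat assume ij: "i < 3" "j < 3"
    show "(\<Sum>k<3. Q $$ (i, k) * Q' $$ (k, j)) = (if i = j then 1 else 0)"
      using ij prod[OF Q(1) Q'(1) ij] by (simp add: Q'(2))
    show "(\<Sum>k<3. Q' $$ (i, k) * Q $$ (k, j)) = (if i = j then 1 else 0)"
      using ij prod[OF Q'(1) Q(1) ij] by (simp add: Q'(3))
  qed
  moreover have "?b l i j = ?b l j i" if l: "l < 2" and ij: "i < 3" "j < 3" for l i j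
  proof -
    have "symmetrizes Q (B l)" using Q(3,4) l by (auto simp: less_2_cases_iff)
    then have T: "transpose_mat (B l * Q) = B l * Q" by (simp add: symmetrizes_def)
    have entry: "(B l * Q) $$ (i, j) = ?b l i j" if ij: "i < 3" "j < 3" for i j
      using prod[OF B[of l] Q(1) ij] ij by (simp add: B_def)
    have "(B l * Q) $$ (i, j) = transpose_mat (B l * Q) $$ (i, j)"
      by (simp only: T)
    also have "\<dots> = (B l * Q) $$ (j, i)"
      using B[of l] Q(1) ij by (intro index_transpose_mat) simp_all
    finally show ?thesis using entry ij by simp
  qed
  ultimately show ?thesis by blast
qed

theorem proposition11p1:
  fixes M :: "('k::alg_closed_field freealg set, 'm) module"
  assumes "special M"
  shows "\<exists>(A :: ('k, 'k vec) module) \<phi>.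
    fd_comm_local_algebra A \<and>
    (let J = radical A; J2 = J \<cdot>\<^bsub>A\<^esub> J
     in \<phi> \<in> algebra_iso L3 (quot A J2) \<and>
        annihilates J2 (ideal_module A J) \<and>
        module_isomorphic L3
          (restrict_scalars \<phi> (module_over_quot (ideal_module A J))) M)"
proof -
  have M: "Module.module L3 M" "finitely_generated L3 M" "dim_vector L3 M = (3, 2)"
    "faithful L3 M" "\<not> has_simple_summand L3 M"
    using assms by (simp_all add: special_def)
  interpret L3_module M by (rule L3_module.intro[OF M(1)])
  obtain t0 s b0 where c0: "coordinates t0 s b0"
    using coordinates_exist[OF M(2,3)] .
  obtain t b where c: "coordinates t s b" and sym: "\<forall>l<2. \<forall>i<3. \<forall>j<3. b l i j = b l j i"
    using symmetric_coordinates[OF L3_module_axioms c0 M(4,5)] by blast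
  note R = form_algebra_realizes[OF c sym]
  have "(let J = radical (form_algebra (struct_const b)); J2 = J \<cdot>\<^bsub>form_algebra (struct_const b)\<^esub> J
     in L3_to_quot b \<in> algebra_iso L3 (quot (form_algebra (struct_const b)) J2) \<and>
        annihilates J2 (ideal_module (form_algebra (struct_const b)) J) \<and>
        module_isomorphic L3
          (restrict_scalars (L3_to_quot b) (module_over_quot (ideal_module (form_algebra (struct_const b)) J))) M)"
    unfolding R(2) Let_def using L3_to_quot_iso[OF c sym] R(3,4) by blast
  then show ?thesis using R(1) by blast
qed

end
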